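(* Let $m,n\in\mathbb N$ be such that $n\ge2$ and $m\le n-1$, and let $\Omega\subset\mathbb R^n$ be a bounded domain with Lipschitz boundary and $|\Omega|=1$. Then there is no largest Orlicz space $L^A(\Omega)$ such that $$W^mL^A(\Omega)\hookrightarrow L^{\infty,\frac nm;-1}(\Omega),$$ where $L^{\infty,\frac nm;-1}(\Omega)$ is the space of measurable functions $f$ on $\Omega$ with $$\|f\|_{\infty,\frac nm;-1}=\left(\int_0^1\Bigl(\frac{f^{**}(t)}{1-\log t}\Bigr)^{\frac nm}\frac{dt}{t}\right)^{\frac mn}<\infty .$$
   Context: $\Omega$ carries Lebesgue measure $|\cdot|$. For measurable $f$ on $\Omega$, $f_*(\lambda)=|\{|f|>\lambda\}|$, $f^*(t)=\inf\{\lambda\ge0:f_*(\lambda)\le t\}$, $f^{**}(t)=\frac1t\int_0^tf^*$. A function $A:[0,\infty]\to[0,\infty]$ is quasi-convex if it is left-continuous, not identically zero or infinity on $(0,\infty]$, $A(0)=0$, and $A(t)/t$ is non-decreasing on $(0,\infty)$; a Young function is a convex quasi-convex function. The Orlicz space $L^A(\Omega)$, for $A$ quasi-convex, is the set of measurable $f$ with $\|f\|_{L^A}=\inf\{\lambda>0:\int_\Omega A(|f|/\lambda)\le1\}<\infty$ (each such space coincides, up to equivalent norms, with one generated by a Young function). $W^mL^A(\Omega)$ is the space of ($m$-times) weakly differentiable $u:\Omega\to\mathbb R$ with $|\nabla^ku|\in L^A(\Omega)$ for $k=0,\dots,m$ ($\nabla^ku$ the vector of all $k$-th order weak partial derivatives,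 $\nabla^0u=u$, $|\cdot|$ the Euclidean norm), with norm $\|u\|_{W^mL^A}=\sum_{k=0}^m\||\nabla^ku|\|_{L^A}$. $W^mL^A\hookrightarrow Y$ means $\|u\|_Y\le C\|u\|_{W^mL^A}$ for all $u\in W^mL^A$, with some constant $C$. A largest Orlicz space with a property is an Orlicz space over $\Omega$ having the property and containing every Orlicz space over $\Omega$ having the property. *)

theory Defs
  imports "HOL-Analysis.Analysis"
begin

section \<open>Bounded Lipschitz domains\<close>

text \<open>Near each boundary point, in suitably rotated coordinates, the set is the epigraph of a
  Lipschitz function. The unit vector \<open>e\<close> is the last coordinate direction, and the remaining
  \<open>n - 1\<close> coordinates of \<open>y\<close> are its projection to the hyperplane orthogonal to \<open>e\<close>.\<close>

definition lipschitz_boundary :: "(real ^ 'n) set \<Rightarrow> bool" where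
  "lipschitz_boundary \<Omega> \<longleftrightarrow>
     (\<forall>x \<in> frontier \<Omega>. \<exists>r>0. \<exists>e \<gamma> L. norm e = 1 \<and> L-lipschitz_on {z. z \<bullet> e = 0} \<gamma> \<and>
        \<Omega> \<inter> ball x r = {y \<in> ball x r. y \<bullet> e > \<gamma> (y - (y \<bullet> e) *\<^sub>R e)})"

definition bounded_lipschitz_domain :: "(real ^ 'n) set \<Rightarrow> bool" where
  "bounded_lipschitz_domain \<Omega> \<longleftrightarrow>
     open \<Omega> \<and> connected \<Omega> \<and> \<Omega> \<noteq> {} \<and> bounded \<Omega> \<and> lipschitz_boundary \<Omega>"


section \<open>Rearrangements\<close>

text \<open>Functions on \<open>\<Omega>\<close> are total functions whose values outside \<open>\<Omega>\<close> are never used.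
  Rearrangements and norms take values in \<open>[0, \<infinity>]\<close>.\<close>

definition distribution_fun :: "(real ^ 'n) set \<Rightarrow> (real ^ 'n \<Rightarrow> real) \<Rightarrow> real \<Rightarrow> ennreal" where
  "distribution_fun \<Omega> f l = emeasure lebesgue {x \<in> \<Omega>. \<bar>f x\<bar> > l}"

definition rearrangement :: "(real ^ 'n) set \<Rightarrow> (real ^ 'n \<Rightarrow> real) \<Rightarrow> real \<Rightarrow> ennreal" where
  "rearrangement \<Omega> f t = Inf {ennreal l |l. l \<ge> 0 \<and> distribution_fun \<Omega> f l \<le> ennreal t}"

definition max_rearrangement :: "(real ^ 'n) set \<Rightarrow> (real ^ 'n \<Rightarrow> real) \<Rightarrow> real \<Rightarrow> ennreal" where
  "max_rearrangement \<Omega> f t = (\<integral>\<^sup>+s \<in> {0..t}. rearrangement \<Omega> f s \<partial>lborel) / ennreal t"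

text \<open>Powers on \<open>[0, \<infinity>]\<close> with a positive real exponent.\<close>

definition ennreal_powr :: "ennreal \<Rightarrow> real \<Rightarrow> ennreal" where
  "ennreal_powr x p = (if x = \<infinity> then \<infinity> else ennreal (enn2real x powr p))"

text \<open>The functional of \<open>L\<^sup>\<infinity>\<^sup>,\<^sup>q\<^sup>;\<^sup>-\<^sup>1(\<Omega>)\<close>, for \<open>|\<Omega>| = 1\<close>.\<close>

definition LZ_norm :: "real \<Rightarrow> (real ^ 'n) set \<Rightarrow> (real ^ 'n \<Rightarrow> real) \<Rightarrow> ennreal" where
  "LZ_norm q \<Omega> f =
     ennreal_powr
       (\<integral>\<^sup>+t \<in> {0<..<1}. ennreal_powr (max_rearrangement \<Omega> f t / ennreal (1 - ln t)) q / ennreal t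
          \<partial>lborel)
       (1 / q)"

definition LZ_space :: "real \<Rightarrow> (real ^ 'n) set \<Rightarrow> (real ^ 'n \<Rightarrow> real) set" where
  "LZ_space q \<Omega> = {f \<in> borel_measurable (lebesgue_on \<Omega>). LZ_norm q \<Omega> f < \<infinity>}"


section \<open>Orlicz spaces\<close>

definition quasi_convex :: "(ennreal \<Rightarrow> ennreal) \<Rightarrow> bool" where
  "quasi_convex A \<longleftrightarrow>
     (\<forall>t>0. continuous (at_left t) A) \<and>
     \<not> (\<forall>t>0. A t = 0) \<and> \<not> (\<forall>t>0. A t = \<infinity>) \<and>
     A 0 = 0 \<and>
     (\<forall>s t. 0 < s \<and> s \<le> t \<and> t < \<infinity> \<longrightarrow> A s / s \<le> A t / t)"

definition orlicz_norm ::
    "(ennreal \<Rightarrow> ennreal) \<Rightarrow> (real ^ 'n) set \<Rightarrow> (real ^ 'n \<Rightarrow> real) \<Rightarrow> ennreal" where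
  "orlicz_norm A \<Omega> f =
     Inf {ennreal l |l. l > 0 \<and> (\<integral>\<^sup>+x. A (ennreal (\<bar>f x\<bar> / l)) \<partial>lebesgue_on \<Omega>) \<le> 1}"

definition orlicz_space ::
    "(ennreal \<Rightarrow> ennreal) \<Rightarrow> (real ^ 'n) set \<Rightarrow> (real ^ 'n \<Rightarrow> real) set" where
  "orlicz_space A \<Omega> = {f \<in> borel_measurable (lebesgue_on \<Omega>). orlicz_norm A \<Omega> f < \<infinity>}"


section \<open>Weak derivatives\<close>

text \<open>A \<open>k\<close>-th order partial derivative is indexed by the list of its \<open>k\<close> coordinate directions.\<close>

definition partial_deriv :: "'n \<Rightarrow> (real ^ 'n \<Rightarrow> real) \<Rightarrow> real ^ 'n \<Rightarrow> real" where
  "partial_deriv i f x = deriv (\<lambda>t. f (x + t *\<^sub>R axis i 1)) 0"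

definition partial_derivs :: "'n list \<Rightarrow> (real ^ 'n \<Rightarrow> real) \<Rightarrow> real ^ 'n \<Rightarrow> real" where
  "partial_derivs I f = foldr partial_deriv I f"

text \<open>The test functions \<open>C\<^sub>c\<^sup>\<infinity>(\<Omega>)\<close>, extended by zero to the whole space.\<close>

definition test_function :: "(real ^ 'n) set \<Rightarrow> (real ^ 'n \<Rightarrow> real) \<Rightarrow> bool" where
  "test_function \<Omega> \<phi> \<longleftrightarrow>
     (\<forall>I. partial_derivs I \<phi> differentiable_on UNIV) \<and>
     compact (closure {x. \<phi> x \<noteq> 0}) \<and> closure {x. \<phi> x \<noteq> 0} \<subseteq> \<Omega>"

definition locally_integrable_on :: "(real ^ 'n \<Rightarrow> real) \<Rightarrow> (real ^ 'n) set \<Rightarrow> bool" where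
  "locally_integrable_on u \<Omega> \<longleftrightarrow> (\<forall>K. compact K \<and> K \<subseteq> \<Omega> \<longrightarrow> u absolutely_integrable_on K)"

definition has_weak_partial ::
    "(real ^ 'n) set \<Rightarrow> 'n list \<Rightarrow> (real ^ 'n \<Rightarrow> real) \<Rightarrow> (real ^ 'n \<Rightarrow> real) \<Rightarrow> bool" where
  "has_weak_partial \<Omega> I u v \<longleftrightarrow>
     locally_integrable_on u \<Omega> \<and> locally_integrable_on v \<Omega> \<and>
     (\<forall>\<phi>. test_function \<Omega> \<phi> \<longrightarrow>
        (LINT x|lebesgue_on \<Omega>. u x * partial_derivs I \<phi> x) =
        (-1) ^ length I * (LINT x|lebesgue_on \<Omega>. v x * \<phi> x))"

definition weakly_differentiable :: "nat \<Rightarrow> (real ^ 'n) set \<Rightarrow> (real ^ 'n \<Rightarrow> real) \<Rightarrow> bool" where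
  "weakly_differentiable m \<Omega> u \<longleftrightarrow> (\<forall>I. length I \<le> m \<longrightarrow> (\<exists>v. has_weak_partial \<Omega> I u v))"

text \<open>A weak derivative is unique up to null sets, so the choice does not affect any norm below.\<close>

definition weak_partial ::
    "(real ^ 'n) set \<Rightarrow> 'n list \<Rightarrow> (real ^ 'n \<Rightarrow> real) \<Rightarrow> real ^ 'n \<Rightarrow> real" where
  "weak_partial \<Omega> I u = (if I = [] then u else (SOME v. has_weak_partial \<Omega> I u v))"

text \<open>The Euclidean length of the vector \<open>\<nabla>\<^sup>ku(x)\<close>, whose entries are all the
  \<open>\<partial>\<^sub>i\<^sub>1\<dots>\<partial>\<^sub>i\<^sub>k u(x)\<close>.\<close>

definition weak_grad_length ::
    "(real ^ 'n) set \<Rightarrow> nat \<Rightarrow> (real ^ 'n \<Rightarrow> real) \<Rightarrow> real ^ 'n \<Rightarrow> real" where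
  "weak_grad_length \<Omega> k u x = L2_set (\<lambda>I. weak_partial \<Omega> I u x) {I. length I = k}"


section \<open>Orlicz--Sobolev spaces and the embedding property\<close>

definition orlicz_sobolev_space ::
    "nat \<Rightarrow> (ennreal \<Rightarrow> ennreal) \<Rightarrow> (real ^ 'n) set \<Rightarrow> (real ^ 'n \<Rightarrow> real) set" where
  "orlicz_sobolev_space m A \<Omega> =
     {u. u \<in> borel_measurable (lebesgue_on \<Omega>) \<and> weakly_differentiable m \<Omega> u \<and>
         (\<forall>k\<le>m. weak_grad_length \<Omega> k u \<in> orlicz_space A \<Omega>)}"

definition orlicz_sobolev_norm ::
    "nat \<Rightarrow> (ennreal \<Rightarrow> ennreal) \<Rightarrow> (real ^ 'n) set \<Rightarrow> (real ^ 'n \<Rightarrow> real) \<Rightarrow> ennreal" where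
  "orlicz_sobolev_norm m A \<Omega> u = (\<Sum>k\<le>m. orlicz_norm A \<Omega> (weak_grad_length \<Omega> k u))"

definition continuously_embedded ::
    "'f set \<Rightarrow> ('f \<Rightarrow> ennreal) \<Rightarrow> 'f set \<Rightarrow> ('f \<Rightarrow> ennreal) \<Rightarrow> bool" where
  "continuously_embedded X normX Y normY \<longleftrightarrow>
     X \<subseteq> Y \<and> (\<exists>C::real. C > 0 \<and> (\<forall>u\<in>X. normY u \<le> ennreal C * normX u))"

text \<open>\<open>L\<^sup>A(\<Omega>)\<close> is a largest Orlicz space with the property \<open>P\<close> of the generating function.\<close>

definition largest_orlicz_space ::
    "(real ^ 'n) set \<Rightarrow> ((ennreal \<Rightarrow> ennreal) \<Rightarrow> bool) \<Rightarrow> (ennreal \<Rightarrow> ennreal) \<Rightarrow> bool" where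
  "largest_orlicz_space \<Omega> P A \<longleftrightarrow>
     quasi_convex A \<and> P A \<and>
     (\<forall>B. quasi_convex B \<and> P B \<longrightarrow> orlicz_space B \<Omega> \<subseteq> orlicz_space A \<Omega>)"

end

theory Submission
  imports Defs
begin

text \<open>Put \<open>q = n / m > 1\<close>. The embedding forces \<open>A\<close> to exceed a multiple of the critical power
  \<open>s\<^sup>q\<close> at arbitrarily large arguments \<open>s\<close>. On the other hand, it still holds for functions
  \<open>B\<close> that are smaller than this power by a power of the logarithm at arguments that are
  very far apart. If these arguments are taken from those at which \<open>A\<close> is large, then \<open>L\<^sup>B\<close>
  satisfies the embedding without being contained in \<open>L\<^sup>A\<close>.

  Suppose that \<open>L\<^sup>A\<close> is the largest space. If, for every \<open>\<epsilon> > 0\<close>, eventually \<open>A(s) \<le> \<epsilon> s\<^sup>q\<close>,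
  let \<open>u\<close> be the sum of the dilations \<open>\<psi>(2\<^sup>j(x - x\<^sub>0) / r)\<close> of a smooth bump for \<open>M \<le> j \<le> 2M\<close>.
  On the shell \<open>\<bar>x - x\<^sub>0\<bar> \<approx> 2\<^sup>-\<^sup>i\<close> all derivatives up to order \<open>m\<close> are at most of size \<open>2\<^sup>i\<^sup>m\<close>,
  hence all shells contribute at most of order \<open>\<epsilon>\<close> to the integral of \<open>A\<close>, and the Sobolev
  norm of \<open>u\<close> is at most of order \<open>(\<epsilon>M)\<^sup>1\<^sup>/\<^sup>q\<close>. But \<open>u\<close> is at least of order \<open>M\<close> on a ball of
  volume about \<open>4\<^sup>-\<^sup>M\<^sup>n\<close>, and this makes its norm in the target space at least of order \<open>M\<^sup>1\<^sup>/\<^sup>q\<close>.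
  For small \<open>\<epsilon>\<close> this contradicts the embedding. Hence there is an \<open>\<epsilon> > 0\<close> with \<open>A(s) > \<epsilon> s\<^sup>q\<close>
  for arbitrarily large \<open>s\<close> (lemma \<open>embedded_imp_large\<close>).

  Choose a very sparse sequence \<open>S\<^sub>k = (k + 1)\<sigma>\<^sub>k\<close> with \<open>A(\<sigma>\<^sub>k) > \<epsilon> \<sigma>\<^sub>k\<^sup>q\<close>, and let \<open>B(s) = c\<^sub>k s\<close>
  for \<open>S\<^sub>k\<^sub>-\<^sub>1 < s \<le> S\<^sub>k\<close>, where \<open>c\<^sub>k\<close> is such that \<open>B(S\<^sub>k) = S\<^sub>k\<^sup>q (ln S\<^sub>k)\<^sup>-\<^sup>\<delta>\<close>, with
  \<open>\<delta> = (q - 1) / 2\<close>. The function \<open>f\<close> that takes the values \<open>S\<^sub>k\<close> on concentric balls of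
  volume \<open>2\<^sup>-\<^sup>k\<^sup>-\<^sup>1 / B(S\<^sub>k)\<close>, with the larger values on the smaller balls, lies in \<open>L\<^sup>B\<close>. It is
  not in \<open>L\<^sup>A\<close>, because \<open>A(S\<^sub>k / (k + 1))\<close> exceeds \<open>2\<^sup>k\<^sup>+\<^sup>1 B(S\<^sub>k)\<close> (lemma
  \<open>step_young_separation\<close>).

  It remains to see that \<open>B\<close> has the embedding property (lemma \<open>step_young_embedded\<close>), and
  this contradicts the maximality of \<open>L\<^sup>A\<close>. On a bounded Lipschitz domain, \<open>\<bar>u\<bar>\<close> is almost
  everywhere bounded by the \<open>L\<^sup>1\<close> norms of its derivatives of order less than \<open>m\<close> and a
  potential of order \<open>m\<close> of \<open>\<bar>\<nabla>\<^sup>mu\<bar>\<close> (lemma \<open>sobolev_potential_bound\<close>). This is proved by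
  integrating mollifications of \<open>u\<close> along the segments of a cone that is contained in the
  domain. Given \<open>0 < t < 1\<close>, the function \<open>\<bar>\<nabla>\<^sup>mu\<bar>\<close> is split at the values \<open>S\<^sub>k\<^sub>-\<^sub>1\<close> and \<open>S\<^sub>k\<close>
  with \<open>c\<^sub>k < 1/t \<le> c\<^sub>k\<^sub>+\<^sub>1\<close>. The part above \<open>S\<^sub>k\<close> has mass at most \<open>t\<close>, so its potential
  contributes at most a constant to \<open>u\<^sup>*\<^sup>*(t)\<close>. The part between the two values has mass at
  most \<open>1 / c\<^sub>k\<close>, so its potential is at most of order \<open>(ln S\<^sub>k)\<^sup>\<beta>\<close>, with \<open>\<beta> = \<delta> / q\<close>. The part
  below \<open>S\<^sub>k\<^sub>-\<^sub>1\<close> has a potential of order \<open>S\<^sub>k\<^sub>-\<^sub>1\<close>, which is at most \<open>(ln S\<^sub>k)\<^sup>\<beta>\<close> because the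
  sequence is sparse. Since \<open>ln S\<^sub>k\<close> is at most of order \<open>ln c\<^sub>k < ln (1/t)\<close>, altogether
  \<open>u\<^sup>*\<^sup>*(t)\<close> is at most of order \<open>(1 - ln t)\<^sup>\<beta>\<close>. Such functions have finite norm in the target
  space, since \<open>(1 - \<beta>) q > 1\<close>.\<close>

section \<open>Smooth functions and test functions\<close>

definition smooth :: "(real ^ 'n \<Rightarrow> real) \<Rightarrow> bool" where
  "smooth \<phi> \<longleftrightarrow> (\<forall>I. partial_derivs I \<phi> differentiable_on UNIV)"

lemma partial_derivs_Nil [simp]: "partial_derivs [] \<phi> = \<phi>"
  by (simp add: partial_derivs_def)

lemma partial_derivs_Cons [simp]:
  "partial_derivs (i # I) \<phi> = partial_deriv i (partial_derivs I \<phi>)"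
  by (simp add: partial_derivs_def)

lemma partial_derivs_append:
  "partial_derivs (I @ J) \<phi> = partial_derivs I (partial_derivs J \<phi>)"
  by (simp add: partial_derivs_def)

lemma smooth_partial_derivs: "smooth \<phi> \<Longrightarrow> smooth (partial_derivs J \<phi>)"
  unfolding smooth_def by (metis partial_derivs_append)

lemma smooth_partial_deriv: "smooth \<phi> \<Longrightarrow> smooth (partial_deriv i \<phi>)"
  using smooth_partial_derivs[of \<phi> "[i]"] by simp

lemma smooth_differentiable: "smooth \<phi> \<Longrightarrow> \<phi> differentiable (at x)"
  unfolding smooth_def differentiable_on_def by (metis UNIV_I partial_derivs_Nil)

lemma smooth_continuous: "smooth \<phi> \<Longrightarrow> continuous_on S \<phi>"
  by (meson continuous_at_imp_continuous_on differentiable_imp_continuous_within smooth_differentiable)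

lemma smooth_borel: "smooth \<phi> \<Longrightarrow> \<phi> \<in> borel_measurable borel"
  by (simp add: borel_measurable_continuous_onI smooth_continuous)

lemma has_derivative_partial_deriv:
  fixes \<phi> :: "real ^ 'n \<Rightarrow> real"
  assumes "\<phi> differentiable (at x)"
  shows "(\<phi> has_derivative (\<lambda>w. \<Sum>i\<in>UNIV. w $ i * partial_deriv i \<phi> x)) (at x)"
proof -
  obtain D where D: "(\<phi> has_derivative D) (at x)"
    using assms by (auto simp: differentiable_def)
  interpret linear D using D has_derivative_linear by blast
  have pd: "partial_deriv i \<phi> x = D (axis i 1)" for i
  proof -
    have "((\<lambda>t. \<phi> (x + t *\<^sub>R axis i 1)) has_derivative (\<lambda>t. D (t *\<^sub>R axis i 1))) (at 0)"
      by (rule has_derivative_compose[where f = "\<lambda>t. x + t *\<^sub>R axis i 1" and g = \<phi>, simplified])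
         (auto intro!: derivative_eq_intros D)
    then have "((\<lambda>t. \<phi> (x + t *\<^sub>R axis i 1)) has_real_derivative D (axis i 1)) (at 0)"
      by (simp add: has_field_derivative_def scale mult_commute_abs)
    then show ?thesis
      unfolding partial_deriv_def by (rule DERIV_imp_deriv)
  qed
  have "D w = (\<Sum>i\<in>UNIV. w $ i * partial_deriv i \<phi> x)" for w
  proof -
    have "D w = D (\<Sum>i\<in>UNIV. w $ i *\<^sub>R axis i 1)"
      using basis_expansion[of w] by (simp add: scalar_mult_eq_scaleR)
    also have "\<dots> = (\<Sum>i\<in>UNIV. w $ i * D (axis i 1))"
      by (simp add: sum scale)
    finally show ?thesis by (simp add: pd)
  qed
  then have "D = (\<lambda>w. \<Sum>i\<in>UNIV. w $ i * partial_deriv i \<phi> x)" by (rule ext)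
  with D show ?thesis by simp
qed

lemma has_real_derivative_along_line:
  fixes \<phi> :: "real ^ 'n \<Rightarrow> real"
  assumes "\<phi> differentiable (at (x + t *\<^sub>R w))"
  shows "((\<lambda>t. \<phi> (x + t *\<^sub>R w)) has_real_derivative
     (\<Sum>i\<in>UNIV. w $ i * partial_deriv i \<phi> (x + t *\<^sub>R w))) (at t)"
proof -
  have "((\<lambda>t. \<phi> (x + t *\<^sub>R w)) has_derivative
      (\<lambda>s. \<Sum>i\<in>UNIV. (s *\<^sub>R w) $ i * partial_deriv i \<phi> (x + t *\<^sub>R w))) (at t)"
    by (rule has_derivative_compose[where f = "\<lambda>t. x + t *\<^sub>R w" and g = \<phi>])
       (auto intro!: derivative_eq_intros has_derivative_partial_deriv assms)
  moreover have "(\<lambda>s. \<Sum>i\<in>UNIV. (s *\<^sub>R w) $ i * partial_deriv i \<phi> (x + t *\<^sub>R w))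
      = (*) (\<Sum>i\<in>UNIV. w $ i * partial_deriv i \<phi> (x + t *\<^sub>R w))"
    by (simp add: fun_eq_iff sum_distrib_left ac_simps)
  ultimately show ?thesis by (simp add: has_field_derivative_def)
qed

lemma partial_deriv_eqI:
  assumes "((\<lambda>t. \<phi> (x + t *\<^sub>R axis i 1)) has_real_derivative d) (at 0)"
  shows "partial_deriv i \<phi> x = d"
  using assms unfolding partial_deriv_def by (rule DERIV_imp_deriv)

lemma has_real_derivative_axis:
  fixes \<phi> :: "real ^ 'n \<Rightarrow> real"
  assumes "\<phi> differentiable (at x)"
  shows "((\<lambda>t. \<phi> (x + t *\<^sub>R axis i 1)) has_real_derivative partial_deriv i \<phi> x) (at 0)"
proof -
  have "(\<Sum>j\<in>UNIV. (axis i 1 :: real ^ 'n) $ j * partial_deriv j \<phi> x) = partial_deriv i \<phi> x"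
    by (simp add: axis_def if_distrib[of "\<lambda>z. z * _"] cong: if_cong)
  with has_real_derivative_along_line[of \<phi> x 0 "axis i 1"] assms show ?thesis by simp
qed

lemma partial_derivs_affine:
  fixes \<phi> :: "real ^ 'n \<Rightarrow> real"
  assumes "smooth \<phi>"
  shows "partial_derivs I (\<lambda>x. a * \<phi> (c *\<^sub>R x + z)) =
           (\<lambda>x. a * c ^ length I * partial_derivs I \<phi> (c *\<^sub>R x + z))"
proof (induction I)
  case (Cons i I)
  have "partial_deriv i (\<lambda>x. a * c ^ length I * partial_derivs I \<phi> (c *\<^sub>R x + z)) x =
      a * c ^ length (i # I) * partial_derivs (i # I) \<phi> (c *\<^sub>R x + z)" for x
  proof (rule partial_deriv_eqI)
    have "((\<lambda>t. partial_derivs I \<phi> ((c *\<^sub>R x + z) + t *\<^sub>R axis i 1)) has_real_derivative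
        partial_derivs (i # I) \<phi> (c *\<^sub>R x + z)) (at 0)"
      by (simp, rule has_real_derivative_axis)
         (use assms smooth_differentiable smooth_partial_derivs in blast)
    then have "((\<lambda>t. partial_derivs I \<phi> ((c *\<^sub>R x + z) + (c * t) *\<^sub>R axis i 1)) has_real_derivative
        partial_derivs (i # I) \<phi> (c *\<^sub>R x + z) * c) (at 0)"
      using DERIV_chain2[where f = "\<lambda>t. partial_derivs I \<phi> ((c *\<^sub>R x + z) + t *\<^sub>R axis i 1)"
          and g = "\<lambda>t. c * t" and x = 0 and Db = c and Da = "partial_derivs (i # I) \<phi> (c *\<^sub>R x + z)"]
      by (auto intro!: derivative_eq_intros)
    then have "((\<lambda>t. partial_derivs I \<phi> (c *\<^sub>R (x + t *\<^sub>R axis i 1) + z)) has_real_derivative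
        partial_derivs (i # I) \<phi> (c *\<^sub>R x + z) * c) (at 0)"
      by (simp add: algebra_simps del: partial_derivs_Cons)
    then show "((\<lambda>t. a * c ^ length I * partial_derivs I \<phi> (c *\<^sub>R (x + t *\<^sub>R axis i 1) + z))
        has_real_derivative a * c ^ length (i # I) * partial_derivs (i # I) \<phi> (c *\<^sub>R x + z)) (at 0)"
      by (rule DERIV_cong[OF DERIV_cmult]) simp
  qed
  with Cons show ?case by (auto simp only: partial_derivs_Cons)
qed simp

lemma smooth_affine:
  fixes \<phi> :: "real ^ 'n \<Rightarrow> real"
  assumes "smooth \<phi>"
  shows "smooth (\<lambda>x. a * \<phi> (c *\<^sub>R x + z))"
  unfolding smooth_def differentiable_on_def
proof (intro allI ballI)
  fix I and x :: "real ^ 'n"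
  have "partial_derivs I \<phi> differentiable (at (c *\<^sub>R x + z))"
    using assms smooth_differentiable smooth_partial_derivs by blast
  then obtain D where D: "(partial_derivs I \<phi> has_derivative D) (at (c *\<^sub>R x + z))"
    by (auto simp: differentiable_def)
  have "((\<lambda>x. c *\<^sub>R x + z) has_derivative (\<lambda>h. c *\<^sub>R h)) (at x)"
    by (auto intro!: derivative_eq_intros)
  from has_derivative_compose[OF this D]
  have "(\<lambda>x. partial_derivs I \<phi> (c *\<^sub>R x + z)) differentiable (at x)"
    by (auto simp: differentiable_def)
  then show "partial_derivs I (\<lambda>x. a * \<phi> (c *\<^sub>R x + z)) differentiable (at x)"
    unfolding partial_derivs_affine[OF assms]
    by (intro differentiable_mult differentiable_const)
qed

lemma partial_derivs_sum:
  fixes \<phi> :: "'k \<Rightarrow> real ^ 'n \<Rightarrow> real"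
  assumes "\<And>j. j \<in> J \<Longrightarrow> smooth (\<phi> j)"
  shows "partial_derivs I (\<lambda>x. \<Sum>j\<in>J. \<phi> j x) = (\<lambda>x. \<Sum>j\<in>J. partial_derivs I (\<phi> j) x)"
proof (induction I)
  case (Cons i I)
  have "partial_deriv i (\<lambda>x. \<Sum>j\<in>J. partial_derivs I (\<phi> j) x) x =
      (\<Sum>j\<in>J. partial_derivs (i # I) (\<phi> j) x)" for x
    by (intro partial_deriv_eqI DERIV_sum, simp, intro has_real_derivative_axis)
       (use assms smooth_differentiable smooth_partial_derivs in blast)
  with Cons show ?case by (auto simp only: partial_derivs_Cons)
qed simp

lemma smooth_sum:
  fixes \<phi> :: "'k \<Rightarrow> real ^ 'n \<Rightarrow> real"
  assumes "\<And>j. j \<in> J \<Longrightarrow> smooth (\<phi> j)" "finite J"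
  shows "smooth (\<lambda>x. \<Sum>j\<in>J. \<phi> j x)"
  unfolding smooth_def differentiable_on_def
proof (intro allI ballI)
  fix I and x :: "real ^ 'n"
  have "(\<lambda>x. \<Sum>j\<in>J. partial_derivs I (\<phi> j) x) differentiable (at x)"
    using assms(1) by (intro differentiable_sum assms(2) ballI smooth_differentiable smooth_partial_derivs)
  then show "partial_derivs I (\<lambda>x. \<Sum>j\<in>J. \<phi> j x) differentiable (at x)"
    by (subst partial_derivs_sum[OF assms(1)])
qed

text \<open>A partial derivative at a point depends only on the values near that point, and the
  complement of \<open>K\<close> is open.\<close>

lemma partial_derivs_eq_0:
  assumes "closed K" "\<And>x. x \<notin> K \<Longrightarrow> \<phi> x = 0" "x \<notin> K"
  shows "partial_derivs I \<phi> x = 0"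
  using \<open>x \<notin> K\<close>
proof (induction I arbitrary: x)
  case (Cons i I)
  have "open (- K)" using assms by auto
  then have "open ((\<lambda>t::real. x + t *\<^sub>R axis i 1) -` (- K))"
    by (intro open_vimage) (auto intro!: continuous_intros)
  moreover have "0 \<in> (\<lambda>t::real. x + t *\<^sub>R axis i 1) -` (- K)"
    using Cons.prems by simp
  ultimately have ev: "eventually (\<lambda>t. t \<in> (\<lambda>t::real. x + t *\<^sub>R axis i 1) -` (- K)) (nhds 0)"
    by (rule eventually_nhds_in_open)
  have "((\<lambda>t. partial_derivs I \<phi> (x + t *\<^sub>R axis i 1)) has_real_derivative 0) (at 0)"
  proof (subst DERIV_cong_ev[OF refl _ refl])
    show "\<forall>\<^sub>F t in nhds 0. partial_derivs I \<phi> (x + t *\<^sub>R axis i 1) = 0"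
      using ev by eventually_elim (auto intro: Cons.IH simp del: vimage_Compl)
  qed auto
  then show ?case by (simp add: partial_deriv_eqI)
qed (use assms in auto)

lemma test_functionI:
  assumes "smooth \<phi>" "compact K" "\<And>x. x \<notin> K \<Longrightarrow> \<phi> x = 0" "K \<subseteq> \<Omega>"
  shows "test_function \<Omega> \<phi>"
proof -
  have "closure {x. \<phi> x \<noteq> 0} \<subseteq> K"
    using assms by (intro closure_minimal) (auto simp: compact_imp_closed)
  moreover from this have "compact (closure {x. \<phi> x \<noteq> 0})"
    using assms(2) by (metis closed_closure compact_Int_closed inf.absorb2)
  ultimately show ?thesis
    using assms unfolding test_function_def smooth_def by auto
qed

lemma test_functionE:
  assumes "test_function \<Omega> \<phi>"
  obtains K where "smooth \<phi>" "compact K" "\<And>x. x \<notin> K \<Longrightarrow> \<phi> x = 0" "K \<subseteq> \<Omega>"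
proof (rule that[of "closure {x. \<phi> x \<noteq> 0}"])
  show "\<phi> x = 0" if "x \<notin> closure {x. \<phi> x \<noteq> 0}" for x
    using that closure_subset[of "{x. \<phi> x \<noteq> 0}"] by auto
qed (use assms in \<open>auto simp: test_function_def smooth_def\<close>)

lemma test_function_partial_derivs:
  assumes "test_function \<Omega> \<phi>"
  shows "test_function \<Omega> (partial_derivs I \<phi>)"
  using assms
proof (rule test_functionE)
  fix K assume K: "smooth \<phi>" "compact K" "\<And>x. x \<notin> K \<Longrightarrow> \<phi> x = 0" "K \<subseteq> \<Omega>"
  show ?thesis
    by (rule test_functionI[OF smooth_partial_derivs[OF K(1)] K(2) _ K(4)])
       (rule partial_derivs_eq_0[OF compact_imp_closed[OF K(2)] K(3)])
qed

lemma continuous_compact_support_bounded: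
  fixes \<phi> :: "real ^ 'n \<Rightarrow> real"
  assumes "continuous_on UNIV \<phi>" "compact K" "\<And>x. x \<notin> K \<Longrightarrow> \<phi> x = 0"
  obtains D where "D > 0" "\<And>x. \<bar>\<phi> x\<bar> \<le> D"
proof -
  have "compact (\<phi> ` K)"
    using assms by (meson compact_continuous_image continuous_on_subset subset_UNIV)
  then obtain b where b: "\<And>x. x \<in> K \<Longrightarrow> \<bar>\<phi> x\<bar> \<le> b"
    using compact_imp_bounded[of "\<phi> ` K"] unfolding bounded_iff by auto
  show ?thesis
  proof (rule that[of "\<bar>b\<bar> + 1"])
    show "\<bar>\<phi> x\<bar> \<le> \<bar>b\<bar> + 1" for x
      using b[of x] assms(3)[of x] by (cases "x \<in> K") auto
  qed auto
qed

lemma continuous_compact_support_integrable: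
  fixes \<phi> :: "real ^ 'n \<Rightarrow> real"
  assumes "continuous_on UNIV \<phi>" "compact K" "\<And>x. x \<notin> K \<Longrightarrow> \<phi> x = 0"
  shows "integrable lborel \<phi>"
proof -
  have "set_integrable lborel K \<phi>"
    unfolding set_integrable_def
    using assms by (intro borel_integrable_compact) (auto intro: continuous_on_subset)
  moreover have "(\<lambda>x. indicator K x *\<^sub>R \<phi> x) = \<phi>"
    using assms(3) by (auto simp: fun_eq_iff indicator_def)
  ultimately show ?thesis by (simp add: set_integrable_def)
qed

lemma integrable_pair_bounded:
  fixes f :: "real ^ 'n \<Rightarrow> real" and k :: "real \<times> (real ^ 'n) \<Rightarrow> real"
  assumes f: "integrable lborel f" and k: "k \<in> borel_measurable borel" and D: "\<And>z. \<bar>k z\<bar> \<le> D"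
  shows "integrable (lborel \<Otimes>\<^sub>M lborel) (\<lambda>(s, y). indicator {0..1} s * k (s, y) * f y)"
proof -
  have [measurable]: "k \<in> borel_measurable (borel \<Otimes>\<^sub>M borel)"
    using k by (simp add: borel_prod)
  have [measurable]: "f \<in> borel_measurable borel" using f by auto
  have D0: "D \<ge> 0" using D[of undefined] by linarith
  show ?thesis
  proof (rule integrableI_bounded)
    have "(\<integral>\<^sup>+ z. ennreal (norm (case z of (s, y) \<Rightarrow> indicator {0..1} s * k (s, y) * f y)) \<partial>(lborel \<Otimes>\<^sub>M lborel))
       = (\<integral>\<^sup>+ s. \<integral>\<^sup>+ y. ennreal (norm (indicator {0..1} s * k (s, y) * f y)) \<partial>lborel \<partial>lborel)"
      by (subst lborel.nn_integral_fst[symmetric]) auto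
    also have "\<dots> \<le> (\<integral>\<^sup>+ (s::real). \<integral>\<^sup>+ y. indicator {0..1} s * ennreal (D * \<bar>f y\<bar>) \<partial>lborel \<partial>lborel)"
      by (intro nn_integral_mono)
         (auto simp: indicator_def abs_mult intro!: ennreal_leI mult_right_mono D)
    also have "\<dots> = (\<integral>\<^sup>+ y. ennreal (D * \<bar>f y\<bar>) \<partial>lborel)"
      by (simp add: nn_integral_cmult nn_integral_multc)
    also have "\<dots> < \<infinity>"
      using f D0 by (simp add: ennreal_mult nn_integral_cmult ennreal_mult_less_top integrable_iff_bounded)
    finally show "(\<integral>\<^sup>+ z. ennreal (norm (case z of (s, y) \<Rightarrow> indicator {0..1} s * k (s, y) * f y)) \<partial>(lborel \<Otimes>\<^sub>M lborel)) < \<infinity>" .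
  qed simp
qed

text \<open>This form of Fubini's theorem exchanges an integration along a segment with the
  integration against an integrable function.\<close>

lemma integral_swap_bounded:
  fixes f :: "real ^ 'n \<Rightarrow> real" and k :: "real \<times> (real ^ 'n) \<Rightarrow> real"
  assumes f: "integrable lborel f" and k: "k \<in> borel_measurable borel" and D: "\<And>z. \<bar>k z\<bar> \<le> D"
  shows "(LINT y|lborel. f y * (LINT s|lborel. indicator {0..1} s * k (s, y))) =
         (LINT s|lborel. indicator {0..1} s * (LINT y|lborel. f y * k (s, y)))"
proof -
  have "(LINT y|lborel. f y * (LINT s|lborel. indicator {0..1} s * k (s, y))) =
     (LINT y|lborel. LINT s|lborel. indicator {0..1} s * k (s, y) * f y)"
    by (simp add: mult.commute)
  also have "\<dots> = (LINT s|lborel. LINT y|lborel. indicator {0..1} s * k (s, y) * f y)"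
    by (rule lborel_pair.Fubini_integral[OF integrable_pair_bounded[OF assms]])
  also have "\<dots> = (LINT s|lborel. indicator {0..1} s * (LINT y|lborel. f y * k (s, y)))"
    by (simp add: mult.assoc) (simp add: mult.commute)
  finally show ?thesis .
qed

text \<open>The fundamental theorem of calculus on the segment from \<open>x\<close> to \<open>x + w\<close>.\<close>

lemma C1_increment:
  fixes \<phi> :: "real ^ 'n \<Rightarrow> real"
  assumes diff: "\<And>x. \<phi> differentiable (at x)"
    and cont: "\<And>i. continuous_on UNIV (partial_deriv i \<phi>)"
  shows "\<phi> (x + w) - \<phi> x =
     (LINT s|lborel. indicator {0..1} s * (\<Sum>i\<in>UNIV. w $ i * partial_deriv i \<phi> (x + s *\<^sub>R w)))"
proof -
  have "(LINT s|lborel. indicator {0..1} s *\<^sub>R (\<Sum>i\<in>UNIV. w $ i * partial_deriv i \<phi> (x + s *\<^sub>R w)))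
      = \<phi> (x + 1 *\<^sub>R w) - \<phi> (x + 0 *\<^sub>R w)"
  proof (rule integral_FTC_Icc)
    show "((\<lambda>s. \<phi> (x + s *\<^sub>R w)) has_vector_derivative
        (\<Sum>i\<in>UNIV. w $ i * partial_deriv i \<phi> (x + s *\<^sub>R w))) (at s within {0..1})" for s
      using has_real_derivative_along_line[OF diff[of "x + s *\<^sub>R w"]]
      by (simp add: has_real_derivative_iff_has_vector_derivative has_vector_derivative_at_within)
    show "continuous_on {0..1} (\<lambda>s. \<Sum>i\<in>UNIV. w $ i * partial_deriv i \<phi> (x + s *\<^sub>R w))"
      by (intro continuous_intros continuous_on_compose2[OF cont])
         auto
  qed simp
  then show ?thesis by simp
qed

lemma integral_translate:
  fixes f :: "real ^ 'n \<Rightarrow> real"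
  assumes [measurable]: "f \<in> borel_measurable borel"
  shows "(LINT x|lborel. f (x + a)) = (LINT x|lborel. f x)"
proof -
  have "(LINT x|lborel. f x) = (LINT x|distr lborel borel ((+) a). f x)"
    by (simp only: lborel_distr_plus)
  also have "\<dots> = (LINT x|lborel. f (x + a))"
    by (subst integral_distr) (auto simp: add.commute)
  finally show ?thesis by simp
qed

text \<open>The integral of \<open>\<phi>(y + e\<^sub>i) - \<phi>(y)\<close> vanishes by translation invariance. On the other hand,
  this difference is the mean over \<open>0 \<le> s \<le> 1\<close> of \<open>\<partial>\<^sub>i\<phi>(y + s e\<^sub>i)\<close>, and each of these
  functions has the same integral as \<open>\<partial>\<^sub>i\<phi>\<close>.\<close>

lemma integral_partial_deriv_eq_0:
  fixes \<phi> :: "real ^ 'n \<Rightarrow> real"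
  assumes diff: "\<And>x. \<phi> differentiable (at x)"
    and cont: "\<And>i. continuous_on UNIV (partial_deriv i \<phi>)" and K: "compact K" "\<And>x. x \<notin> K \<Longrightarrow> \<phi> x = 0"
  shows "(LINT x|lborel. partial_deriv i \<phi> x) = 0"
proof -
  let ?e = "axis i 1 :: real ^ 'n"
  let ?g = "partial_deriv i \<phi>"
  have g0: "?g x = 0" if "x \<notin> K" for x
    using partial_derivs_eq_0[OF compact_imp_closed[OF K(1)] K(2) that, where I = "[i]"] by simp
  have \<phi>c: "continuous_on S \<phi>" for S
    by (meson continuous_at_imp_continuous_on differentiable_imp_continuous_within diff)
  note gc = cont[of i]
  obtain D where D: "\<And>x. \<bar>?g x\<bar> \<le> D"
    using continuous_compact_support_bounded[OF gc K(1) g0] by blast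
  obtain r where r: "K \<subseteq> cball 0 r"
    using compact_imp_bounded[OF K(1)] unfolding bounded_iff by (metis mem_cball_0 subsetI)
  \<comment> \<open>This ball contains the supports of all translates by \<open>s e\<^sub>i\<close> with \<open>0 \<le> s \<le> 1\<close>, so its
    indicator can serve as the integrable factor in Fubini's theorem.\<close>
  let ?f = "indicator (cball 0 (r + 1)) :: real ^ 'n \<Rightarrow> real"
  let ?k = "\<lambda>(s, y). ?g (y + s *\<^sub>R ?e)"
  have f: "integrable lborel ?f"
    using emeasure_bounded_finite[OF bounded_cball, of "0 :: real ^ 'n" "r + 1"]
    by (intro integrable_real_indicator) auto
  have eqf: "?f y * (indicator {0..1} s * ?g (y + s *\<^sub>R ?e)) = indicator {0..1} s * ?g (y + s *\<^sub>R ?e)" for s :: real and y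
  proof -
    have "?g (y + s *\<^sub>R ?e) = 0" if "norm y > r + 1" "0 \<le> s" "s \<le> 1"
    proof (rule g0, rule)
      assume "y + s *\<^sub>R ?e \<in> K"
      with r have "norm (y + s *\<^sub>R ?e) \<le> r" by auto
      moreover have "norm y \<le> norm (y + s *\<^sub>R ?e) + norm (s *\<^sub>R ?e)"
        by (metis add_diff_cancel_right' norm_triangle_ineq4)
      ultimately show False using that by simp
    qed
    then show ?thesis by (auto simp: indicator_def)
  qed
  have inc: "\<phi> (y + ?e) - \<phi> y = (LINT s|lborel. indicator {0..1} s * ?g (y + s *\<^sub>R ?e))" for y
  proof -
    have "(\<Sum>j\<in>UNIV. ?e $ j * partial_deriv j \<phi> z) = ?g z" for z
      by (simp add: axis_def if_distrib[of "\<lambda>z. z * _"] cong: if_cong)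
    then show ?thesis using C1_increment[OF diff cont, of y ?e] by simp
  qed
  have int\<phi>: "integrable lborel \<phi>"
    by (rule continuous_compact_support_integrable[OF \<phi>c K])
  have km: "?k \<in> borel_measurable borel"
    by (intro borel_measurable_continuous_onI)
       (auto simp: split_beta intro!: continuous_intros continuous_on_compose2[OF gc])
  have "0 = (LINT y|lborel. \<phi> (y + ?e)) - (LINT y|lborel. \<phi> y)"
    using borel_measurable_continuous_onI[OF \<phi>c] by (subst integral_translate) auto
  also have "\<dots> = (LINT y|lborel. \<phi> (y + ?e) - \<phi> y)"
  proof (rule Bochner_Integration.integral_diff[symmetric])
    show "integrable lborel (\<lambda>y. \<phi> (y + ?e))"
    proof (rule continuous_compact_support_integrable[where K = "(\<lambda>y. y - ?e) ` K"])
      show "continuous_on UNIV (\<lambda>y. \<phi> (y + ?e))"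
        by (intro continuous_on_compose2[OF \<phi>c] continuous_intros) auto
      show "compact ((\<lambda>y. y - ?e) ` K)"
        by (intro compact_continuous_image K continuous_intros)
      show "\<phi> (x + ?e) = 0" if "x \<notin> (\<lambda>y. y - ?e) ` K" for x
        using that by (intro K) (force simp: image_iff)
    qed
  qed (rule int\<phi>)
  also have "\<dots> = (LINT y|lborel. ?f y * (LINT s|lborel. indicator {0..1} s * ?k (s, y)))"
  proof (rule Bochner_Integration.integral_cong[OF refl])
    fix y
    have "?f y * (LINT s|lborel. indicator {0..1} s * ?k (s, y)) =
        (LINT s|lborel. ?f y * (indicator {0..1} s * ?k (s, y)))" by simp
    also have "\<dots> = (LINT s|lborel. indicator {0..1} s * ?g (y + s *\<^sub>R ?e))"
      using eqf by (simp only: prod.case)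
    finally show "\<phi> (y + ?e) - \<phi> y = ?f y * (LINT s|lborel. indicator {0..1} s * ?k (s, y))"
      by (simp only: inc)
  qed
  also have "\<dots> = (LINT s|lborel. indicator {0..1} s * (LINT y|lborel. ?f y * ?k (s, y)))"
    by (rule integral_swap_bounded[OF f km]) (use D in auto)
  also have "\<dots> = (LINT (s::real)|lborel. indicator {0..1} s * (LINT y|lborel. ?g y))"
  proof (rule Bochner_Integration.integral_cong[OF refl])
    fix s :: real
    show "indicator {0..1} s * (LINT y|lborel. ?f y * ?k (s, y)) = indicator {0..1} s * (LINT y|lborel. ?g y)"
    proof (cases "s \<in> {0..1}")
      case True
      have "(LINT y|lborel. ?f y * ?k (s, y)) = (LINT y|lborel. ?g (y + s *\<^sub>R ?e))"
        by (rule Bochner_Integration.integral_cong[OF refl]) (use eqf[of _ s] True in simp)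
      then show ?thesis
        using integral_translate[OF borel_measurable_continuous_onI[OF gc], of "s *\<^sub>R ?e"] by simp
    qed simp
  qed
  also have "\<dots> = (LINT y|lborel. ?g y)"
    by simp
  finally show ?thesis by simp
qed

lemma partial_deriv_mult:
  assumes "f differentiable (at x)" "g differentiable (at x)"
  shows "partial_deriv i (\<lambda>x. f x * g x) x = partial_deriv i f x * g x + f x * partial_deriv i g x"
proof (rule partial_deriv_eqI)
  show "((\<lambda>t. f (x + t *\<^sub>R axis i 1) * g (x + t *\<^sub>R axis i 1)) has_real_derivative
      partial_deriv i f x * g x + f x * partial_deriv i g x) (at 0)"
    using DERIV_mult[OF has_real_derivative_axis[OF assms(1), of i] has_real_derivative_axis[OF assms(2), of i]]
    by (simp add: algebra_simps)
qed

section \<open>A smooth bump function\<close>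

text \<open>The functions \<open>exp(-1/t) t\<^sup>-\<^sup>a\<close> on the positive half-line, extended by zero. Up to linear
  combinations the family is closed under differentiation, also at \<open>0\<close>, and this shows that
  its members are smooth.\<close>

definition flat_exp :: "nat \<Rightarrow> real \<Rightarrow> real" where
  "flat_exp a t = (if t > 0 then exp (- inverse t) * inverse t ^ a else 0)"

lemma flat_exp_tendsto_0: "(flat_exp a \<longlongrightarrow> 0) (at 0)"
proof -
  have lim: "((\<lambda>x::real. x ^ a / exp x) \<longlongrightarrow> 0) at_top"
    by (rule tendsto_power_div_exp_0)
  have "((\<lambda>t::real. inverse t ^ a / exp (inverse t)) \<longlongrightarrow> 0) (at_right 0)"
    using filterlim_compose[OF lim filterlim_inverse_at_top_right] by simp
  then have "(flat_exp a \<longlongrightarrow> 0) (at_right 0)"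
  proof (rule Lim_transform_eventually)
    show "\<forall>\<^sub>F t in at_right 0. inverse t ^ a / exp (inverse t) = flat_exp a t"
      by (auto simp: eventually_at_filter flat_exp_def exp_minus divide_inverse intro!: always_eventually)
  qed
  moreover have "(flat_exp a \<longlongrightarrow> 0) (at_left 0)"
    by (rule Lim_transform_eventually[OF tendsto_const])
       (auto simp: eventually_at_filter flat_exp_def intro!: always_eventually)
  ultimately show ?thesis by (simp add: filterlim_split_at_real)
qed

lemma flat_exp_has_derivative:
  "(flat_exp a has_real_derivative (flat_exp (a + 2) t - real a * flat_exp (a + 1) t)) (at t)"
proof (cases "t = 0")
  case True
  have "((\<lambda>h. (flat_exp a (0 + h) - flat_exp a 0) / h) \<longlongrightarrow> 0) (at 0)"
  proof (rule Lim_transform_eventually[OF flat_exp_tendsto_0[of "a + 1"]])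
    \<comment> \<open>At \<open>0\<close> the difference quotient is again a member of the family.\<close>
    show "\<forall>\<^sub>F h in at 0. flat_exp (a + 1) h = (flat_exp a (0 + h) - flat_exp a 0) / h"
      by (auto simp: eventually_at_filter flat_exp_def divide_inverse intro!: always_eventually)
  qed
  then show ?thesis using True by (simp add: DERIV_def flat_exp_def)
next
  case False
  show ?thesis
  proof (cases "t > 0")
    case True
    have "((\<lambda>t. exp (- inverse t) * inverse t ^ a) has_real_derivative
        (flat_exp (a + 2) t - real a * flat_exp (a + 1) t)) (at t)"
      using True
      apply (auto intro!: derivative_eq_intros simp: flat_exp_def)
      apply (cases a)
      apply (simp_all add: field_simps power2_eq_square)
      done
    then show ?thesis
    proof (rule has_field_derivative_transform_within_open[where S = "{0<..}"])
      show "x \<in> {0<..} \<Longrightarrow> exp (- inverse x) * inverse x ^ a = flat_exp a x" for x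
        by (auto simp: flat_exp_def)
    qed (use True in auto)
  next
    case nt: False
    have "((\<lambda>t::real. 0) has_real_derivative (flat_exp (a + 2) t - real a * flat_exp (a + 1) t)) (at t)"
      using nt by (simp add: flat_exp_def)
    then show ?thesis
    proof (rule has_field_derivative_transform_within_open[where S = "{..<0}"])
      show "x \<in> {..<0} \<Longrightarrow> 0 = flat_exp a x" for x
        by (auto simp: flat_exp_def)
    qed (use False nt in auto)
  qed
qed

text \<open>A class of functions that contains the bump \<open>exp(-1/(1+t)) exp(-1/(1-t))\<close> on \<open>(-1, 1)\<close> and
  is closed under differentiation.\<close>

inductive_set bump_terms :: "(real \<Rightarrow> real) set" where
  bump_terms_base: "(\<lambda>t. c * (flat_exp a (1 + t) * flat_exp b (1 - t))) \<in> bump_terms"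
| bump_terms_add: "f \<in> bump_terms \<Longrightarrow> g \<in> bump_terms \<Longrightarrow> (\<lambda>t. f t + g t) \<in> bump_terms"

lemma bump_terms_derivative:
  assumes "f \<in> bump_terms"
  shows "\<exists>g\<in>bump_terms. \<forall>t. (f has_real_derivative g t) (at t)"
  using assms
proof induction
  case (bump_terms_base c a b)
  let ?g = "\<lambda>t. (c * (flat_exp (a + 2) (1 + t) * flat_exp b (1 - t))
      + (- c * real a) * (flat_exp (a + 1) (1 + t) * flat_exp b (1 - t)))
      + ((- c) * (flat_exp a (1 + t) * flat_exp (b + 2) (1 - t))
      + (c * real b) * (flat_exp a (1 + t) * flat_exp (b + 1) (1 - t)))"
  have "?g \<in> bump_terms"
    by (intro bump_terms.intros)
  moreover have "((\<lambda>t. c * (flat_exp a (1 + t) * flat_exp b (1 - t))) has_real_derivative ?g t) (at t)" for t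
  proof -
    have 1: "((\<lambda>t. flat_exp a (1 + t)) has_real_derivative
        (flat_exp (a + 2) (1 + t) - real a * flat_exp (a + 1) (1 + t)) * 1) (at t)"
      by (rule DERIV_chain2[OF flat_exp_has_derivative]) (auto intro!: derivative_eq_intros)
    have 2: "((\<lambda>t. flat_exp b (1 - t)) has_real_derivative
        (flat_exp (b + 2) (1 - t) - real b * flat_exp (b + 1) (1 - t)) * (-1)) (at t)"
      by (rule DERIV_chain2[OF flat_exp_has_derivative]) (auto intro!: derivative_eq_intros)
    show ?thesis
      by (rule DERIV_cong[OF DERIV_cmult[OF DERIV_mult[OF 1 2]]]) (simp add: algebra_simps)
  qed
  ultimately show ?case by (intro bexI[of _ ?g] allI)
next
  case (bump_terms_add f g)
  then obtain f' g' where *: "f' \<in> bump_terms" "\<And>t. (f has_real_derivative f' t) (at t)"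
    "g' \<in> bump_terms" "\<And>t. (g has_real_derivative g' t) (at t)" by blast
  show ?case
    by (rule bexI[of _ "\<lambda>t. f' t + g' t"]) (auto intro!: DERIV_add * bump_terms.intros)
qed

text \<open>The function \<open>D k\<close> is the \<open>k\<close>-th derivative of the bump.\<close>

lemma infinitely_differentiable_bump:
  obtains D :: "nat \<Rightarrow> real \<Rightarrow> real" where
    "\<And>k t. (D k has_real_derivative D (Suc k) t) (at t)"
    "\<And>t. \<bar>t\<bar> \<ge> 1 \<Longrightarrow> D 0 t = 0" "\<And>t. \<bar>t\<bar> < 1 \<Longrightarrow> D 0 t > 0"
proof -
  let ?f = "\<lambda>t. 1 * (flat_exp 0 (1 + t) * flat_exp 0 (1 - t))"
  have "\<exists>D. \<forall>k. (D k \<in> bump_terms \<and> (k = 0 \<longrightarrow> D k = ?f)) \<and>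
      (\<forall>t. (D k has_real_derivative D (Suc k) t) (at t))"
  proof (rule dependent_nat_choice)
    show "\<exists>f. f \<in> bump_terms \<and> ((0::nat) = 0 \<longrightarrow> f = ?f)"
      using bump_terms_base by blast
    show "\<exists>g. (g \<in> bump_terms \<and> (Suc k = 0 \<longrightarrow> g = ?f)) \<and> (\<forall>t. (f has_real_derivative g t) (at t))"
      if "f \<in> bump_terms \<and> (k = 0 \<longrightarrow> f = ?f)" for f k
      using bump_terms_derivative[of f] that by auto
  qed
  then obtain D where D: "\<And>k t. (D k has_real_derivative D (Suc k) t) (at t)" "D 0 = ?f" by blast
  show ?thesis
    by (rule that[of D]) (use D in \<open>auto simp: flat_exp_def\<close>)
qed

text \<open>Each factor is differentiated as often as its coordinate direction occurs in the list.\<close>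

lemma partial_derivs_product:
  fixes D :: "nat \<Rightarrow> real \<Rightarrow> real"
  assumes D: "\<And>k t. (D k has_real_derivative D (Suc k) t) (at t)"
  shows "partial_derivs I (\<lambda>x :: real ^ 'n. \<Prod>i\<in>UNIV. D 0 (x $ i)) =
    (\<lambda>x. \<Prod>i\<in>UNIV. D (count_list I i) (x $ i))"
proof (induction I)
  case (Cons j I)
  have "partial_deriv j (\<lambda>x :: real ^ 'n. \<Prod>i\<in>UNIV. D (count_list I i) (x $ i)) x =
    (\<Prod>i\<in>UNIV. D (count_list (j # I) i) (x $ i))" for x
  proof (rule partial_deriv_eqI)
    let ?c = "\<Prod>i\<in>UNIV - {j}. D (count_list I i) (x $ i)"
    have "((\<lambda>t. ?c * D (count_list I j) (x $ j + t)) has_real_derivative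
        ?c * (D (Suc (count_list I j)) (x $ j + 0) * 1)) (at 0)"
      by (intro DERIV_cmult DERIV_chain2[OF D]) (auto intro!: derivative_eq_intros)
    moreover have "(\<Prod>i\<in>UNIV. D (count_list I i) ((x + t *\<^sub>R axis j 1) $ i)) =
        ?c * D (count_list I j) (x $ j + t)" for t
      by (subst prod.remove[of UNIV j]) (auto simp: axis_def mult.commute intro!: prod.cong)
    moreover have "(\<Prod>i\<in>UNIV. D (count_list (j # I) i) (x $ i)) =
        ?c * (D (Suc (count_list I j)) (x $ j + 0) * 1)"
      by (subst prod.remove[of UNIV j]) (auto simp: mult.commute intro!: prod.cong)
    ultimately show "((\<lambda>t. \<Prod>i\<in>UNIV. D (count_list I i) ((x + t *\<^sub>R axis j 1) $ i))
        has_real_derivative (\<Prod>i\<in>UNIV. D (count_list (j # I) i) (x $ i))) (at 0)"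
      by presburger
  qed
  with Cons show ?case by (auto simp only: partial_derivs_Cons)
qed simp

lemma smooth_product:
  fixes D :: "nat \<Rightarrow> real \<Rightarrow> real"
  assumes D: "\<And>k t. (D k has_real_derivative D (Suc k) t) (at t)"
  shows "smooth (\<lambda>x :: real ^ 'n. \<Prod>i\<in>UNIV. D 0 (x $ i))"
  unfolding smooth_def partial_derivs_product[of D, OF D] differentiable_on_def differentiable_def
proof (intro allI ballI exI)
  fix I and x :: "real ^ 'n"
  have "((\<lambda>x :: real ^ 'n. D (count_list I i) (x $ i)) has_derivative
      (\<lambda>y. D (Suc (count_list I i)) (x $ i) * (y $ i))) (at x)" for i
    using D[unfolded has_field_derivative_def]
    by (intro has_derivative_compose[where f = "\<lambda>x. x $ i" and g = "D (count_list I i)"])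
       (auto intro!: derivative_eq_intros bounded_linear_imp_has_derivative bounded_linear_vec_nth)
  then show "((\<lambda>x :: real ^ 'n. \<Prod>i\<in>UNIV. D (count_list I i) (x $ i)) has_derivative
      (\<lambda>y. \<Sum>i\<in>UNIV. (D (Suc (count_list I i)) (x $ i) * (y $ i)) *
         (\<Prod>j\<in>UNIV - {i}. D (count_list I j) (x $ j)))) (at x)"
    by (intro has_derivative_prod) auto
qed

lemma smooth_bump_exists:
  obtains \<psi> :: "real ^ 'n \<Rightarrow> real"
  where "smooth \<psi>" "\<And>x. \<psi> x \<ge> 0" "\<And>x. norm x \<ge> 1 \<Longrightarrow> \<psi> x = 0" "\<psi> 0 > 0"
proof -
  obtain D :: "nat \<Rightarrow> real \<Rightarrow> real" where
    D: "\<And>k t. (D k has_real_derivative D (Suc k) t) (at t)"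
    "\<And>t. \<bar>t\<bar> \<ge> 1 \<Longrightarrow> D 0 t = 0" "\<And>t. \<bar>t\<bar> < 1 \<Longrightarrow> D 0 t > 0"
    using infinitely_differentiable_bump by blast
  have D0: "D 0 t \<ge> 0" for t using D(2,3)[of t] by force
  let ?N = "real CARD('n)"
  \<comment> \<open>The product of the bumps is supported in a cube. After scaling by the dimension, this
    cube lies in the unit ball, since the Euclidean norm is at most the sum of the absolute
    values of the coordinates.\<close>
  define \<psi> where "\<psi> = (\<lambda>x :: real ^ 'n. 1 * (\<lambda>x. \<Prod>i\<in>UNIV. D 0 (x $ i)) (?N *\<^sub>R x + 0))"
  have eq: "\<psi> x = (\<Prod>i\<in>UNIV. D 0 (?N * x $ i))" for x
    by (simp add: \<psi>_def)
  show ?thesis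
  proof (rule that)
    show "smooth \<psi>"
      unfolding \<psi>_def by (intro smooth_affine smooth_product[of D, OF D(1)])
    show "\<psi> x \<ge> 0" for x
      unfolding eq by (intro prod_nonneg ballI D0)
    show "\<psi> 0 > 0"
      unfolding eq by (intro prod_pos) (simp add: D)
    show "\<psi> x = 0" if "norm x \<ge> 1" for x
    proof -
      have "\<exists>i. \<bar>?N * x $ i\<bar> \<ge> 1"
      proof (rule ccontr)
        assume "\<not> ?thesis"
        then have "\<bar>x $ i\<bar> < 1 / ?N" for i
          by (auto simp: not_le abs_mult field_simps)
        then have "(\<Sum>i\<in>UNIV. \<bar>x $ i\<bar>) < (\<Sum>i\<in>(UNIV :: 'n set). 1 / ?N)"
          by (intro sum_strict_mono) auto
        with that norm_le_l1_cart[of x] show False by simp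
      qed
      then show ?thesis unfolding eq using D(2) by (metis UNIV_I finite prod_zero)
    qed
  qed
qed

section \<open>Classical derivatives as weak derivatives\<close>

lemma smooth_C1:
  assumes "smooth \<phi>"
  shows "\<phi> differentiable (at x)" "continuous_on UNIV (partial_deriv i \<phi>)"
  using assms smooth_differentiable smooth_continuous smooth_partial_deriv by blast+

text \<open>Each integration by parts removes the outermost derivative from \<open>\<phi>\<close>, so the derivatives
  arrive at \<open>u\<close> in reversed order.\<close>

lemma smooth_integration_by_parts:
  fixes u \<phi> :: "real ^ 'n \<Rightarrow> real"
  assumes u: "smooth u" and \<phi>: "smooth \<phi>" and K: "compact K" "\<And>x. x \<notin> K \<Longrightarrow> \<phi> x = 0"
  shows "(LINT x|lborel. u x * partial_derivs I \<phi> x) =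
    (-1) ^ length I * (LINT x|lborel. partial_derivs (rev I) u x * \<phi> x)"
  using u
proof (induction I arbitrary: u)
  case (Cons i J)
  define g where "g = partial_derivs J \<phi>"
  have g: "smooth g" unfolding g_def by (rule smooth_partial_derivs[OF \<phi>])
  have g0: "g x = 0" if "x \<notin> K" for x
    unfolding g_def by (rule partial_derivs_eq_0[OF compact_imp_closed[OF K(1)] K(2) that])
  have dg0: "partial_deriv i g x = 0" if "x \<notin> K" for x
    using partial_derivs_eq_0[OF compact_imp_closed[OF K(1)] g0 that, where I = "[i]"] by simp
  have u: "smooth u" by fact
  have pd: "partial_deriv j (\<lambda>x. u x * g x) = (\<lambda>x. partial_deriv j u x * g x + u x * partial_deriv j g x)" for j
    using u g by (intro ext partial_deriv_mult smooth_C1)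
  note cont = smooth_continuous[OF u] smooth_continuous[OF g]
    smooth_C1(2)[OF u] smooth_C1(2)[OF g]
  have "0 = (LINT x|lborel. partial_deriv i (\<lambda>x. u x * g x) x)"
  proof (rule integral_partial_deriv_eq_0[OF _ _ K(1), symmetric])
    show "(\<lambda>x. u x * g x) differentiable (at x)" for x
      using u g by (intro differentiable_mult smooth_C1)
    show "continuous_on UNIV (partial_deriv j (\<lambda>x. u x * g x))" for j
      unfolding pd by (intro continuous_intros cont)
  qed (simp add: g0)
  also have "\<dots> = (LINT x|lborel. partial_deriv i u x * g x) + (LINT x|lborel. u x * partial_deriv i g x)"
    unfolding pd
    by (intro Bochner_Integration.integral_add continuous_compact_support_integrable[OF _ K(1)]
        continuous_intros cont) (auto simp: g0 dg0)
  finally have "(LINT x|lborel. u x * partial_derivs (i # J) \<phi> x) =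
      - (LINT x|lborel. partial_deriv i u x * partial_derivs J \<phi> x)"
    by (simp add: g_def)
  also have "\<dots> = (-1) ^ length (i # J) * (LINT x|lborel. partial_derivs (rev (i # J)) u x * \<phi> x)"
    by (subst Cons.IH) (simp_all add: u smooth_partial_deriv partial_derivs_append)
  finally show ?case .
qed simp

lemma integral_lebesgue_on_eq_lborel:
  fixes g :: "real ^ 'n \<Rightarrow> real"
  assumes "open \<Omega>" "g \<in> borel_measurable borel" "\<And>x. x \<notin> \<Omega> \<Longrightarrow> g x = 0"
  shows "(LINT x|lebesgue_on \<Omega>. g x) = (LINT x|lborel. g x)"
proof -
  have "(LINT x|lebesgue_on \<Omega>. g x) = (LINT x|lebesgue. indicator \<Omega> x *\<^sub>R g x)"
    using assms(1) by (subst integral_restrict_space) auto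
  also have "(\<lambda>x. indicator \<Omega> x *\<^sub>R g x) = g"
    using assms(3) by (auto simp: fun_eq_iff indicator_def)
  also have "(LINT x|lebesgue. g x) = (LINT x|lborel. g x)"
    using assms(2) by (intro integral_completion) auto
  finally show ?thesis .
qed

lemma integrable_imp_locally_integrable:
  fixes u :: "real ^ 'n \<Rightarrow> real"
  assumes "integrable lborel u"
  shows "locally_integrable_on u \<Omega>"
  unfolding locally_integrable_on_def
proof (intro allI impI)
  fix K :: "(real ^ 'n) set" assume "compact K \<and> K \<subseteq> \<Omega>"
  then have "K \<in> sets lebesgue" by (auto simp: compact_imp_closed)
  moreover have "integrable lebesgue u"
    using assms by (simp add: integrable_completion)
  ultimately show "u absolutely_integrable_on K"
    unfolding set_integrable_def by (rule integrable_mult_indicator)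
qed

lemma test_function_has_weak_partial:
  fixes \<Omega> :: "(real ^ 'n) set"
  assumes "open \<Omega>" "test_function \<Omega> u"
  shows "has_weak_partial \<Omega> I u (partial_derivs (rev I) u)"
proof -
  have int: "integrable lborel v" if v: "test_function \<Omega> v" for v
    by (rule test_functionE[OF v], rule continuous_compact_support_integrable[OF smooth_continuous])
  obtain K where K: "smooth u" "compact K" "\<And>x. x \<notin> K \<Longrightarrow> u x = 0" "K \<subseteq> \<Omega>"
    using assms(2) by (rule test_functionE) metis
  show ?thesis
    unfolding has_weak_partial_def
  proof (intro conjI allI impI)
    show "locally_integrable_on u \<Omega>" "locally_integrable_on (partial_derivs (rev I) u) \<Omega>"
      using assms(2) by (auto intro!: integrable_imp_locally_integrable int test_function_partial_derivs)
    fix \<phi> assume \<phi>: "test_function \<Omega> \<phi>"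
    obtain K' where K': "smooth \<phi>" "compact K'" "\<And>x. x \<notin> K' \<Longrightarrow> \<phi> x = 0" "K' \<subseteq> \<Omega>"
      using \<phi> by (rule test_functionE) metis
    have "(LINT x|lebesgue_on \<Omega>. u x * partial_derivs I \<phi> x) = (LINT x|lborel. u x * partial_derivs I \<phi> x)"
      using K by (intro integral_lebesgue_on_eq_lborel assms borel_measurable_times smooth_borel
          smooth_partial_derivs K') auto
    also have "\<dots> = (-1) ^ length I * (LINT x|lborel. partial_derivs (rev I) u x * \<phi> x)"
      by (rule smooth_integration_by_parts[OF K(1) K'(1-3)])
    also have "(LINT x|lborel. partial_derivs (rev I) u x * \<phi> x) =
        (LINT x|lebesgue_on \<Omega>. partial_derivs (rev I) u x * \<phi> x)"
      using K' by (intro integral_lebesgue_on_eq_lborel[symmetric] assms borel_measurable_times smooth_borel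
          smooth_partial_derivs K) auto
    finally show "(LINT x|lebesgue_on \<Omega>. u x * partial_derivs I \<phi> x) =
        (-1) ^ length I * (LINT x|lebesgue_on \<Omega>. partial_derivs (rev I) u x * \<phi> x)" .
  qed
qed

section \<open>Translations and mollification of integrable functions\<close>

lemma nn_integral_translate:
  fixes f :: "real ^ 'n \<Rightarrow> ennreal"
  assumes [measurable]: "f \<in> borel_measurable borel"
  shows "(\<integral>\<^sup>+ x. f (x + a) \<partial>lborel) = (\<integral>\<^sup>+ x. f x \<partial>lborel)"
proof -
  have "(\<integral>\<^sup>+ x. f x \<partial>lborel) = (\<integral>\<^sup>+ x. f x \<partial>distr lborel borel ((+) a))"
    by (simp only: lborel_distr_plus)
  also have "\<dots> = (\<integral>\<^sup>+ x. f (x + a) \<partial>lborel)"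
    by (subst nn_integral_distr) (auto simp: add.commute)
  finally show ?thesis by simp
qed

lemma nn_integral_dilate:
  fixes f :: "real ^ 'n \<Rightarrow> ennreal"
  assumes [measurable]: "f \<in> borel_measurable borel" and "c \<noteq> 0"
  shows "ennreal (\<bar>c\<bar> ^ CARD('n)) * (\<integral>\<^sup>+ x. f (t + c *\<^sub>R x) \<partial>lborel) = (\<integral>\<^sup>+ x. f x \<partial>lborel)"
proof -
  have "(\<integral>\<^sup>+ x. f x \<partial>lborel) =
      (\<integral>\<^sup>+ x. f x \<partial>density (distr lborel borel (\<lambda>x. t + c *\<^sub>R x)) (\<lambda>_. ennreal (\<bar>c\<bar> ^ DIM(real^'n))))"
    using lborel_affine[OF \<open>c \<noteq> 0\<close>, of t] by simp
  also have "\<dots> = ennreal (\<bar>c\<bar> ^ CARD('n)) * (\<integral>\<^sup>+ x. f (t + c *\<^sub>R x) \<partial>lborel)"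
    by (simp add: nn_integral_density nn_integral_distr nn_integral_cmult)
  finally show ?thesis ..
qed

lemma integral_dilate:
  fixes f :: "real ^ 'n \<Rightarrow> real"
  assumes [measurable]: "f \<in> borel_measurable borel" and "c \<noteq> 0"
  shows "\<bar>c\<bar> ^ CARD('n) * (LINT x|lborel. f (t + c *\<^sub>R x)) = (LINT x|lborel. f x)"
proof -
  have "(LINT x|lborel. f x) =
      (LINT x|density (distr lborel borel (\<lambda>x. t + c *\<^sub>R x)) (\<lambda>_. ennreal (\<bar>c\<bar> ^ DIM(real^'n))). f x)"
    using lborel_affine[OF \<open>c \<noteq> 0\<close>, of t] by simp
  also have "\<dots> = \<bar>c\<bar> ^ CARD('n) * (LINT x|lborel. f (t + c *\<^sub>R x))"
    by (simp add: integral_density integral_distr)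
  finally show ?thesis ..
qed

definition shift_dist :: "(real ^ 'n \<Rightarrow> real) \<Rightarrow> real ^ 'n \<Rightarrow> ennreal" where
  "shift_dist f h = (\<integral>\<^sup>+ x. ennreal \<bar>f (x + h) - f x\<bar> \<partial>lborel)"

lemma shift_dist_le:
  fixes f :: "real ^ 'n \<Rightarrow> real"
  assumes [measurable]: "f \<in> borel_measurable borel" "g \<in> borel_measurable borel"
  shows "shift_dist f h \<le> 2 * (\<integral>\<^sup>+ x. ennreal \<bar>f x - g x\<bar> \<partial>lborel) + shift_dist g h"
proof -
  have "shift_dist f h \<le> (\<integral>\<^sup>+ x. ennreal \<bar>f (x + h) - g (x + h)\<bar> + (ennreal \<bar>f x - g x\<bar>
      + ennreal \<bar>g (x + h) - g x\<bar>) \<partial>lborel)"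
    unfolding shift_dist_def by (intro nn_integral_mono) (simp flip: ennreal_plus)
  also have "\<dots> = (\<integral>\<^sup>+ x. ennreal \<bar>f (x + h) - g (x + h)\<bar> \<partial>lborel) +
      ((\<integral>\<^sup>+ x. ennreal \<bar>f x - g x\<bar> \<partial>lborel) + shift_dist g h)"
    unfolding shift_dist_def by (subst nn_integral_add, simp_all)+
  also have "(\<integral>\<^sup>+ x. ennreal \<bar>f (x + h) - g (x + h)\<bar> \<partial>lborel) = (\<integral>\<^sup>+ x. ennreal \<bar>f x - g x\<bar> \<partial>lborel)"
    by (rule nn_integral_translate[where f = "\<lambda>x. ennreal \<bar>f x - g x\<bar>"]) simp
  finally show ?thesis by (simp add: mult_2 add.assoc)
qed

text \<open>The functions whose translates converge to them in \<open>L\<^sup>1\<close> are closed under limits in \<open>L\<^sup>1\<close>,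
  because translation preserves the \<open>L\<^sup>1\<close> norm.\<close>

lemma shift_dist_tendsto_approx:
  fixes f :: "real ^ 'n \<Rightarrow> real"
  assumes f: "f \<in> borel_measurable borel"
    and approx: "\<And>e::real. e > 0 \<Longrightarrow> \<exists>g. g \<in> borel_measurable borel \<and>
      (\<integral>\<^sup>+ x. ennreal \<bar>f x - g x\<bar> \<partial>lborel) \<le> ennreal e \<and> (\<lambda>j. shift_dist g (h j)) \<longlonglongrightarrow> 0"
  shows "(\<lambda>j::nat. shift_dist f (h j)) \<longlonglongrightarrow> 0"
proof (rule order_tendstoI)
  fix a :: ennreal assume "a > 0"
  then obtain e :: real where e: "e > 0" "ennreal e < a"
    by (metis dense ennreal_cases ennreal_less_zero_iff less_irrefl less_top_ennreal not_less_zero order_less_le_trans top_greatest)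
  obtain g where g: "g \<in> borel_measurable borel"
    "(\<integral>\<^sup>+ x. ennreal \<bar>f x - g x\<bar> \<partial>lborel) \<le> ennreal (e / 4)" "(\<lambda>j. shift_dist g (h j)) \<longlonglongrightarrow> 0"
    using approx[of "e / 4"] e by auto
  have "eventually (\<lambda>j. shift_dist g (h j) < ennreal (e / 2)) sequentially"
    using order_tendstoD(2)[OF g(3), of "ennreal (e / 2)"] e by simp
  then show "eventually (\<lambda>j. shift_dist f (h j) < a) sequentially"
  proof eventually_elim
    case (elim j)
    have "shift_dist f (h j) \<le> 2 * ennreal (e / 4) + shift_dist g (h j)"
      using shift_dist_le[OF f g(1), of "h j"] g(2) by (meson add_right_mono dual_order.trans mult_left_mono zero_le)
    also have "\<dots> \<le> 2 * ennreal (e / 4) + ennreal (e / 2)"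
      using elim by (intro add_left_mono) simp
    also have "\<dots> = ennreal e"
      using e by (simp add: ennreal_mult'[of 2, symmetric] flip: ennreal_plus ennreal_numeral)
    finally show ?case using e by simp
  qed
qed simp

text \<open>Since \<open>V\<close> and its translate have the same finite measure, the two halves of their
  symmetric difference have equal measure. The half inside \<open>V\<close> is treated by dominated
  convergence: every point of an open set stays inside under small translations.\<close>

lemma shift_dist_open_tendsto_0:
  fixes V :: "(real ^ 'n) set"
  assumes V: "open V" "emeasure lborel V < \<infinity>" and h: "h \<longlonglongrightarrow> 0"
  shows "(\<lambda>j::nat. shift_dist (indicator V) (h j)) \<longlonglongrightarrow> 0"
proof -
  have [measurable]: "V \<in> sets borel" using V by auto
  let ?d = "\<lambda>j x. indicator V x * indicator (- V) (x + h j) :: ennreal"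
  have eq: "shift_dist (indicator V) (h j) = 2 * (\<integral>\<^sup>+ x. ?d j x \<partial>lborel)" for j
  proof -
    let ?b = "\<lambda>x. indicator V (x + h j) * indicator (- V) x :: ennreal"
    let ?c = "\<lambda>x. indicator V (x + h j) * indicator V x :: ennreal"
    have c: "(\<integral>\<^sup>+ x. ?c x \<partial>lborel) < \<infinity>"
      by (rule le_less_trans[OF _ V(2)])
         (auto simp: indicator_def simp flip: nn_integral_indicator intro!: nn_integral_mono)
    have "(\<integral>\<^sup>+ x. ?b x \<partial>lborel) + (\<integral>\<^sup>+ x. ?c x \<partial>lborel) = (\<integral>\<^sup>+ x. indicator V (x + h j) \<partial>lborel)"
      by (subst nn_integral_add[symmetric]) (auto simp: indicator_def intro!: nn_integral_cong)
    also have "\<dots> = (\<integral>\<^sup>+ x. indicator V x \<partial>lborel)"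
      by (rule nn_integral_translate) simp
    also have "\<dots> = (\<integral>\<^sup>+ x. ?d j x \<partial>lborel) + (\<integral>\<^sup>+ x. ?c x \<partial>lborel)"
      by (subst nn_integral_add[symmetric]) (auto simp: indicator_def simp del: nn_integral_indicator intro!: nn_integral_cong)
    finally have bd: "(\<integral>\<^sup>+ x. ?b x \<partial>lborel) = (\<integral>\<^sup>+ x. ?d j x \<partial>lborel)"
      using c by (auto simp: ennreal_add_left_cancel add.commute)
    have "shift_dist (indicator V) (h j) = (\<integral>\<^sup>+ x. ?b x + ?d j x \<partial>lborel)"
      unfolding shift_dist_def by (intro nn_integral_cong) (auto simp: indicator_def)
    also have "\<dots> = (\<integral>\<^sup>+ x. ?b x \<partial>lborel) + (\<integral>\<^sup>+ x. ?d j x \<partial>lborel)"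
      by (intro nn_integral_add) auto
    finally show ?thesis by (simp add: bd mult_2)
  qed
  have "(\<lambda>j. \<integral>\<^sup>+ x. ?d j x \<partial>lborel) \<longlonglongrightarrow> (\<integral>\<^sup>+ (x :: real ^ 'n). 0 \<partial>lborel)"
  proof (rule nn_integral_dominated_convergence[where w = "indicator V"])
    show "AE x in lborel. (\<lambda>j. ?d j x) \<longlonglongrightarrow> 0"
    proof (rule AE_I2)
      fix x
      show "(\<lambda>j. ?d j x) \<longlonglongrightarrow> 0"
      proof (cases "x \<in> V")
        case True
        have "(\<lambda>j. x + h j) \<longlonglongrightarrow> x"
          using tendsto_add[OF tendsto_const h, of x] by simp
        then have "eventually (\<lambda>j. x + h j \<in> V) sequentially"
          using True V(1) by (simp add: topological_tendstoD)
        then have "eventually (\<lambda>j. 0 = ?d j x) sequentially"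
          by eventually_elim (simp add: indicator_def)
        then show ?thesis by (rule Lim_transform_eventually[OF tendsto_const])
      qed simp
    qed
  qed (use V(2) in \<open>auto split: split_indicator\<close>)
  then have "(\<lambda>j. 2 * (\<integral>\<^sup>+ x. ?d j x \<partial>lborel)) \<longlonglongrightarrow> 2 * 0"
    by (intro ennreal_tendsto_cmult) auto
  then show ?thesis unfolding eq by simp
qed

text \<open>Open sets are covered by the previous lemma. Outer regularity extends the claim to
  indicators of measurable sets, and linearity and limits in \<open>L\<^sup>1\<close> extend it to all
  integrable functions.\<close>

lemma shift_dist_tendsto_0:
  fixes f :: "real ^ 'n \<Rightarrow> real"
  assumes "integrable lborel f" and h: "h \<longlonglongrightarrow> 0"
  shows "(\<lambda>j::nat. shift_dist f (h j)) \<longlonglongrightarrow> 0"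
  using assms(1)
proof induction
  case (base A c)
  have [measurable]: "A \<in> sets borel" using base by simp
  have "(\<lambda>j. shift_dist (indicator A) (h j)) \<longlonglongrightarrow> 0"
  proof (rule shift_dist_tendsto_approx)
    fix e :: real assume "e > 0"
    then obtain U where U: "open U" "A \<subseteq> U" "emeasure lborel (U - A) < ennreal e"
      using outer_regular_lborel[of A e] base by auto
    have [measurable]: "U \<in> sets borel" using U by auto
    have "emeasure lborel U \<le> emeasure lborel A + emeasure lborel (U - A)"
      using U(2) by (subst plus_emeasure) (auto simp: Un_absorb1)
    also have "\<dots> < \<infinity>" using base U(3) by (auto simp: less_top[symmetric] top_unique)
    finally have "emeasure lborel U < \<infinity>" .
    moreover have "(\<integral>\<^sup>+ x. ennreal \<bar>indicat_real A x - indicator U x\<bar> \<partial>lborel) = emeasure lborel (U - A)"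
      using U(2) by (subst nn_integral_indicator[symmetric])
        (auto simp: indicator_def simp del: nn_integral_indicator intro!: nn_integral_cong)
    ultimately show "\<exists>g. g \<in> borel_measurable borel \<and>
      (\<integral>\<^sup>+ x. ennreal \<bar>indicat_real A x - g x\<bar> \<partial>lborel) \<le> ennreal e \<and> (\<lambda>j. shift_dist g (h j)) \<longlonglongrightarrow> 0"
      using shift_dist_open_tendsto_0[OF U(1) _ h] U(3) by (intro exI[of _ "indicator U"]) auto
  qed simp
  then have "(\<lambda>j. ennreal \<bar>c\<bar> * shift_dist (indicator A) (h j)) \<longlonglongrightarrow> ennreal \<bar>c\<bar> * 0"
    by (intro ennreal_tendsto_cmult) auto
  moreover have "ennreal \<bar>c\<bar> * shift_dist (indicator A) k = shift_dist (\<lambda>x. indicator A x *\<^sub>R c) k" for k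
    unfolding shift_dist_def
    by (subst nn_integral_cmult[symmetric])
       (auto simp: ennreal_mult'[symmetric] abs_mult[symmetric] algebra_simps intro!: nn_integral_cong)
  ultimately show ?case by simp
next
  case (add f g)
  have [measurable]: "f \<in> borel_measurable borel" "g \<in> borel_measurable borel" using add by auto
  have le: "shift_dist (\<lambda>x. f x + g x) k \<le> shift_dist f k + shift_dist g k" for k
  proof -
    have "shift_dist (\<lambda>x. f x + g x) k \<le>
      (\<integral>\<^sup>+ x. ennreal \<bar>f (x + k) - f x\<bar> + ennreal \<bar>g (x + k) - g x\<bar> \<partial>lborel)"
      unfolding shift_dist_def by (intro nn_integral_mono) (simp flip: ennreal_plus)
    also have "\<dots> = shift_dist f k + shift_dist g k"
      unfolding shift_dist_def by (intro nn_integral_add) auto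
    finally show ?thesis .
  qed
  have "(\<lambda>j. shift_dist f (h j) + shift_dist g (h j)) \<longlonglongrightarrow> 0 + 0"
    using add by (intro tendsto_add) auto
  then have lim0: "(\<lambda>j. shift_dist f (h j) + shift_dist g (h j)) \<longlonglongrightarrow> 0" by simp
  show ?case
    by (rule tendsto_sandwich[OF _ _ tendsto_const lim0]) (simp_all add: le)
next
  case (lim f s)
  have fm [measurable]: "f \<in> borel_measurable borel" and sm [measurable]: "\<And>i. s i \<in> borel_measurable borel"
    using lim by auto
  show ?case
  proof (rule shift_dist_tendsto_approx[OF fm])
    fix e :: real assume "e > 0"
    have "(\<lambda>i. \<integral>\<^sup>+ x. ennreal \<bar>f x - s i x\<bar> \<partial>lborel) \<longlonglongrightarrow> (\<integral>\<^sup>+ (x :: real ^ 'n). 0 \<partial>lborel)"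
    proof (rule nn_integral_dominated_convergence[where w = "\<lambda>x. ennreal (3 * \<bar>f x\<bar>)"])
      show "AE x in lborel. ennreal \<bar>f x - s j x\<bar> \<le> ennreal (3 * \<bar>f x\<bar>)" for j
      proof (rule AE_I2, rule ennreal_leI)
        show "\<bar>f x - s j x\<bar> \<le> 3 * \<bar>f x\<bar>" for x
          using lim(3)[of x j] by simp
      qed
      show "(\<integral>\<^sup>+ x. ennreal (3 * \<bar>f x\<bar>) \<partial>lborel) < \<infinity>"
      proof -
        have "(\<integral>\<^sup>+ x. ennreal (3 * \<bar>f x\<bar>) \<partial>lborel) = 3 * (\<integral>\<^sup>+ x. ennreal \<bar>f x\<bar> \<partial>lborel)"
          by (subst nn_integral_cmult[symmetric]) (auto simp: ennreal_mult')
        then show ?thesis using lim(4) by (simp add: integrable_iff_bounded ennreal_mult_less_top)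
      qed
      show "AE x in lborel. (\<lambda>i. ennreal \<bar>f x - s i x\<bar>) \<longlonglongrightarrow> 0"
      proof (rule AE_I2)
        fix x
        have "(\<lambda>i. s i x) \<longlonglongrightarrow> f x" using lim by simp
        then have "(\<lambda>i. \<bar>f x - s i x\<bar>) \<longlonglongrightarrow> \<bar>f x - f x\<bar>"
          by (intro tendsto_intros)
        from tendsto_ennrealI[OF this] show "(\<lambda>i. ennreal \<bar>f x - s i x\<bar>) \<longlonglongrightarrow> 0"
          by simp
      qed
    qed auto
    then have "eventually (\<lambda>i. (\<integral>\<^sup>+ x. ennreal \<bar>f x - s i x\<bar> \<partial>lborel) < ennreal e) sequentially"
      using \<open>e > 0\<close> by (intro order_tendstoD) auto
    then obtain i where "(\<integral>\<^sup>+ x. ennreal \<bar>f x - s i x\<bar> \<partial>lborel) < ennreal e"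
      using eventually_happens' sequentially_bot by blast
    then show "\<exists>g. g \<in> borel_measurable borel \<and>
      (\<integral>\<^sup>+ x. ennreal \<bar>f x - g x\<bar> \<partial>lborel) \<le> ennreal e \<and> (\<lambda>j. shift_dist g (h j)) \<longlonglongrightarrow> 0"
      using lim by (intro exI[of _ "s i"]) auto
  qed
qed

definition mollifier :: "(real ^ 'n \<Rightarrow> real) \<Rightarrow> bool" where
  "mollifier \<eta> \<longleftrightarrow> smooth \<eta> \<and> (\<forall>x. \<eta> x \<ge> 0) \<and> (\<forall>x. norm x \<ge> 1 \<longrightarrow> \<eta> x = 0) \<and>
     (LINT x|lborel. \<eta> x) = 1"

text \<open>The convolution of \<open>f\<close> with the mollifier of radius \<open>\<delta>\<close>, after the substitution that moves
  the radius from the kernel to the argument of \<open>f\<close>.\<close>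

definition mollify :: "(real ^ 'n \<Rightarrow> real) \<Rightarrow> real \<Rightarrow> (real ^ 'n \<Rightarrow> real) \<Rightarrow> real ^ 'n \<Rightarrow> real" where
  "mollify \<eta> \<delta> f x = (LINT z|lborel. f (x - \<delta> *\<^sub>R z) * \<eta> z)"

lemma mollifier_integrable:
  assumes "mollifier \<eta>"
  shows "integrable lborel \<eta>"
  by (rule continuous_compact_support_integrable[where K = "cball 0 1"])
     (use assms in \<open>auto simp: mollifier_def intro: smooth_continuous\<close>)

lemma mollifier_exists: "\<exists>\<eta> :: real ^ 'n \<Rightarrow> real. mollifier \<eta>"
proof -
  obtain \<psi> :: "real ^ 'n \<Rightarrow> real" where \<psi>: "smooth \<psi>" "\<And>x. \<psi> x \<ge> 0" "\<And>x. norm x \<ge> 1 \<Longrightarrow> \<psi> x = 0" "\<psi> 0 > 0"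
    using smooth_bump_exists by metis
  have int: "integrable lborel \<psi>"
    by (rule continuous_compact_support_integrable[where K = "cball 0 1"])
       (use \<psi> in \<open>auto intro: smooth_continuous\<close>)
  have "(LINT x|lborel. \<psi> x) \<noteq> 0"
  proof
    assume "(LINT x|lborel. \<psi> x) = 0"
    then have "AE x in lborel. \<psi> x = 0"
      using int \<psi>(2) by (subst (asm) integral_nonneg_eq_0_iff_AE) auto
    then have "\<psi> 0 = 0"
    proof -
      assume ae: "AE x in lborel. \<psi> x = 0"
      have "open {x. \<psi> x \<noteq> 0}"
        by (intro open_Collect_neq smooth_continuous[OF \<psi>(1)] continuous_on_const)
      moreover from this have "negligible {x. \<psi> x \<noteq> 0}"
        using AE_completion[OF ae] by (simp add: negligible_iff_null_sets AE_iff_null_sets)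
      ultimately show ?thesis using open_not_negligible by blast
    qed
    with \<psi>(4) show False by simp
  qed
  then have I: "(LINT x|lborel. \<psi> x) > 0"
    using \<psi>(2) by (simp add: less_le integral_nonneg_AE)
  have "smooth (\<lambda>x. inverse (LINT x|lborel. \<psi> x) * \<psi> (1 *\<^sub>R x + 0))"
    by (rule smooth_affine[OF \<psi>(1)])
  then have "mollifier (\<lambda>x. inverse (LINT x|lborel. \<psi> x) * \<psi> x)"
    using I \<psi> by (auto simp: mollifier_def)
  then show ?thesis by blast
qed

lemma mollifier_bounded:
  assumes "mollifier \<eta>"
  obtains D where "D > 0" "\<And>x. \<bar>\<eta> x\<bar> \<le> D"
proof (rule continuous_compact_support_bounded[of \<eta> "cball 0 1"])
  show "continuous_on UNIV \<eta>" using assms by (simp add: mollifier_def smooth_continuous)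
  show "\<eta> x = 0" if "x \<notin> cball 0 1" for x using that assms by (simp add: mollifier_def)
qed (use that in auto)

lemma mollifier_borel: "mollifier \<eta> \<Longrightarrow> \<eta> \<in> borel_measurable borel"
  by (simp add: mollifier_def smooth_borel)

lemma integrable_mollify_integrand:
  fixes f :: "real ^ 'n \<Rightarrow> real"
  assumes \<eta>: "mollifier \<eta>" and f: "integrable lborel f" and "\<delta> > 0"
  shows "integrable lborel (\<lambda>z. f (x - \<delta> *\<^sub>R z) * \<eta> z)"
proof -
  have [measurable]: "f \<in> borel_measurable borel" "\<eta> \<in> borel_measurable borel"
    using f mollifier_borel[OF \<eta>] by auto
  obtain D where D: "D > 0" "\<And>x. \<bar>\<eta> x\<bar> \<le> D" using mollifier_bounded[OF \<eta>] by blast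
  have "ennreal (\<bar>-\<delta>\<bar> ^ CARD('n)) * (\<integral>\<^sup>+ z. ennreal \<bar>f (x + (-\<delta>) *\<^sub>R z)\<bar> \<partial>lborel) = (\<integral>\<^sup>+ z. ennreal \<bar>f z\<bar> \<partial>lborel)"
    by (rule nn_integral_dilate[where f = "\<lambda>z. ennreal \<bar>f z\<bar>"]) (use \<open>\<delta> > 0\<close> in auto)
  also have "\<dots> < \<infinity>" using f by (simp add: integrable_iff_bounded)
  finally have "(\<integral>\<^sup>+ z. ennreal \<bar>f (x - \<delta> *\<^sub>R z)\<bar> \<partial>lborel) < \<infinity>"
    using \<open>\<delta> > 0\<close> by (auto simp: ennreal_mult_less_top)
  then have "integrable lborel (\<lambda>z. f (x - \<delta> *\<^sub>R z))"
    by (simp add: integrable_iff_bounded)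
  then have "integrable lborel (\<lambda>z. D * f (x - \<delta> *\<^sub>R z))" by simp
  then show ?thesis
    by (rule Bochner_Integration.integrable_bound)
       (use D in \<open>auto simp: abs_mult mult.commute[of D] intro!: mult_left_mono\<close>)
qed

text \<open>By Fubini's theorem, the \<open>L\<^sup>1\<close> distance is at most the mean of the distances between \<open>f\<close>
  and its translates by \<open>\<delta>z\<close>, taken with the weight \<open>\<eta>(z)\<close>.\<close>

lemma mollify_L1_tendsto:
  fixes f :: "real ^ 'n \<Rightarrow> real"
  assumes \<eta>: "mollifier \<eta>" and f: "integrable lborel f" and \<delta>: "\<delta> \<longlonglongrightarrow> 0" "\<And>j. \<delta> j > 0"
  shows "(\<lambda>j::nat. \<integral>\<^sup>+ x. ennreal \<bar>mollify \<eta> (\<delta> j) f x - f x\<bar> \<partial>lborel) \<longlonglongrightarrow> 0"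
proof -
  have [measurable]: "f \<in> borel_measurable borel" "\<eta> \<in> borel_measurable borel"
    using f mollifier_borel[OF \<eta>] by auto
  have \<eta>0: "\<eta> z \<ge> 0" for z using \<eta> by (simp add: mollifier_def)
  have \<eta>1: "(LINT z|lborel. \<eta> z) = 1" using \<eta> by (simp add: mollifier_def)
  have sm: "(\<lambda>z. shift_dist f (c *\<^sub>R z)) \<in> borel_measurable borel" for c
    unfolding shift_dist_def by measurable
  have bound: "(\<integral>\<^sup>+ x. ennreal \<bar>mollify \<eta> (\<delta> j) f x - f x\<bar> \<partial>lborel) \<le>
      (\<integral>\<^sup>+ z. shift_dist f (- \<delta> j *\<^sub>R z) * ennreal (\<eta> z) \<partial>lborel)" for j
  proof -
    have "ennreal \<bar>mollify \<eta> (\<delta> j) f x - f x\<bar> \<le> (\<integral>\<^sup>+ z. ennreal \<bar>f (x - \<delta> j *\<^sub>R z) - f x\<bar> * ennreal (\<eta> z) \<partial>lborel)" for x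
    proof -
      have int: "integrable lborel (\<lambda>z. f (x - \<delta> j *\<^sub>R z) * \<eta> z)" "integrable lborel (\<lambda>z. f x * \<eta> z)"
        using mollifier_integrable[OF \<eta>] \<delta> by (auto intro: integrable_mollify_integrand[OF \<eta> f])
      have "mollify \<eta> (\<delta> j) f x - f x = (LINT z|lborel. f (x - \<delta> j *\<^sub>R z) * \<eta> z) - (LINT z|lborel. f x * \<eta> z)"
        by (simp add: mollify_def \<eta>1)
      also have "\<dots> = (LINT z|lborel. f (x - \<delta> j *\<^sub>R z) * \<eta> z - f x * \<eta> z)"
        by (rule Bochner_Integration.integral_diff[OF int, symmetric])
      finally have "ennreal \<bar>mollify \<eta> (\<delta> j) f x - f x\<bar> \<le>
          (\<integral>\<^sup>+ z. ennreal \<bar>f (x - \<delta> j *\<^sub>R z) * \<eta> z - f x * \<eta> z\<bar> \<partial>lborel)"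
        using integral_norm_bound_ennreal[OF Bochner_Integration.integrable_diff[OF int]] by simp
      also have "\<dots> = (\<integral>\<^sup>+ z. ennreal \<bar>f (x - \<delta> j *\<^sub>R z) - f x\<bar> * ennreal (\<eta> z) \<partial>lborel)"
        by (intro nn_integral_cong)
           (simp add: \<eta>0 flip: left_diff_distrib ennreal_mult' ennreal_mult'' abs_mult_pos)
      finally show ?thesis .
    qed
    then have "(\<integral>\<^sup>+ x. ennreal \<bar>mollify \<eta> (\<delta> j) f x - f x\<bar> \<partial>lborel) \<le>
      (\<integral>\<^sup>+ x. \<integral>\<^sup>+ z. ennreal \<bar>f (x - \<delta> j *\<^sub>R z) - f x\<bar> * ennreal (\<eta> z) \<partial>lborel \<partial>lborel)"
      by (intro nn_integral_mono)
    also have "\<dots> = (\<integral>\<^sup>+ z. \<integral>\<^sup>+ x. ennreal \<bar>f (x - \<delta> j *\<^sub>R z) - f x\<bar> * ennreal (\<eta> z) \<partial>lborel \<partial>lborel)"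
      by (rule lborel_pair.Fubini') measurable
    also have "\<dots> = (\<integral>\<^sup>+ z. shift_dist f (- \<delta> j *\<^sub>R z) * ennreal (\<eta> z) \<partial>lborel)"
      unfolding shift_dist_def by (intro nn_integral_cong) (subst nn_integral_multc, simp_all)
    finally show ?thesis .
  qed
  have sd2: "shift_dist f h \<le> 2 * (\<integral>\<^sup>+ x. ennreal \<bar>f x\<bar> \<partial>lborel)" for h
    using shift_dist_le[of f "\<lambda>_. 0" h] by (simp add: shift_dist_def[of "\<lambda>_. 0"])
  have "(\<lambda>j. \<integral>\<^sup>+ z. shift_dist f (- \<delta> j *\<^sub>R z) * ennreal (\<eta> z) \<partial>lborel) \<longlonglongrightarrow> (\<integral>\<^sup>+ (z :: real ^ 'n). 0 \<partial>lborel)"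
  proof (rule nn_integral_dominated_convergence[where w = "\<lambda>z. 2 * (\<integral>\<^sup>+ x. ennreal \<bar>f x\<bar> \<partial>lborel) * ennreal (\<eta> z)"])
    show "AE z in lborel. shift_dist f (- \<delta> j *\<^sub>R z) * ennreal (\<eta> z) \<le>
        2 * (\<integral>\<^sup>+ x. ennreal \<bar>f x\<bar> \<partial>lborel) * ennreal (\<eta> z)" for j
      by (intro AE_I2 mult_right_mono sd2) auto
    have "(\<integral>\<^sup>+ z. ennreal (\<eta> z) \<partial>lborel) < \<infinity>"
      using mollifier_integrable[OF \<eta>] \<eta>0 by (simp add: integrable_iff_bounded)
    moreover have "(\<integral>\<^sup>+ x. ennreal \<bar>f x\<bar> \<partial>lborel) < \<infinity>"
      using f by (simp add: integrable_iff_bounded)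
    ultimately show "(\<integral>\<^sup>+ z. 2 * (\<integral>\<^sup>+ x. ennreal \<bar>f x\<bar> \<partial>lborel) * ennreal (\<eta> z) \<partial>lborel) < \<infinity>"
      by (subst nn_integral_cmult) (auto simp: ennreal_mult_less_top)
    show "AE z in lborel. (\<lambda>j. shift_dist f (- \<delta> j *\<^sub>R z) * ennreal (\<eta> z)) \<longlonglongrightarrow> 0"
    proof (rule AE_I2)
      fix z :: "real ^ 'n"
      have "(\<lambda>j. - \<delta> j *\<^sub>R z) \<longlonglongrightarrow> 0"
        using tendsto_scaleR[OF tendsto_minus[OF \<delta>(1)] tendsto_const[of z]] by simp
      then have "(\<lambda>j. shift_dist f (- \<delta> j *\<^sub>R z)) \<longlonglongrightarrow> 0"
        by (rule shift_dist_tendsto_0[OF f])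
      from ennreal_tendsto_cmult[OF _ this, of "ennreal (\<eta> z)"]
      show "(\<lambda>j. shift_dist f (- \<delta> j *\<^sub>R z) * ennreal (\<eta> z)) \<longlonglongrightarrow> 0"
        by (simp add: mult.commute)
    qed
  qed (use sm in measurable)
  then have lim: "(\<lambda>j. \<integral>\<^sup>+ z. shift_dist f (- \<delta> j *\<^sub>R z) * ennreal (\<eta> z) \<partial>lborel) \<longlonglongrightarrow> 0" by simp
  show ?thesis
    by (rule tendsto_sandwich[OF always_eventually[OF allI] always_eventually[OF allI[OF bound]] tendsto_const lim]) simp
qed

lemma mollify_AE_tendsto:
  fixes f :: "real ^ 'n \<Rightarrow> real"
  assumes \<eta>: "mollifier \<eta>" and f: "integrable lborel f" and \<delta>: "\<delta> \<longlonglongrightarrow> 0" "\<And>j. \<delta> j > 0"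
  obtains r :: "nat \<Rightarrow> nat" where "strict_mono r"
    "AE x in lborel. (\<lambda>j. mollify \<eta> (\<delta> (r j)) f x) \<longlonglongrightarrow> f x"
proof -
  have [measurable]: "f \<in> borel_measurable borel" "\<eta> \<in> borel_measurable borel"
    using f mollifier_borel[OF \<eta>] by auto
  have mm [measurable]: "mollify \<eta> c f \<in> borel_measurable borel" for c
    unfolding mollify_def by measurable
  note lim = mollify_L1_tendsto[OF \<eta> f \<delta>]
  have "eventually (\<lambda>j. (\<integral>\<^sup>+ x. ennreal \<bar>mollify \<eta> (\<delta> j) f x - f x\<bar> \<partial>lborel) < 1) sequentially"
    using order_tendstoD(2)[OF lim, of 1] by simp
  then obtain N where N: "\<And>j. j \<ge> N \<Longrightarrow> (\<integral>\<^sup>+ x. ennreal \<bar>mollify \<eta> (\<delta> j) f x - f x\<bar> \<partial>lborel) < 1"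
    by (auto simp: eventually_sequentially)
  let ?u = "\<lambda>j x. mollify \<eta> (\<delta> (j + N)) f x - f x"
  have iu: "integrable lborel (?u j)" for j
    using N[of "j + N"] by (auto simp: integrable_iff_bounded intro: less_trans)
  have eq: "ennreal (LINT x|lborel. norm (?u j x)) = (\<integral>\<^sup>+ x. ennreal \<bar>?u j x\<bar> \<partial>lborel)" for j
    using nn_integral_eq_integral[OF integrable_norm[OF iu[of j]]] by simp
  have "(\<lambda>j. ennreal (LINT x|lborel. norm (?u j x))) \<longlonglongrightarrow> ennreal 0"
    unfolding eq using LIMSEQ_ignore_initial_segment[OF lim, of N] by simp
  then have "(\<lambda>j. LINT x|lborel. norm (?u j x)) \<longlonglongrightarrow> 0"
    by (subst (asm) tendsto_ennreal_iff) (auto intro!: always_eventually integral_nonneg_AE)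
  from tendsto_L1_AE_subseq[OF iu this]
  obtain r where r: "strict_mono r" "AE x in lborel. (\<lambda>j. ?u (r j) x) \<longlonglongrightarrow> 0"
    by blast
  show ?thesis
  proof (rule that[of "\<lambda>j. r j + N"])
    show "strict_mono (\<lambda>j. r j + N)" using r(1) by (auto simp: strict_mono_def)
    show "AE x in lborel. (\<lambda>j. mollify \<eta> (\<delta> (r j + N)) f x) \<longlonglongrightarrow> f x"
      using r(2) by eventually_elim (simp add: LIM_zero_iff)
  qed
qed

text \<open>In this form the variable of integration sits in the kernel, which for a mollifier \<open>\<eta>\<close> is
  a test function, so the definition of weak derivatives applies to it.\<close>

lemma mollify_eq_convolution:
  fixes f :: "real ^ 'n \<Rightarrow> real"
  assumes [measurable]: "f \<in> borel_measurable borel" "\<eta> \<in> borel_measurable borel" and "\<delta> > 0"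
  shows "mollify \<eta> \<delta> f x =
    (LINT y|lborel. f y * (inverse (\<delta> ^ CARD('n)) * \<eta> ((- inverse \<delta>) *\<^sub>R y + inverse \<delta> *\<^sub>R x)))"
proof -
  let ?g = "\<lambda>y. f y * (inverse (\<delta> ^ CARD('n)) * \<eta> ((- inverse \<delta>) *\<^sub>R y + inverse \<delta> *\<^sub>R x))"
  have "(LINT y|lborel. ?g y) = \<bar>-\<delta>\<bar> ^ CARD('n) * (LINT z|lborel. ?g (x + (-\<delta>) *\<^sub>R z))"
    by (rule integral_dilate[symmetric]) (use \<open>\<delta> > 0\<close> in auto)
  also have "\<dots> = (LINT z|lborel. \<delta> ^ CARD('n) * ?g (x + (-\<delta>) *\<^sub>R z))"
    using \<open>\<delta> > 0\<close> by simp
  also have "\<dots> = mollify \<eta> \<delta> f x"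
    unfolding mollify_def
  proof (rule Bochner_Integration.integral_cong[OF refl])
    fix z :: "real ^ 'n"
    have "(- inverse \<delta>) *\<^sub>R (x + (-\<delta>) *\<^sub>R z) + inverse \<delta> *\<^sub>R x = z"
      using \<open>\<delta> > 0\<close> by (simp add: scaleR_diff_right)
    then show "\<delta> ^ CARD('n) * ?g (x + (-\<delta>) *\<^sub>R z) = f (x - \<delta> *\<^sub>R z) * \<eta> z"
      using \<open>\<delta> > 0\<close> by simp
  qed
  finally show ?thesis ..
qed

section \<open>Uniqueness of weak derivatives\<close>

lemma mollifier_test_function:
  fixes \<eta> :: "real ^ 'n \<Rightarrow> real"
  assumes "mollifier \<eta>" "\<delta> > 0" "cball x \<delta> \<subseteq> \<Omega>"
  shows "test_function \<Omega> (\<lambda>y. a * \<eta> ((- inverse \<delta>) *\<^sub>R y + inverse \<delta> *\<^sub>R x))"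
proof (rule test_functionI[where K = "cball x \<delta>"])
  show "smooth (\<lambda>y. a * \<eta> ((- inverse \<delta>) *\<^sub>R y + inverse \<delta> *\<^sub>R x))"
    using assms by (intro smooth_affine) (simp add: mollifier_def)
  fix y assume "y \<notin> cball x \<delta>"
  then have "\<delta> < norm (x - y)" by (simp add: dist_norm)
  moreover have "(- inverse \<delta>) *\<^sub>R y + inverse \<delta> *\<^sub>R x = inverse \<delta> *\<^sub>R (x - y)"
    by (simp add: algebra_simps)
  moreover have "norm (inverse \<delta> *\<^sub>R (x - y)) = norm (x - y) / \<delta>"
    using \<open>\<delta> > 0\<close> by (simp only: norm_scaleR) (simp add: field_simps)
  ultimately have "norm ((- inverse \<delta>) *\<^sub>R y + inverse \<delta> *\<^sub>R x) \<ge> 1"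
    using \<open>\<delta> > 0\<close> by (simp only: le_divide_eq) simp
  then show "a * \<eta> ((- inverse \<delta>) *\<^sub>R y + inverse \<delta> *\<^sub>R x) = 0"
    using assms(1) by (simp add: mollifier_def)
qed (use assms in auto)

lemma integrable_lebesgue_borel_version:
  fixes g :: "real ^ 'n \<Rightarrow> real"
  assumes "integrable lebesgue g"
  obtains f where "integrable lborel f" "AE x in lebesgue. g x = f x"
proof -
  obtain f where f: "f \<in> borel_measurable lborel" "AE x in lborel. g x = f x"
    using completion_ex_borel_measurable_real[of g lborel] assms by auto
  have ae: "AE x in lebesgue. g x = f x" using f(2) by (rule AE_completion)
  have "integrable lebesgue f"
    using assms f by (subst integrable_cong_AE[where g = g]) (use ae in \<open>auto intro: measurable_completion\<close>)
  then have "integrable lborel f" using f by (simp add: integrable_completion)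
  then show ?thesis using that ae by blast
qed

text \<open>Near a point of \<open>\<Omega>\<close>, a mollification of \<open>w\<close> is the integral of \<open>w\<close> against a test function
  and hence zero. Along a sequence of radii the mollifications converge to \<open>w\<close> almost
  everywhere. Countably many such neighbourhoods cover \<open>\<Omega>\<close>.\<close>

lemma fundamental_lemma_test_functions:
  fixes w :: "real ^ 'n \<Rightarrow> real"
  assumes \<Omega>: "open \<Omega>" and w: "locally_integrable_on w \<Omega>"
    and zero: "\<And>\<phi>. test_function \<Omega> \<phi> \<Longrightarrow> (LINT x|lebesgue_on \<Omega>. w x * \<phi> x) = 0"
  shows "AE x in lebesgue. x \<in> \<Omega> \<longrightarrow> w x = 0"
proof -
  obtain \<eta> :: "real ^ 'n \<Rightarrow> real" where \<eta>: "mollifier \<eta>" using mollifier_exists by blast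
  have [measurable]: "\<eta> \<in> borel_measurable borel" by (rule mollifier_borel[OF \<eta>])
  have local: "\<exists>r>0. AE x in lebesgue. x \<in> ball p r \<longrightarrow> w x = 0" if p: "p \<in> \<Omega>" for p
  proof -
    obtain e where e: "e > 0" "cball p e \<subseteq> \<Omega>"
      using \<Omega> p unfolding open_contains_cball by meson
    define r where "r = e / 2"
    have r: "r > 0" "cball p (2 * r) \<subseteq> \<Omega>" using e by (auto simp: r_def)
    let ?g = "\<lambda>x. indicator (cball p (2 * r)) x *\<^sub>R w x"
    have g: "integrable lebesgue ?g"
      using w r unfolding locally_integrable_on_def set_integrable_def by auto
    obtain f where f: "integrable lborel f" "AE x in lebesgue. ?g x = f x"
      using g
      by (rule integrable_lebesgue_borel_version)
    have [measurable]: "f \<in> borel_measurable borel" using f by auto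
    have zero': "mollify \<eta> \<delta> f x = 0" if x: "x \<in> ball p r" and \<delta>: "0 < \<delta>" "\<delta> < r" for x \<delta>
    proof -
      let ?\<phi> = "\<lambda>y. inverse (\<delta> ^ CARD('n)) * \<eta> ((- inverse \<delta>) *\<^sub>R y + inverse \<delta> *\<^sub>R x)"
      have sub: "cball x \<delta> \<subseteq> cball p (2 * r)"
      proof
        fix y assume "y \<in> cball x \<delta>"
        then show "y \<in> cball p (2 * r)"
          using x \<delta> dist_triangle[of p y x] by simp
      qed
      have t: "test_function \<Omega> ?\<phi>" "test_function (cball p (2 * r)) ?\<phi>"
        using sub r(2) by (intro mollifier_test_function \<eta> \<delta>; blast)+
      have supp: "?\<phi> y = 0" if "y \<notin> cball p (2 * r)" for y
        using t(2) that closure_subset[of "{x. ?\<phi> x \<noteq> 0}"] unfolding test_function_def by blast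
      have "mollify \<eta> \<delta> f x = (LINT y|lborel. f y * ?\<phi> y)"
        by (rule mollify_eq_convolution) (use \<delta> in auto)
      also have "\<dots> = (LINT y|lebesgue. f y * ?\<phi> y)"
        by (rule integral_completion[symmetric]) auto
      also have "\<dots> = (LINT y|lebesgue. ?g y * ?\<phi> y)"
      proof (rule integral_cong_AE)
        have "(\<lambda>y. f y * ?\<phi> y) \<in> borel_measurable lborel" by measurable
        then show "(\<lambda>y. f y * ?\<phi> y) \<in> borel_measurable lebesgue"
          by (rule measurable_completion)
        have "?\<phi> \<in> borel_measurable lborel" by measurable
        then show "(\<lambda>y. ?g y * ?\<phi> y) \<in> borel_measurable lebesgue"
          using g by (intro borel_measurable_times measurable_completion[of ?\<phi>]) auto
        show "AE y in lebesgue. f y * ?\<phi> y = ?g y * ?\<phi> y"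
          using f(2) by eventually_elim simp
      qed
      also have "\<dots> = (LINT y|lebesgue. indicator \<Omega> y *\<^sub>R (w y * ?\<phi> y))"
      proof (rule Bochner_Integration.integral_cong[OF refl])
        show "?g y * ?\<phi> y = indicator \<Omega> y *\<^sub>R (w y * ?\<phi> y)" for y
        proof (cases "y \<in> cball p (2 * r)")
          case True
          then have "y \<in> \<Omega>" using r by blast
          with True show ?thesis by simp
        next
          case False
          from supp[OF this] show ?thesis by simp
        qed
      qed
      also have "\<dots> = (LINT y|lebesgue_on \<Omega>. w y * ?\<phi> y)"
        using \<Omega> by (subst integral_restrict_space) auto
      also have "\<dots> = 0" by (rule zero[OF t(1)])
      finally show ?thesis .
    qed
    define \<delta> where "\<delta> = (\<lambda>j::nat. r / real (j + 2))"
    have \<delta>0: "\<delta> \<longlonglongrightarrow> 0" unfolding \<delta>_def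
      by (rule LIMSEQ_ignore_initial_segment[OF lim_const_over_n])
    have \<delta>: "\<delta> j > 0" "\<delta> j < r" for j
      using r(1) by (auto simp: \<delta>_def divide_less_eq)
    obtain s where s: "strict_mono s" "AE x in lborel. (\<lambda>j. mollify \<eta> (\<delta> (s j)) f x) \<longlonglongrightarrow> f x"
      by (rule mollify_AE_tendsto[OF \<eta> f(1) \<delta>0 \<delta>(1)])
    have "AE x in lebesgue. x \<in> ball p r \<longrightarrow> w x = 0"
      using AE_completion[OF s(2)] f(2)
    proof eventually_elim
      case (elim x)
      show ?case
      proof
        assume x: "x \<in> ball p r"
        then have "(\<lambda>j. mollify \<eta> (\<delta> (s j)) f x) = (\<lambda>j. 0)"
          using zero' \<delta> by (intro ext) blast
        with elim(1) have "f x = 0" by (simp add: LIMSEQ_const_iff)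
        with elim(2) x r show "w x = 0" by auto
      qed
    qed
    then show ?thesis using r by blast
  qed
  define R where "R p = (SOME r. r > 0 \<and> (AE x in lebesgue. x \<in> ball p r \<longrightarrow> w x = 0))" for p
  have R: "R p > 0" "AE x in lebesgue. x \<in> ball p (R p) \<longrightarrow> w x = 0" if "p \<in> \<Omega>" for p
    using someI_ex[OF local[OF that]] by (auto simp: R_def)
  obtain F where F: "F \<subseteq> (\<lambda>p. ball p (R p)) ` \<Omega>" "countable F" "\<Union>F = (\<Union>p\<in>\<Omega>. ball p (R p))"
    using Lindelof[of "(\<lambda>p. ball p (R p)) ` \<Omega>"] by auto
  have "AE x in lebesgue. \<forall>B\<in>F. x \<in> B \<longrightarrow> w x = 0"
    using F(1) R(2) by (subst AE_ball_countable[OF F(2)]) blast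
  then show ?thesis
  proof eventually_elim
    case (elim x)
    show ?case
    proof
      assume "x \<in> \<Omega>"
      then have "x \<in> (\<Union>p\<in>\<Omega>. ball p (R p))" using R(1)[of x] by (intro UN_I[of x]) auto
      then show "w x = 0" using elim F(3) by blast
    qed
  qed
qed

lemma has_weak_partial_unique:
  fixes u :: "real ^ 'n \<Rightarrow> real"
  assumes \<Omega>: "open \<Omega>" and v: "has_weak_partial \<Omega> I u v" and v': "has_weak_partial \<Omega> I u v'"
  shows "AE x in lebesgue. x \<in> \<Omega> \<longrightarrow> v x = v' x"
proof -
  have li: "locally_integrable_on v \<Omega>" "locally_integrable_on v' \<Omega>"
    using v v' by (auto simp: has_weak_partial_def)
  have int: "integrable (lebesgue_on \<Omega>) (\<lambda>x. h x * \<phi> x)"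
    if h: "locally_integrable_on h \<Omega>" and \<phi>: "test_function \<Omega> \<phi>" for h \<phi>
    using \<phi>
  proof (rule test_functionE)
    fix K assume K: "smooth \<phi>" "compact K" "\<And>x. x \<notin> K \<Longrightarrow> \<phi> x = 0" "K \<subseteq> \<Omega>"
    obtain D where D: "D > 0" "\<And>x. \<bar>\<phi> x\<bar> \<le> D"
      using continuous_compact_support_bounded[OF smooth_continuous[OF K(1)] K(2,3)] by blast
    have ih: "integrable lebesgue (\<lambda>x. indicator K x *\<^sub>R h x)"
      using h K unfolding locally_integrable_on_def set_integrable_def by auto
    have "integrable lebesgue (\<lambda>x. (indicator K x *\<^sub>R h x) * \<phi> x)"
    proof (rule Bochner_Integration.integrable_bound)
      show "integrable lebesgue (\<lambda>x. D * (indicator K x *\<^sub>R h x))"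
        using ih by simp
      show "(\<lambda>x. indicator K x *\<^sub>R h x * \<phi> x) \<in> borel_measurable lebesgue"
        using ih smooth_borel[OF K(1)] by (intro borel_measurable_times) (auto intro: measurable_completion)
      show "AE x in lebesgue. norm (indicator K x *\<^sub>R h x * \<phi> x) \<le> norm (D * (indicator K x *\<^sub>R h x))"
        using D by (auto intro!: AE_I2 mult_left_mono simp: abs_mult mult.commute[of D])
    qed
    also have "(\<lambda>x. (indicator K x *\<^sub>R h x) * \<phi> x) = (\<lambda>x. indicator \<Omega> x *\<^sub>R (h x * \<phi> x))"
      using K(3,4) by (auto simp: fun_eq_iff indicator_def)
    finally show ?thesis using \<Omega> by (subst integrable_restrict_space) auto
  qed
  have "AE x in lebesgue. x \<in> \<Omega> \<longrightarrow> v x - v' x = 0"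
  proof (rule fundamental_lemma_test_functions[OF \<Omega>])
    show "locally_integrable_on (\<lambda>x. v x - v' x) \<Omega>"
      using li unfolding locally_integrable_on_def by (auto intro: set_integral_diff)
    fix \<phi> assume \<phi>: "test_function \<Omega> \<phi>"
    have "(LINT x|lebesgue_on \<Omega>. v x * \<phi> x) = (LINT x|lebesgue_on \<Omega>. v' x * \<phi> x)"
    proof -
      have "(-1) ^ length I * (LINT x|lebesgue_on \<Omega>. v x * \<phi> x) =
          (-1) ^ length I * (LINT x|lebesgue_on \<Omega>. v' x * \<phi> x)"
        using v v' \<phi> unfolding has_weak_partial_def by force
      then show ?thesis by simp
    qed
    then show "(LINT x|lebesgue_on \<Omega>. (v x - v' x) * \<phi> x) = 0"
      using int[OF li(1) \<phi>] int[OF li(2) \<phi>] by (simp add: left_diff_distrib)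
  qed
  then show ?thesis by simp
qed

section \<open>Taylor bounds along segments and cones\<close>

text \<open>Away from the boundary, the gradient of a mollification is the mollification of the weak
  gradient. This is stated as a formula for increments: the increment of the kernel is
  written as an integral along the segment, and then the weak derivative is used at every
  point of the segment.\<close>

lemma mollify_increment:
  fixes f :: "real ^ 'n \<Rightarrow> real" and g :: "'n \<Rightarrow> real ^ 'n \<Rightarrow> real"
  assumes \<eta>: "mollifier \<eta>" and f: "integrable lborel f" and g: "\<And>i. integrable lborel (g i)" and \<delta>: "\<delta> > 0"
    and weak: "\<And>i \<phi>. test_function \<Omega> \<phi> \<Longrightarrow>
      (LINT y|lborel. f y * partial_deriv i \<phi> y) = - (LINT y|lborel. g i y * \<phi> y)"
    and seg: "\<And>s. 0 \<le> s \<Longrightarrow> s \<le> 1 \<Longrightarrow> cball (x + s *\<^sub>R w) \<delta> \<subseteq> \<Omega>"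
  shows "mollify \<eta> \<delta> f (x + w) - mollify \<eta> \<delta> f x =
    (LINT s|lborel. indicator {0..1} s * (\<Sum>i\<in>UNIV. w $ i * mollify \<eta> \<delta> (g i) (x + s *\<^sub>R w)))"
proof -
  have sm: "smooth \<eta>" using \<eta> by (simp add: mollifier_def)
  have [measurable]: "f \<in> borel_measurable borel" "\<eta> \<in> borel_measurable borel"
    "\<And>i. g i \<in> borel_measurable borel"
    using f g mollifier_borel[OF \<eta>] by auto
  let ?a = "inverse (\<delta> ^ CARD('n))" and ?c = "inverse \<delta>"
  let ?\<kappa> = "\<lambda>z y. ?a * \<eta> ((- ?c) *\<^sub>R y + ?c *\<^sub>R z)"
  let ?d = "\<lambda>i z y. ?a * ?c * partial_deriv i \<eta> ((- ?c) *\<^sub>R y + ?c *\<^sub>R z)"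
  have dcont: "continuous_on UNIV (partial_deriv i \<eta>)" for i
    by (rule smooth_C1[OF sm])
  \<comment> \<open>The derivatives of the kernel in the centre \<open>z\<close> and in the variable of integration \<open>y\<close>
    differ by their sign. The first one occurs in increments, the second one in the
    definition of weak derivatives.\<close>
  have dz: "partial_deriv i (\<lambda>z. ?\<kappa> z y) z = ?d i z y" for i z y
    using fun_cong[OF partial_derivs_affine[OF sm, where I = "[i]" and a = ?a and c = ?c and z = "(- ?c) *\<^sub>R y"], of z]
    by (simp add: add.commute)
  have dy: "partial_deriv i (?\<kappa> z) y = - ?d i z y" for i z y
    using fun_cong[OF partial_derivs_affine[OF sm, where I = "[i]" and a = ?a and c = "- ?c" and z = "?c *\<^sub>R z"], of y]
    by simp
  have smz: "smooth (\<lambda>z. ?\<kappa> z y)" for y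
    using smooth_affine[OF sm, of ?a ?c "(- ?c) *\<^sub>R y"] by (simp add: add.commute)
  have \<kappa>b: "\<exists>D. \<forall>y. \<bar>?\<kappa> z y\<bar> \<le> D" for z
  proof -
    obtain D where "\<And>x. \<bar>\<eta> x\<bar> \<le> D" using mollifier_bounded[OF \<eta>] by blast
    then show ?thesis using \<delta> by (intro exI[of _ "?a * D"]) (auto simp: abs_mult intro!: mult_left_mono)
  qed
  have int\<kappa>: "integrable lborel (\<lambda>y. f y * ?\<kappa> z y)" for z
  proof -
    obtain D where D: "\<And>y. \<bar>?\<kappa> z y\<bar> \<le> D" using \<kappa>b by blast
    show ?thesis
    proof (rule Bochner_Integration.integrable_bound[where f = "\<lambda>y. D * f y"])
      show "AE y in lborel. norm (f y * ?\<kappa> z y) \<le> norm (D * f y)"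
      proof (rule AE_I2)
        fix y
        have "\<bar>f y\<bar> * \<bar>?\<kappa> z y\<bar> \<le> \<bar>f y\<bar> * \<bar>D\<bar>"
          using order_trans[OF D[of y] abs_ge_self] by (intro mult_left_mono) auto
        then show "norm (f y * ?\<kappa> z y) \<le> norm (D * f y)"
          by (simp only: real_norm_def abs_mult) (simp add: mult.commute)
      qed
    qed (use f in auto)
  qed
  have d0: "partial_deriv i \<eta> x = 0" if "x \<notin> cball 0 1" for i x
    using partial_derivs_eq_0[of "cball 0 1" \<eta> x "[i]"] \<eta> that by (auto simp: mollifier_def)
  have "\<exists>D. \<forall>x. \<bar>partial_deriv i \<eta> x\<bar> \<le> D" for i
    using continuous_compact_support_bounded[OF dcont compact_cball[of 0 1] d0] by metis
  then obtain D where D: "\<And>i x. \<bar>partial_deriv i \<eta> x\<bar> \<le> D i" by metis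
  let ?k = "\<lambda>(s, y). \<Sum>i\<in>UNIV. w $ i * ?d i (x + s *\<^sub>R w) y"
  have kb: "\<bar>?k p\<bar> \<le> (\<Sum>i\<in>UNIV. \<bar>w $ i\<bar> * (?a * ?c * D i))" for p
    using \<delta> by (cases p) (auto simp: abs_mult intro!: order_trans[OF sum_abs] sum_mono mult_left_mono D)
  have km: "?k \<in> borel_measurable borel"
    by (intro borel_measurable_continuous_onI)
       (auto simp: split_beta intro!: continuous_intros continuous_on_compose2[OF dcont])
  have intd: "integrable lborel (\<lambda>y. f y * ?d i z y)" for i z
  proof (rule Bochner_Integration.integrable_bound[where f = "\<lambda>y. (?a * ?c * D i) * f y"])
    show "(\<lambda>y. f y * ?d i z y) \<in> borel_measurable lborel"
    proof -
      have "(\<lambda>y. ?d i z y) \<in> borel_measurable borel"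
        by (intro borel_measurable_continuous_onI continuous_intros continuous_on_compose2[OF dcont]) auto
      then show ?thesis by simp
    qed
    show "AE y in lborel. norm (f y * ?d i z y) \<le> norm ((?a * ?c * D i) * f y)"
    proof (rule AE_I2)
      fix y
      have "\<bar>?d i z y\<bar> \<le> ?a * ?c * D i"
        using \<delta> by (auto simp: abs_mult intro!: mult_left_mono D)
      then have "\<bar>f y\<bar> * \<bar>?d i z y\<bar> \<le> \<bar>f y\<bar> * \<bar>?a * ?c * D i\<bar>"
        by (intro mult_left_mono) auto
      then show "norm (f y * ?d i z y) \<le> norm ((?a * ?c * D i) * f y)"
        by (simp only: real_norm_def abs_mult) (simp add: mult.commute)
    qed
  qed (use f in auto)
  have conv: "mollify \<eta> \<delta> h z = (LINT y|lborel. h y * ?\<kappa> z y)" if "h \<in> borel_measurable borel" for h z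
    by (rule mollify_eq_convolution) (use that \<delta> in auto)
  have "mollify \<eta> \<delta> f (x + w) - mollify \<eta> \<delta> f x =
      (LINT y|lborel. f y * ?\<kappa> (x + w) y) - (LINT y|lborel. f y * ?\<kappa> x y)"
    by (simp only: conv[OF \<open>f \<in> borel_measurable borel\<close>])
  also have "\<dots> = (LINT y|lborel. f y * ?\<kappa> (x + w) y - f y * ?\<kappa> x y)"
    by (rule Bochner_Integration.integral_diff[OF int\<kappa> int\<kappa>, symmetric])
  also have "\<dots> = (LINT y|lborel. f y * (LINT s|lborel. indicator {0..1} s * ?k (s, y)))"
  proof (rule Bochner_Integration.integral_cong[OF refl])
    fix y
    have "?\<kappa> (x + w) y - ?\<kappa> x y =
        (LINT s|lborel. indicator {0..1} s * (\<Sum>i\<in>UNIV. w $ i * partial_deriv i (\<lambda>z. ?\<kappa> z y) (x + s *\<^sub>R w)))"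
      by (rule C1_increment[OF smooth_C1[OF smz]])
    also have "\<dots> = (LINT s|lborel. indicator {0..1} s * ?k (s, y))"
      by (simp only: dz prod.case)
    finally show "f y * ?\<kappa> (x + w) y - f y * ?\<kappa> x y = f y * (LINT s|lborel. indicator {0..1} s * ?k (s, y))"
      by (simp only: right_diff_distrib[symmetric])
  qed
  also have "\<dots> = (LINT s|lborel. indicator {0..1} s * (LINT y|lborel. f y * ?k (s, y)))"
    by (rule integral_swap_bounded[OF f km kb])
  also have "\<dots> = (LINT s|lborel. indicator {0..1} s * (\<Sum>i\<in>UNIV. w $ i * mollify \<eta> \<delta> (g i) (x + s *\<^sub>R w)))"
  proof (rule Bochner_Integration.integral_cong[OF refl])
    fix s :: real
    show "indicator {0..1} s * (LINT y|lborel. f y * ?k (s, y)) =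
        indicator {0..1} s * (\<Sum>i\<in>UNIV. w $ i * mollify \<eta> \<delta> (g i) (x + s *\<^sub>R w))"
    proof (cases "s \<in> {0..1}")
      case True
      let ?z = "x + s *\<^sub>R w"
      have t: "test_function \<Omega> (?\<kappa> ?z)"
        using seg[of s] True by (intro mollifier_test_function \<eta> \<delta>) auto
      have "(LINT y|lborel. f y * ?k (s, y)) = (LINT y|lborel. (\<Sum>i\<in>UNIV. w $ i * (f y * ?d i ?z y)))"
        by (rule Bochner_Integration.integral_cong[OF refl])
           (simp only: prod.case sum_distrib_left mult.left_commute)
      also have "\<dots> = (\<Sum>i\<in>UNIV. w $ i * (LINT y|lborel. f y * ?d i ?z y))"
        by (subst Bochner_Integration.integral_sum[OF integrable_mult_right[OF intd]])
           (simp only: integral_mult_right_zero)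
      also have "\<dots> = (\<Sum>i\<in>UNIV. w $ i * mollify \<eta> \<delta> (g i) ?z)"
      proof (rule sum.cong[OF refl], rule arg_cong[where f = "\<lambda>t. _ * t"])
        fix i
        have "(LINT y|lborel. f y * ?d i ?z y) = - (LINT y|lborel. f y * partial_deriv i (?\<kappa> ?z) y)"
          by (simp only: dy mult_minus_right Bochner_Integration.integral_minus minus_minus)
        also have "\<dots> = (LINT y|lborel. g i y * ?\<kappa> ?z y)"
          by (simp only: weak[OF t] minus_minus)
        also have "\<dots> = mollify \<eta> \<delta> (g i) ?z"
          by (simp only: conv[OF \<open>g i \<in> borel_measurable borel\<close>])
        finally show "(LINT y|lborel. f y * ?d i ?z y) = mollify \<eta> \<delta> (g i) ?z" .
      qed
      finally show ?thesis by simp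
    qed simp
  qed
  finally show ?thesis .
qed

text \<open>Here \<open>G k s\<close> stands for the size of the derivatives of order \<open>k\<close> at the point with
  parameter \<open>s\<close> of a segment. Inserting the bound for \<open>G j\<close> into the remainder of order \<open>j\<close>
  and exchanging the integrals raises the power of \<open>s\<close> by one. The result is a Taylor
  formula with boundary terms at the far endpoint \<open>1\<close> and the remainder kernel centred at
  the near endpoint \<open>0\<close>, up to the factorials, which are estimated by one.\<close>

lemma iterated_segment_bound:
  fixes G :: "nat \<Rightarrow> real \<Rightarrow> ennreal" and c :: ennreal
  assumes [measurable]: "\<And>k. G k \<in> borel_measurable borel"
    and step: "\<And>k s. k < m \<Longrightarrow> 0 \<le> s \<Longrightarrow> s \<le> 1 \<Longrightarrow>
      G k s \<le> G k 1 + c * (\<integral>\<^sup>+ t. indicator {s..1} t * G (Suc k) t \<partial>lborel)"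
    and j: "1 \<le> j" "j \<le> m"
  shows "G 0 0 \<le> (\<Sum>k<j. c ^ k * G k 1) +
    c ^ j * (\<integral>\<^sup>+ s. indicator {0..1} s * ennreal (s ^ (j - 1)) * G j s \<partial>lborel)"
  using j
proof (induction j rule: nat_induct_at_least)
  case base
  then show ?case using step[of 0 0] by simp
next
  case (Suc j)
  let ?I = "\<lambda>j. \<integral>\<^sup>+ s. indicator {0..1} s * ennreal (s ^ (j - 1)) * G j s \<partial>lborel"
  have [measurable]: "(\<lambda>(s, t). indicator {0..1} s * ennreal (s ^ (j - 1)) * (indicator {s..1} t * G (Suc j) t)) \<in> borel_measurable (borel \<Otimes>\<^sub>M borel)"
  proof -
    have "(\<lambda>(s, t). indicator {s..1::real} t :: ennreal) = (\<lambda>(s, t). if s \<le> t \<and> t \<le> 1 then 1 else 0)"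
      by (auto simp: indicator_def fun_eq_iff)
    moreover have "(\<lambda>(s :: real, t). if s \<le> t \<and> t \<le> 1 then 1 else 0 :: ennreal) \<in> borel_measurable (borel \<Otimes>\<^sub>M borel)"
      by measurable
    ultimately have [measurable]: "(\<lambda>(s, t). indicator {s..1::real} t :: ennreal) \<in> borel_measurable (borel \<Otimes>\<^sub>M borel)" by simp
    have "(\<lambda>p. (\<lambda>(s, t). indicator {s..1::real} t :: ennreal) p * G (Suc j) (snd p) * (indicator {0..1} (fst p) * ennreal (fst p ^ (j - 1)))) \<in> borel_measurable (borel \<Otimes>\<^sub>M borel)"
      by measurable
    then show ?thesis by (simp add: split_beta mult_ac)
  qed
  have "?I j \<le> (\<integral>\<^sup>+ s. indicator {0..1} s * G j 1 + c * (\<integral>\<^sup>+ t. indicator {0..1} s * ennreal (s ^ (j - 1)) * (indicator {s..1} t * G (Suc j) t) \<partial>lborel) \<partial>lborel)"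
  proof (rule nn_integral_mono)
    fix s :: real
    show "indicator {0..1} s * ennreal (s ^ (j - 1)) * G j s \<le>
        indicator {0..1} s * G j 1 + c * (\<integral>\<^sup>+ t. indicator {0..1} s * ennreal (s ^ (j - 1)) * (indicator {s..1} t * G (Suc j) t) \<partial>lborel)"
    proof (cases "s \<in> {0..1}")
      case True
      then have s1: "ennreal (s ^ (j - 1)) \<le> 1"
        by (simp add: power_le_one flip: ennreal_1)
      have "ennreal (s ^ (j - 1)) * G j s \<le> ennreal (s ^ (j - 1)) * (G j 1 + c * (\<integral>\<^sup>+ t. indicator {s..1} t * G (Suc j) t \<partial>lborel))"
        using step[of j s] True Suc by (intro mult_left_mono) auto
      also have "\<dots> \<le> G j 1 + c * (ennreal (s ^ (j - 1)) * (\<integral>\<^sup>+ t. indicator {s..1} t * G (Suc j) t \<partial>lborel))"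
        using mult_right_mono[OF s1, of "G j 1"] by (simp add: distrib_left mult.left_commute add_right_mono)
      also have "\<dots> = G j 1 + c * (\<integral>\<^sup>+ t. ennreal (s ^ (j - 1)) * (indicator {s..1} t * G (Suc j) t) \<partial>lborel)"
        by (subst nn_integral_cmult) auto
      finally show ?thesis using True by simp
    qed simp
  qed
  also have "\<dots> = G j 1 + c * (\<integral>\<^sup>+ s. \<integral>\<^sup>+ t. indicator {0..1} s * ennreal (s ^ (j - 1)) * (indicator {s..1} t * G (Suc j) t) \<partial>lborel \<partial>lborel)"
    (is "_ = _ + c * ?D")
  proof -
    have "(\<lambda>s. \<integral>\<^sup>+ t. indicator {0..1} s * ennreal (s ^ (j - 1)) * (indicator {s..1} t * G (Suc j) t) \<partial>lborel) \<in> borel_measurable lborel"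
      by (rule lborel.borel_measurable_nn_integral) measurable
    then show ?thesis
      by (subst nn_integral_add) (auto simp: nn_integral_multc nn_integral_cmult)
  qed
  also have "?D = (\<integral>\<^sup>+ t. \<integral>\<^sup>+ s. indicator {0..1} s * ennreal (s ^ (j - 1)) * (indicator {s..1} t * G (Suc j) t) \<partial>lborel \<partial>lborel)"
    by (rule lborel_pair.Fubini'[symmetric]) measurable
  also have "\<dots> \<le> ?I (Suc j)"
  proof (rule nn_integral_mono)
    fix t :: real
    have "(\<integral>\<^sup>+ s. indicator {0..1} s * ennreal (s ^ (j - 1)) * (indicator {s..1} t * G (Suc j) t) \<partial>lborel)
        \<le> (\<integral>\<^sup>+ s. indicator {0..t} s * (indicator {0..1} t * ennreal (t ^ (j - 1)) * G (Suc j) t) \<partial>lborel)"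
      by (intro nn_integral_mono) (auto simp: indicator_def intro!: mult_right_mono ennreal_leI power_mono)
    also have "\<dots> = ennreal t * (indicator {0..1} t * ennreal (t ^ (j - 1)) * G (Suc j) t)"
      by (cases "t \<ge> 0") (auto simp: nn_integral_multc)
    also have "\<dots> = indicator {0..1} t * ennreal (t ^ (Suc j - 1)) * G (Suc j) t"
      using Suc by (cases j) (auto simp: indicator_def ennreal_mult' mult_ac)
    finally show "(\<integral>\<^sup>+ s. indicator {0..1} s * ennreal (s ^ (j - 1)) * (indicator {s..1} t * G (Suc j) t) \<partial>lborel) \<le> indicator {0..1} t * ennreal (t ^ (Suc j - 1)) * G (Suc j) t" .
  qed
  finally have I: "?I j \<le> G j 1 + c * ?I (Suc j)"
    by (simp add: add_left_mono mult_left_mono)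
  have "G 0 0 \<le> (\<Sum>k<j. c ^ k * G k 1) + c ^ j * ?I j"
    using Suc by simp
  also have "\<dots> \<le> (\<Sum>k<j. c ^ k * G k 1) + c ^ j * (G j 1 + c * ?I (Suc j))"
    by (intro add_left_mono mult_left_mono I) auto
  also have "\<dots> = (\<Sum>k<Suc j. c ^ k * G k 1) + c ^ Suc j * ?I (Suc j)"
    by (simp add: distrib_left add.assoc mult_ac)
  finally show ?case .
qed

text \<open>The substitution \<open>y = x + s w\<close> shows that, for bounded \<open>W\<close> and \<open>1 \<le> m < n\<close>, with \<open>n\<close> the
  dimension, this is at most a multiple of the Riesz potential of order \<open>m\<close>, the integral of
  \<open>\<bar>x - y\<bar>\<^sup>m\<^sup>-\<^sup>n F(y)\<close>. It is the form in which the potential arises when the remainder of a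
  Taylor formula is integrated over segments from \<open>x\<close> with directions in \<open>W\<close>.\<close>

definition cone_potential :: "(real ^ 'n) set \<Rightarrow> nat \<Rightarrow> (real ^ 'n \<Rightarrow> ennreal) \<Rightarrow> real ^ 'n \<Rightarrow> ennreal" where
  "cone_potential W m F x =
     (\<integral>\<^sup>+ w. \<integral>\<^sup>+ s. indicator W w * (indicator {0..1} s * ennreal (s ^ (m - 1)) * F (x + s *\<^sub>R w)) \<partial>lborel \<partial>lborel)"

lemma borel_measurable_cone_potential [measurable]:
  assumes [measurable]: "F \<in> borel_measurable borel" "W \<in> sets borel"
  shows "cone_potential W m F \<in> borel_measurable borel"
  unfolding cone_potential_def by measurable

text \<open>For fixed \<open>s\<close> and \<open>w\<close>, the integrand is a translate of \<open>F\<close> with a weight of at most one.\<close>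

lemma nn_integral_cone_potential_le:
  fixes F :: "real ^ 'n \<Rightarrow> ennreal" and W :: "(real ^ 'n) set"
  assumes [measurable]: "F \<in> borel_measurable borel" "W \<in> sets borel"
  shows "(\<integral>\<^sup>+ x. cone_potential W m F x \<partial>lborel) \<le> emeasure lborel W * (\<integral>\<^sup>+ x. F x \<partial>lborel)"
proof -
  have "(\<integral>\<^sup>+ x. cone_potential W m F x \<partial>lborel) =
     (\<integral>\<^sup>+ w. \<integral>\<^sup>+ x. \<integral>\<^sup>+ s. indicator W w * (indicator {0..1} s * ennreal (s ^ (m - 1)) * F (x + s *\<^sub>R w)) \<partial>lborel \<partial>lborel \<partial>lborel)"
    unfolding cone_potential_def by (rule lborel_pair.Fubini') measurable
  also have "\<dots> = (\<integral>\<^sup>+ w. \<integral>\<^sup>+ s. \<integral>\<^sup>+ x. indicator W w * (indicator {0..1} s * ennreal (s ^ (m - 1)) * F (x + s *\<^sub>R w)) \<partial>lborel \<partial>lborel \<partial>lborel)"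
    by (intro nn_integral_cong lborel_pair.Fubini') measurable
  also have "\<dots> = (\<integral>\<^sup>+ w. \<integral>\<^sup>+ s. indicator W w * (indicator {0..1} s * ennreal (s ^ (m - 1))) * (\<integral>\<^sup>+ x. F x \<partial>lborel) \<partial>lborel \<partial>lborel)"
  proof (intro nn_integral_cong)
    fix w :: "real ^ 'n" and s :: real
    have "(\<integral>\<^sup>+ x. indicator W w * (indicator {0..1} s * ennreal (s ^ (m - 1)) * F (x + s *\<^sub>R w)) \<partial>lborel)
      = indicator W w * (indicator {0..1} s * ennreal (s ^ (m - 1))) * (\<integral>\<^sup>+ x. F (x + s *\<^sub>R w) \<partial>lborel)"
      by (subst nn_integral_cmult[symmetric]) (auto simp: mult.assoc)
    then show "(\<integral>\<^sup>+ x. indicator W w * (indicator {0..1} s * ennreal (s ^ (m - 1)) * F (x + s *\<^sub>R w)) \<partial>lborel)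
      = indicator W w * (indicator {0..1} s * ennreal (s ^ (m - 1))) * (\<integral>\<^sup>+ x. F x \<partial>lborel)"
      by (simp add: nn_integral_translate)
  qed
  also have "\<dots> \<le> (\<integral>\<^sup>+ w. \<integral>\<^sup>+ s. indicator W w * indicator {0..1::real} s * (\<integral>\<^sup>+ x. F x \<partial>lborel) \<partial>lborel \<partial>lborel)"
    by (intro nn_integral_mono mult_right_mono)
       (auto simp: indicator_def power_le_one ennreal_le_1)
  also have "\<dots> = emeasure lborel W * (\<integral>\<^sup>+ x. F x \<partial>lborel)"
    by (simp add: nn_integral_multc nn_integral_cmult)
  finally show ?thesis .
qed

lemma mollify_L1_le:
  fixes f :: "real ^ 'n \<Rightarrow> real"
  assumes \<eta>: "mollifier \<eta>" and [measurable]: "f \<in> borel_measurable borel"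
  shows "(\<integral>\<^sup>+ x. ennreal \<bar>mollify \<eta> \<delta> f x\<bar> \<partial>lborel) \<le> (\<integral>\<^sup>+ x. ennreal \<bar>f x\<bar> \<partial>lborel)"
    and mollify_abs_le: "ennreal \<bar>mollify \<eta> \<delta> f x\<bar> \<le> (\<integral>\<^sup>+ z. ennreal \<bar>f (x - \<delta> *\<^sub>R z)\<bar> * ennreal (\<eta> z) \<partial>lborel)"
proof -
  have [measurable]: "\<eta> \<in> borel_measurable borel" by (rule mollifier_borel[OF \<eta>])
  have \<eta>0: "\<eta> z \<ge> 0" for z using \<eta> by (simp add: mollifier_def)
  show *: "ennreal \<bar>mollify \<eta> \<delta> f x\<bar> \<le> (\<integral>\<^sup>+ z. ennreal \<bar>f (x - \<delta> *\<^sub>R z)\<bar> * ennreal (\<eta> z) \<partial>lborel)" for x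
  proof (cases "integrable lborel (\<lambda>z. f (x - \<delta> *\<^sub>R z) * \<eta> z)")
    case True
    from integral_norm_bound_ennreal[OF this] show ?thesis
      by (simp add: mollify_def abs_mult ennreal_mult \<eta>0)
  qed (simp add: mollify_def not_integrable_integral_eq)
  have "(\<integral>\<^sup>+ x. ennreal \<bar>mollify \<eta> \<delta> f x\<bar> \<partial>lborel) \<le>
      (\<integral>\<^sup>+ x. \<integral>\<^sup>+ z. ennreal \<bar>f (x - \<delta> *\<^sub>R z)\<bar> * ennreal (\<eta> z) \<partial>lborel \<partial>lborel)"
    by (intro nn_integral_mono *)
  also have "\<dots> = (\<integral>\<^sup>+ z. \<integral>\<^sup>+ x. ennreal \<bar>f (x - \<delta> *\<^sub>R z)\<bar> * ennreal (\<eta> z) \<partial>lborel \<partial>lborel)"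
    by (rule lborel_pair.Fubini') measurable
  also have "\<dots> = (\<integral>\<^sup>+ z. (\<integral>\<^sup>+ x. ennreal \<bar>f x\<bar> \<partial>lborel) * ennreal (\<eta> z) \<partial>lborel)"
  proof (intro nn_integral_cong)
    fix z :: "real ^ 'n"
    have "(\<integral>\<^sup>+ x. ennreal \<bar>f (x + (- (\<delta> *\<^sub>R z)))\<bar> \<partial>lborel) = (\<integral>\<^sup>+ x. ennreal \<bar>f x\<bar> \<partial>lborel)"
      by (rule nn_integral_translate[where f = "\<lambda>x. ennreal \<bar>f x\<bar>"]) simp
    then show "(\<integral>\<^sup>+ x. ennreal \<bar>f (x - \<delta> *\<^sub>R z)\<bar> * ennreal (\<eta> z) \<partial>lborel) = (\<integral>\<^sup>+ x. ennreal \<bar>f x\<bar> \<partial>lborel) * ennreal (\<eta> z)"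
      by (simp add: nn_integral_multc)
  qed
  also have "\<dots> = (\<integral>\<^sup>+ x. ennreal \<bar>f x\<bar> \<partial>lborel) * (\<integral>\<^sup>+ z. ennreal (\<eta> z) \<partial>lborel)"
    by (rule nn_integral_cmult) simp
  also have "(\<integral>\<^sup>+ z. ennreal (\<eta> z) \<partial>lborel) = 1"
    using mollifier_integrable[OF \<eta>] \<eta>0 \<eta> by (subst nn_integral_eq_integral) (auto simp: mollifier_def)
  finally show "(\<integral>\<^sup>+ x. ennreal \<bar>mollify \<eta> \<delta> f x\<bar> \<partial>lborel) \<le> (\<integral>\<^sup>+ x. ennreal \<bar>f x\<bar> \<partial>lborel)" by simp
qed

lemma sum_lists_snoc:
  fixes g :: "('n :: finite) list \<Rightarrow> 'a :: comm_monoid_add"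
  shows "(\<Sum>I | length I = k. \<Sum>i\<in>UNIV. g (I @ [i])) = (\<Sum>I | length I = Suc k. g I)"
proof -
  have fin: "finite {I :: 'n list. length I = k}"
    using finite_lists_length_eq[of "UNIV :: 'n set" k] by simp
  have "bij_betw (\<lambda>(I, i). I @ [i]) ({I :: 'n list. length I = k} \<times> UNIV) {I. length I = Suc k}"
  proof (rule bij_betwI')
    fix J :: "'n list" assume "J \<in> {I. length I = Suc k}"
    then have "J \<noteq> []" "length (butlast J) = k" by auto
    then show "\<exists>p\<in>{I. length I = k} \<times> UNIV. J = (case p of (I, i) \<Rightarrow> I @ [i])"
      by (intro bexI[of _ "(butlast J, last J)"]) simp_all
  qed auto
  from sum.reindex_bij_betw[OF this, of g]
  have "(\<Sum>I | length I = Suc k. g I) = (\<Sum>(I, i)\<in>{I. length I = k} \<times> UNIV. g (I @ [i]))"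
    by (simp add: split_beta)
  also have "\<dots> = (\<Sum>I | length I = k. \<Sum>i\<in>UNIV. g (I @ [i]))"
    using fin by (simp add: sum.cartesian_product)
  finally show ?thesis by simp
qed

lemma finite_lists_of_length [simp]: "finite {I :: 'n :: finite list. length I = k}"
  using finite_lists_length_eq[of "UNIV :: 'n set" k] by simp

text \<open>The increment formula is applied on the part of the segment from parameter \<open>s\<close> to
  parameter \<open>1\<close>, to all derivatives of order \<open>k\<close> at once.\<close>

lemma mollified_segment_bound:
  fixes f :: "'n list \<Rightarrow> real ^ 'n \<Rightarrow> real"
  assumes \<eta>: "mollifier \<eta>" and \<delta>: "\<delta> > 0"
    and f: "\<And>I. integrable lborel (f I)"
    and weak: "\<And>I i \<phi>. length I < m \<Longrightarrow> test_function \<Omega> \<phi> \<Longrightarrow>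
      (LINT y|lborel. f I y * partial_deriv i \<phi> y) = - (LINT y|lborel. f (I @ [i]) y * \<phi> y)"
    and seg: "\<And>s. 0 \<le> s \<Longrightarrow> s \<le> 1 \<Longrightarrow> cball (x + s *\<^sub>R w) \<delta> \<subseteq> \<Omega>"
    and c: "\<And>i. \<bar>w $ i\<bar> \<le> c" and k: "k < m" and s: "0 \<le> s" "s \<le> 1"
  defines "G \<equiv> \<lambda>k s. \<Sum>I | length I = k. ennreal \<bar>mollify \<eta> \<delta> (f I) (x + s *\<^sub>R w)\<bar>"
  shows "G k s \<le> G k 1 + ennreal c * (\<integral>\<^sup>+ t. indicator {s..1} t * G (Suc k) t \<partial>lborel)"
proof -
  have [measurable]: "f I \<in> borel_measurable borel" for I using f[of I] by auto
  have [measurable]: "\<eta> \<in> borel_measurable borel" by (rule mollifier_borel[OF \<eta>])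
  have [measurable]: "mollify \<eta> \<delta> (f I) \<in> borel_measurable borel" for I
    unfolding mollify_def by measurable
  let ?v = "\<lambda>I. mollify \<eta> \<delta> (f I)"
  let ?w = "(1 - s) *\<^sub>R w" and ?x = "x + s *\<^sub>R w"
  have c0: "c \<ge> 0" using c[of undefined] by linarith
  have one: "ennreal \<bar>?v I ?x\<bar> \<le> ennreal \<bar>?v I (x + w)\<bar> +
      ennreal c * (\<integral>\<^sup>+ t. indicator {s..1} t * (\<Sum>i\<in>UNIV. ennreal \<bar>?v (I @ [i]) (x + t *\<^sub>R w)\<bar>) \<partial>lborel)"
    if I: "length I = k" for I
  proof -
    let ?h = "\<lambda>r. indicator {0..1} r * (\<Sum>i\<in>UNIV. ?w $ i * ?v (I @ [i]) (?x + r *\<^sub>R ?w))"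
    have eqx: "?x + r *\<^sub>R ?w = x + (s + (1 - s) * r) *\<^sub>R w" for r
      by (simp add: algebra_simps)
    have sr: "0 \<le> s + (1 - s) * r" "s + (1 - s) * r \<le> 1" if "0 \<le> r" "r \<le> 1" for r
    proof -
      show "0 \<le> s + (1 - s) * r" using s that by (intro add_nonneg_nonneg mult_nonneg_nonneg) auto
      have "(1 - s) * r \<le> (1 - s) * 1" using s that by (intro mult_left_mono) auto
      then show "s + (1 - s) * r \<le> 1" by simp
    qed
    have "?v I (?x + ?w) - ?v I ?x = (LINT r|lborel. ?h r)"
    proof (rule mollify_increment[OF \<eta> f f \<delta>])
      show "cball (?x + r *\<^sub>R ?w) \<delta> \<subseteq> \<Omega>" if "0 \<le> r" "r \<le> 1" for r
        unfolding eqx by (rule seg) (use sr[OF that] in auto)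
    qed (use weak I k in auto)
    moreover have "?x + ?w = x + w" by (simp add: algebra_simps)
    ultimately have "\<bar>?v I ?x\<bar> \<le> \<bar>?v I (x + w)\<bar> + \<bar>LINT r|lborel. ?h r\<bar>" by simp
    then have split: "ennreal \<bar>?v I ?x\<bar> \<le> ennreal \<bar>?v I (x + w)\<bar> + ennreal \<bar>LINT r|lborel. ?h r\<bar>"
      by (simp flip: ennreal_plus)
    have "ennreal \<bar>LINT r|lborel. ?h r\<bar> \<le> (\<integral>\<^sup>+ r. ennreal \<bar>?h r\<bar> \<partial>lborel)"
    proof (cases "integrable lborel ?h")
      case True
      from integral_norm_bound_ennreal[OF this] show ?thesis by simp
    qed (simp add: not_integrable_integral_eq)
    also have "\<dots> \<le> (\<integral>\<^sup>+ r. ennreal (c * (1 - s)) * (indicator {0..1} r *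
        (\<Sum>i\<in>UNIV. ennreal \<bar>?v (I @ [i]) (x + (s + (1 - s) * r) *\<^sub>R w)\<bar>)) \<partial>lborel)"
    proof (intro nn_integral_mono)
      fix r :: real
      have "\<bar>\<Sum>i\<in>UNIV. ?w $ i * ?v (I @ [i]) (?x + r *\<^sub>R ?w)\<bar>
          \<le> (\<Sum>i\<in>UNIV. (c * (1 - s)) * \<bar>?v (I @ [i]) (x + (s + (1 - s) * r) *\<^sub>R w)\<bar>)"
        unfolding eqx using s c
        by (intro order_trans[OF sum_abs] sum_mono)
           (auto simp: abs_mult mult.commute[of _ "1 - s"] mult.assoc intro!: mult_left_mono mult_right_mono)
      then have "ennreal \<bar>\<Sum>i\<in>UNIV. ?w $ i * ?v (I @ [i]) (?x + r *\<^sub>R ?w)\<bar>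
          \<le> ennreal (c * (1 - s)) * (\<Sum>i\<in>UNIV. ennreal \<bar>?v (I @ [i]) (x + (s + (1 - s) * r) *\<^sub>R w)\<bar>)"
        using c0 s by (simp add: ennreal_leI sum_distrib_left[symmetric] flip: ennreal_mult'')
      then show "ennreal \<bar>?h r\<bar> \<le> ennreal (c * (1 - s)) * (indicator {0..1} r *
        (\<Sum>i\<in>UNIV. ennreal \<bar>?v (I @ [i]) (x + (s + (1 - s) * r) *\<^sub>R w)\<bar>))"
        by (cases "r \<in> {0..1}") simp_all
    qed
    also have "\<dots> = ennreal c * (ennreal (1 - s) * (\<integral>\<^sup>+ r. indicator {0..1} r *
        (\<Sum>i\<in>UNIV. ennreal \<bar>?v (I @ [i]) (x + (s + (1 - s) * r) *\<^sub>R w)\<bar>) \<partial>lborel))"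
      using c0 s by (subst nn_integral_cmult) (auto simp: ennreal_mult mult.assoc)
    also have "\<dots> \<le> ennreal c * (\<integral>\<^sup>+ t. indicator {s..1} t * (\<Sum>i\<in>UNIV. ennreal \<bar>?v (I @ [i]) (x + t *\<^sub>R w)\<bar>) \<partial>lborel)"
    proof (rule mult_left_mono)
    show "ennreal (1 - s) * (\<integral>\<^sup>+ r. indicator {0..1} r *
        (\<Sum>i\<in>UNIV. ennreal \<bar>?v (I @ [i]) (x + (s + (1 - s) * r) *\<^sub>R w)\<bar>) \<partial>lborel) \<le>
        (\<integral>\<^sup>+ t. indicator {s..1} t * (\<Sum>i\<in>UNIV. ennreal \<bar>?v (I @ [i]) (x + t *\<^sub>R w)\<bar>) \<partial>lborel)"
    proof (cases "s = 1")
      case False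
      let ?g = "\<lambda>t. indicator {s..1} t * (\<Sum>i\<in>UNIV. ennreal \<bar>?v (I @ [i]) (x + t *\<^sub>R w)\<bar>)"
      have "(\<integral>\<^sup>+ r. indicator {0..1} r *
        (\<Sum>i\<in>UNIV. ennreal \<bar>?v (I @ [i]) (x + (s + (1 - s) * r) *\<^sub>R w)\<bar>) \<partial>lborel) \<le>
          (\<integral>\<^sup>+ r. ?g (s + (1 - s) * r) \<partial>lborel)"
        using s sr(2) by (intro nn_integral_mono mult_right_mono) (auto simp: indicator_def)
      then have "ennreal (1 - s) * (\<integral>\<^sup>+ r. indicator {0..1} r *
        (\<Sum>i\<in>UNIV. ennreal \<bar>?v (I @ [i]) (x + (s + (1 - s) * r) *\<^sub>R w)\<bar>) \<partial>lborel) \<le>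
          ennreal \<bar>1 - s\<bar> * (\<integral>\<^sup>+ r. ?g (s + (1 - s) * r) \<partial>lborel)"
        using s by (intro mult_mono) auto
      also have "\<dots> = (\<integral>\<^sup>+ t. ?g t \<partial>lborel)"
        using False by (intro nn_integral_real_affine[symmetric]) auto
      finally show ?thesis .
    qed simp
    qed simp
    finally show ?thesis using split by (meson add_left_mono order_trans)
  qed
  have "G k s \<le> (\<Sum>I | length I = k. ennreal \<bar>?v I (x + w)\<bar> +
      ennreal c * (\<integral>\<^sup>+ t. indicator {s..1} t * (\<Sum>i\<in>UNIV. ennreal \<bar>?v (I @ [i]) (x + t *\<^sub>R w)\<bar>) \<partial>lborel))"
    unfolding G_def by (intro sum_mono one) simp
  also have "\<dots> = G k 1 + ennreal c * (\<integral>\<^sup>+ t. (\<Sum>I | length I = k. indicator {s..1} t * (\<Sum>i\<in>UNIV. ennreal \<bar>?v (I @ [i]) (x + t *\<^sub>R w)\<bar>)) \<partial>lborel)"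
    unfolding G_def by (subst nn_integral_sum) (simp_all add: sum.distrib sum_distrib_left)
  also have "(\<lambda>t. \<Sum>I | length I = k. indicator {s..1} t * (\<Sum>i\<in>UNIV. ennreal \<bar>?v (I @ [i]) (x + t *\<^sub>R w)\<bar>))
      = (\<lambda>t. indicator {s..1} t * G (Suc k) t)"
    unfolding G_def sum_distrib_left[symmetric] sum_lists_snoc[where g = "\<lambda>I. ennreal \<bar>?v I (x + _ *\<^sub>R w)\<bar>"] ..
  finally show ?thesis .
qed

lemma cone_potential_mono:
  "(\<And>y. F y \<le> F' y) \<Longrightarrow> cone_potential W m F x \<le> cone_potential W m F' x"
  unfolding cone_potential_def by (intro nn_integral_mono mult_left_mono) auto

lemma cone_potential_mono_set:
  "W \<subseteq> W' \<Longrightarrow> cone_potential W m F x \<le> cone_potential W' m F x"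
  unfolding cone_potential_def
  by (intro nn_integral_mono mult_right_mono) (auto simp: indicator_def)

lemma cone_potential_add:
  fixes F G :: "real ^ 'n \<Rightarrow> ennreal"
  assumes [measurable]: "F \<in> borel_measurable borel" "G \<in> borel_measurable borel" "W \<in> sets borel"
  shows "cone_potential W m (\<lambda>y. F y + G y) x = cone_potential W m F x + cone_potential W m G x"
  unfolding cone_potential_def
  by (subst nn_integral_add[symmetric], measurable)
     (intro nn_integral_cong, subst nn_integral_add[symmetric], measurable, simp add: distrib_left)

lemma cone_potential_cmult:
  fixes F :: "real ^ 'n \<Rightarrow> ennreal"
  assumes [measurable]: "F \<in> borel_measurable borel" "W \<in> sets borel"
  shows "cone_potential W m (\<lambda>y. a * F y) x = a * cone_potential W m F x"
  unfolding cone_potential_def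
  by (subst nn_integral_cmult[symmetric], measurable)
     (intro nn_integral_cong, subst nn_integral_cmult[symmetric], measurable, simp add: mult_ac)

text \<open>The potential is built from translations, so it commutes with the averaging over
  translations in a mollification.\<close>

lemma cone_potential_average:
  fixes F :: "real ^ 'n \<Rightarrow> ennreal" and h :: "real ^ 'n \<Rightarrow> ennreal"
  assumes [measurable]: "F \<in> borel_measurable borel" "h \<in> borel_measurable borel" "W \<in> sets borel"
  shows "cone_potential W m (\<lambda>y. \<integral>\<^sup>+ z. F (y - \<delta> *\<^sub>R z) * h z \<partial>lborel) x =
    (\<integral>\<^sup>+ z. cone_potential W m F (x - \<delta> *\<^sub>R z) * h z \<partial>lborel)"
proof -
  let ?a = "\<lambda>w s. indicator W w * (indicator {0..1} s * ennreal (s ^ (m - 1)))"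
  have "cone_potential W m (\<lambda>y. \<integral>\<^sup>+ z. F (y - \<delta> *\<^sub>R z) * h z \<partial>lborel) x =
      (\<integral>\<^sup>+ w. \<integral>\<^sup>+ s. \<integral>\<^sup>+ z. ?a w s * (F (x + s *\<^sub>R w - \<delta> *\<^sub>R z) * h z) \<partial>lborel \<partial>lborel \<partial>lborel)"
    unfolding cone_potential_def by (subst nn_integral_cmult) (simp_all add: mult.assoc)
  also have "\<dots> = (\<integral>\<^sup>+ w. \<integral>\<^sup>+ z. \<integral>\<^sup>+ s. ?a w s * (F (x + s *\<^sub>R w - \<delta> *\<^sub>R z) * h z) \<partial>lborel \<partial>lborel \<partial>lborel)"
    by (intro nn_integral_cong lborel_pair.Fubini'[symmetric]) measurable
  also have "\<dots> = (\<integral>\<^sup>+ z. \<integral>\<^sup>+ w. \<integral>\<^sup>+ s. ?a w s * (F (x + s *\<^sub>R w - \<delta> *\<^sub>R z) * h z) \<partial>lborel \<partial>lborel \<partial>lborel)"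
    by (rule lborel_pair.Fubini'[symmetric]) measurable
  also have "\<dots> = (\<integral>\<^sup>+ z. cone_potential W m F (x - \<delta> *\<^sub>R z) * h z \<partial>lborel)"
  proof (rule nn_integral_cong)
    fix z :: "real ^ 'n"
    have "(\<integral>\<^sup>+ w. \<integral>\<^sup>+ s. ?a w s * (F (x + s *\<^sub>R w - \<delta> *\<^sub>R z) * h z) \<partial>lborel \<partial>lborel) =
      (\<integral>\<^sup>+ w. \<integral>\<^sup>+ s. ?a w s * F (x - \<delta> *\<^sub>R z + s *\<^sub>R w) * h z \<partial>lborel \<partial>lborel)"
      by (simp add: algebra_simps)
    also have "\<dots> = (\<integral>\<^sup>+ w. (\<integral>\<^sup>+ s. ?a w s * F (x - \<delta> *\<^sub>R z + s *\<^sub>R w) \<partial>lborel) * h z \<partial>lborel)"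
      by (intro nn_integral_cong nn_integral_multc) measurable
    also have "\<dots> = (\<integral>\<^sup>+ w. (\<integral>\<^sup>+ s. ?a w s * F (x - \<delta> *\<^sub>R z + s *\<^sub>R w) \<partial>lborel) \<partial>lborel) * h z"
      by (rule nn_integral_multc) measurable
    finally show "(\<integral>\<^sup>+ w. \<integral>\<^sup>+ s. ?a w s * (F (x + s *\<^sub>R w - \<delta> *\<^sub>R z) * h z) \<partial>lborel \<partial>lborel)
        = cone_potential W m F (x - \<delta> *\<^sub>R z) * h z"
      by (simp add: cone_potential_def mult.assoc)
  qed
  finally show ?thesis .
qed

text \<open>The Taylor formula along segments is integrated over the directions \<open>w \<in> W\<close>. The boundary
  terms, evaluated at \<open>x + w\<close>, become \<open>L\<^sup>1\<close> norms of derivatives of lower order. The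
  remainders become the potential of the mollified derivatives of order \<open>m\<close>, which is
  bounded by the mollification of the potential of these derivatives.\<close>

lemma mollified_cone_bound:
  fixes f :: "'n list \<Rightarrow> real ^ 'n \<Rightarrow> real" and W :: "(real ^ 'n) set"
  assumes \<eta>: "mollifier \<eta>" and \<delta>: "\<delta> > 0" and m: "m \<ge> 1"
    and f: "\<And>I. integrable lborel (f I)"
    and weak: "\<And>I i \<phi>. length I < m \<Longrightarrow> test_function \<Omega> \<phi> \<Longrightarrow>
      (LINT y|lborel. f I y * partial_deriv i \<phi> y) = - (LINT y|lborel. f (I @ [i]) y * \<phi> y)"
    and W [measurable]: "W \<in> sets borel"
    and seg: "\<And>w s. w \<in> W \<Longrightarrow> 0 \<le> s \<Longrightarrow> s \<le> 1 \<Longrightarrow> cball (x + s *\<^sub>R w) \<delta> \<subseteq> \<Omega>"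
    and c: "\<And>w i. w \<in> W \<Longrightarrow> \<bar>w $ i\<bar> \<le> c"
  shows "emeasure lborel W * ennreal \<bar>mollify \<eta> \<delta> (f []) x\<bar> \<le>
    (\<Sum>k<m. ennreal c ^ k * (\<Sum>I | length I = k. \<integral>\<^sup>+ y. ennreal \<bar>f I y\<bar> \<partial>lborel)) +
    ennreal c ^ m * (\<integral>\<^sup>+ z. cone_potential W m (\<lambda>y. \<Sum>I | length I = m. ennreal \<bar>f I y\<bar>) (x - \<delta> *\<^sub>R z) * ennreal (\<eta> z) \<partial>lborel)"
proof -
  have [measurable]: "f I \<in> borel_measurable borel" for I using f[of I] by auto
  have [measurable]: "\<eta> \<in> borel_measurable borel" by (rule mollifier_borel[OF \<eta>])
  have [measurable]: "mollify \<eta> \<delta> (f I) \<in> borel_measurable borel" for I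
    unfolding mollify_def by measurable
  let ?v = "\<lambda>I. mollify \<eta> \<delta> (f I)"
  let ?G = "\<lambda>w k s. \<Sum>I | length I = k. ennreal \<bar>?v I (x + s *\<^sub>R w)\<bar>"
  let ?P = "\<lambda>w. \<integral>\<^sup>+ s. indicator {0..1} s * ennreal (s ^ (m - 1)) * ?G w m s \<partial>lborel"
  have pt: "ennreal \<bar>?v [] x\<bar> \<le> (\<Sum>k<m. ennreal c ^ k * ?G w k 1) + ennreal c ^ m * ?P w" if w: "w \<in> W" for w
  proof -
    have "?G w 0 0 \<le> (\<Sum>k<m. ennreal c ^ k * ?G w k 1) + ennreal c ^ m * ?P w"
    proof (rule iterated_segment_bound[where m = m])
      show "?G w k s \<le> ?G w k 1 + ennreal c * (\<integral>\<^sup>+ t. indicator {s..1} t * ?G w (Suc k) t \<partial>lborel)"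
        if "k < m" "0 \<le> s" "s \<le> 1" for k s
        using mollified_segment_bound[OF \<eta> \<delta> f weak seg[OF w] c[OF w] that] by simp
    qed (use m in auto)
    then show ?thesis by simp
  qed
  have 1: "(\<integral>\<^sup>+ w. indicator W w * (\<Sum>k<m. ennreal c ^ k * ?G w k 1) \<partial>lborel) \<le>
      (\<Sum>k<m. ennreal c ^ k * (\<Sum>I | length I = k. \<integral>\<^sup>+ y. ennreal \<bar>f I y\<bar> \<partial>lborel))"
  proof -
    have "(\<integral>\<^sup>+ w. indicator W w * (\<Sum>k<m. ennreal c ^ k * ?G w k 1) \<partial>lborel) \<le>
        (\<integral>\<^sup>+ w. (\<Sum>k<m. ennreal c ^ k * (\<Sum>I | length I = k. ennreal \<bar>?v I (w + x)\<bar>)) \<partial>lborel)"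
      by (intro nn_integral_mono) (auto simp: indicator_def add.commute)
    also have "\<dots> = (\<Sum>k<m. ennreal c ^ k * (\<Sum>I | length I = k. \<integral>\<^sup>+ w. ennreal \<bar>?v I (w + x)\<bar> \<partial>lborel))"
      by (simp add: nn_integral_sum nn_integral_cmult del: sum_ennreal)
    also have "\<dots> \<le> (\<Sum>k<m. ennreal c ^ k * (\<Sum>I | length I = k. \<integral>\<^sup>+ y. ennreal \<bar>f I y\<bar> \<partial>lborel))"
    proof (intro sum_mono mult_left_mono)
      fix I
      have "(\<integral>\<^sup>+ w. ennreal \<bar>?v I (w + x)\<bar> \<partial>lborel) = (\<integral>\<^sup>+ w. ennreal \<bar>?v I w\<bar> \<partial>lborel)"
        by (rule nn_integral_translate[where f = "\<lambda>w. ennreal \<bar>?v I w\<bar>"]) simp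
      also have "\<dots> \<le> (\<integral>\<^sup>+ y. ennreal \<bar>f I y\<bar> \<partial>lborel)"
        by (rule mollify_L1_le[OF \<eta>]) simp
      finally show "(\<integral>\<^sup>+ w. ennreal \<bar>?v I (w + x)\<bar> \<partial>lborel) \<le> (\<integral>\<^sup>+ y. ennreal \<bar>f I y\<bar> \<partial>lborel)" .
    qed simp
    finally show ?thesis .
  qed
  have 2: "(\<integral>\<^sup>+ w. indicator W w * ?P w \<partial>lborel) \<le>
      (\<integral>\<^sup>+ z. cone_potential W m (\<lambda>y. \<Sum>I | length I = m. ennreal \<bar>f I y\<bar>) (x - \<delta> *\<^sub>R z) * ennreal (\<eta> z) \<partial>lborel)"
  proof -
    have "(\<integral>\<^sup>+ w. indicator W w * ?P w \<partial>lborel) = cone_potential W m (\<lambda>y. \<Sum>I | length I = m. ennreal \<bar>?v I y\<bar>) x"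
      unfolding cone_potential_def by (subst nn_integral_cmult) (simp_all add: mult.assoc)
    also have "\<dots> \<le> cone_potential W m (\<lambda>y. \<integral>\<^sup>+ z. (\<Sum>I | length I = m. ennreal \<bar>f I (y - \<delta> *\<^sub>R z)\<bar>) * ennreal (\<eta> z) \<partial>lborel) x"
    proof (rule cone_potential_mono)
      fix y
      have "(\<Sum>I | length I = m. ennreal \<bar>?v I y\<bar>) \<le>
          (\<Sum>I | length I = m. \<integral>\<^sup>+ z. ennreal \<bar>f I (y - \<delta> *\<^sub>R z)\<bar> * ennreal (\<eta> z) \<partial>lborel)"
        by (intro sum_mono mollify_abs_le[OF \<eta>]) simp
      also have "\<dots> = (\<integral>\<^sup>+ z. (\<Sum>I | length I = m. ennreal \<bar>f I (y - \<delta> *\<^sub>R z)\<bar>) * ennreal (\<eta> z) \<partial>lborel)"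
        by (simp add: sum_distrib_right nn_integral_sum del: sum_ennreal)
      finally show "(\<Sum>I | length I = m. ennreal \<bar>?v I y\<bar>) \<le>
        (\<integral>\<^sup>+ z. (\<Sum>I | length I = m. ennreal \<bar>f I (y - \<delta> *\<^sub>R z)\<bar>) * ennreal (\<eta> z) \<partial>lborel)" .
    qed
    also have "\<dots> = (\<integral>\<^sup>+ z. cone_potential W m (\<lambda>y. \<Sum>I | length I = m. ennreal \<bar>f I y\<bar>) (x - \<delta> *\<^sub>R z) * ennreal (\<eta> z) \<partial>lborel)"
      by (rule cone_potential_average) measurable
    finally show ?thesis .
  qed
  have "emeasure lborel W * ennreal \<bar>?v [] x\<bar> = (\<integral>\<^sup>+ w. indicator W w * ennreal \<bar>?v [] x\<bar> \<partial>lborel)"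
    by (simp add: nn_integral_multc)
  also have "\<dots> \<le> (\<integral>\<^sup>+ w. indicator W w * (\<Sum>k<m. ennreal c ^ k * ?G w k 1) + ennreal c ^ m * (indicator W w * ?P w) \<partial>lborel)"
    using pt by (intro nn_integral_mono) (auto simp: indicator_def)
  also have "\<dots> = (\<integral>\<^sup>+ w. indicator W w * (\<Sum>k<m. ennreal c ^ k * ?G w k 1) \<partial>lborel) +
      ennreal c ^ m * (\<integral>\<^sup>+ w. indicator W w * ?P w \<partial>lborel)"
    by (subst nn_integral_add) (auto simp: nn_integral_cmult)
  finally show ?thesis using 1 2 by (meson add_mono mult_left_mono order_trans zero_le)
qed

text \<open>The radius of the mollification tends to zero in the previous bound. Both \<open>f []\<close> and the
  potential are integrable, so along a common sequence of radii both mollifications converge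
  almost everywhere to the unmollified functions.\<close>

proposition sobolev_cone_bound:
  fixes f :: "'n list \<Rightarrow> real ^ 'n \<Rightarrow> real" and w0 :: "real ^ 'n"
  assumes \<Omega>: "open \<Omega>" and m: "m \<ge> 1"
    and f: "\<And>I. integrable lborel (f I)"
    and weak: "\<And>I i \<phi>. length I < m \<Longrightarrow> test_function \<Omega> \<phi> \<Longrightarrow>
      (LINT y|lborel. f I y * partial_deriv i \<phi> y) = - (LINT y|lborel. f (I @ [i]) y * \<phi> y)"
    and U: "\<And>x w s. x \<in> U \<Longrightarrow> w \<in> cball w0 \<kappa> \<Longrightarrow> 0 \<le> s \<Longrightarrow> s \<le> 1 \<Longrightarrow> x + s *\<^sub>R w \<in> \<Omega>"
    and c: "\<And>w i. w \<in> cball w0 \<kappa> \<Longrightarrow> \<bar>w $ i\<bar> \<le> c"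
  shows "AE x in lborel. x \<in> U \<longrightarrow> emeasure lborel (cball w0 \<kappa>) * ennreal \<bar>f [] x\<bar> \<le>
    (\<Sum>k<m. ennreal c ^ k * (\<Sum>I | length I = k. \<integral>\<^sup>+ y. ennreal \<bar>f I y\<bar> \<partial>lborel)) +
    ennreal c ^ m * cone_potential (cball w0 \<kappa>) m (\<lambda>y. \<Sum>I | length I = m. ennreal \<bar>f I y\<bar>) x"
proof -
  obtain \<eta> :: "real ^ 'n \<Rightarrow> real" where \<eta>: "mollifier \<eta>" using mollifier_exists by blast
  have [measurable]: "f I \<in> borel_measurable borel" for I using f[of I] by auto
  have [measurable]: "\<eta> \<in> borel_measurable borel" by (rule mollifier_borel[OF \<eta>])
  have \<eta>0: "\<eta> z \<ge> 0" for z using \<eta> by (simp add: mollifier_def)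
  let ?W = "cball w0 \<kappa>"
  let ?N = "\<Sum>k<m. ennreal c ^ k * (\<Sum>I | length I = k. \<integral>\<^sup>+ y. ennreal \<bar>f I y\<bar> \<partial>lborel)"
  define F where "F = (\<lambda>y. \<Sum>I | length I = m. ennreal \<bar>f I y\<bar>)"
  have [measurable]: "F \<in> borel_measurable borel" unfolding F_def by measurable
  define R where "R = cone_potential ?W m F"
  have [measurable]: "R \<in> borel_measurable borel" unfolding R_def by measurable
  have "(\<integral>\<^sup>+ y. F y \<partial>lborel) = (\<Sum>I | length I = m. \<integral>\<^sup>+ y. ennreal \<bar>f I y\<bar> \<partial>lborel)"
    unfolding F_def by (rule nn_integral_sum) simp
  also have "\<dots> < \<infinity>"
    using f by (simp add: integrable_iff_bounded)
  finally have "emeasure lborel ?W * (\<integral>\<^sup>+ y. F y \<partial>lborel) < \<infinity>"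
    using emeasure_bounded_finite[OF bounded_cball, of w0 \<kappa>] by (simp add: ennreal_mult_less_top)
  with nn_integral_cone_potential_le[of F ?W m] have Rint: "(\<integral>\<^sup>+ x. R x \<partial>lborel) < \<infinity>"
    unfolding R_def by (auto intro: le_less_trans)
  then have Rfin: "AE x in lborel. R x \<noteq> \<infinity>"
    by (intro nn_integral_noteq_infinite) auto
  \<comment> \<open>The potential is finite almost everywhere. Its real-valued version is mollified together
    with \<open>f []\<close>.\<close>
  define r where "r = (\<lambda>x. enn2real (R x))"
  have [measurable]: "r \<in> borel_measurable borel" unfolding r_def by measurable
  have Rr: "AE x in lborel. R x = ennreal (r x)"
    using Rfin by eventually_elim (simp add: r_def less_top)
  have r0: "r x \<ge> 0" for x by (simp add: r_def)
  have rint: "integrable lborel r"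
  proof (rule integrableI_bounded)
    have "(\<integral>\<^sup>+ x. ennreal (norm (r x)) \<partial>lborel) = (\<integral>\<^sup>+ x. R x \<partial>lborel)"
      using Rr by (intro nn_integral_cong_AE) (auto simp: r0)
    then show "(\<integral>\<^sup>+ x. ennreal (norm (r x)) \<partial>lborel) < \<infinity>" using Rint by simp
  qed simp
  have avg: "(\<integral>\<^sup>+ z. R (x - \<delta> *\<^sub>R z) * ennreal (\<eta> z) \<partial>lborel) = ennreal (mollify \<eta> \<delta> r x)" if \<delta>: "\<delta> > 0" for x \<delta>
  proof -
    have neq: "- \<delta> \<noteq> 0" using \<delta> by simp
    have "AE y in density (distr lborel borel (\<lambda>z. x + (-\<delta>) *\<^sub>R z)) (\<lambda>_. ennreal (\<bar>-\<delta>\<bar> ^ DIM(real^'n))). R y = ennreal (r y)"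
      using Rr by (subst (asm) lborel_affine[OF neq, of x])
    then have ae: "AE z in lborel. R (x + (- \<delta>) *\<^sub>R z) = ennreal (r (x + (- \<delta>) *\<^sub>R z))"
      using \<delta> by (simp add: AE_density AE_distr_iff)
    have "(\<integral>\<^sup>+ z. R (x - \<delta> *\<^sub>R z) * ennreal (\<eta> z) \<partial>lborel) = (\<integral>\<^sup>+ z. ennreal (r (x - \<delta> *\<^sub>R z) * \<eta> z) \<partial>lborel)"
      using ae by (intro nn_integral_cong_AE) (auto simp: ennreal_mult r0 \<eta>0)
    also have "\<dots> = ennreal (mollify \<eta> \<delta> r x)"
      unfolding mollify_def
      by (rule nn_integral_eq_integral[OF integrable_mollify_integrand[OF \<eta> rint \<delta>]])
         (simp add: r0 \<eta>0)
    finally show ?thesis .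
  qed
  define \<delta> where "\<delta> = (\<lambda>j::nat. 1 / real (Suc j))"
  have \<delta>0: "\<delta> \<longlonglongrightarrow> 0" unfolding \<delta>_def by (rule LIMSEQ_Suc[OF lim_const_over_n])
  have \<delta>pos: "\<delta> j > 0" for j by (simp add: \<delta>_def)
  obtain r1 where r1: "strict_mono r1" "AE x in lborel. (\<lambda>j. mollify \<eta> (\<delta> (r1 j)) (f []) x) \<longlonglongrightarrow> f [] x"
    by (rule mollify_AE_tendsto[OF \<eta> f \<delta>0 \<delta>pos])
  have \<delta>1: "(\<lambda>j. \<delta> (r1 j)) \<longlonglongrightarrow> 0"
    using LIMSEQ_subseq_LIMSEQ[OF \<delta>0 r1(1)] by (simp add: o_def)
  obtain r2 where r2: "strict_mono r2" "AE x in lborel. (\<lambda>j. mollify \<eta> (\<delta> (r1 (r2 j))) r x) \<longlonglongrightarrow> r x"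
    by (rule mollify_AE_tendsto[OF \<eta> rint \<delta>1 \<delta>pos])
  define d where "d = (\<lambda>j. \<delta> (r1 (r2 j)))"
  have d0: "d \<longlonglongrightarrow> 0"
    using LIMSEQ_subseq_LIMSEQ[OF \<delta>1 r2(1)] by (simp add: o_def d_def)
  have dpos: "d j > 0" for j by (simp add: d_def \<delta>pos)
  show ?thesis
    using r1(2) r2(2) Rr
  proof eventually_elim
    case (elim x)
    show ?case
    proof
      assume x: "x \<in> U"
      \<comment> \<open>The cone with vertex \<open>x\<close> is a compact subset of \<open>\<Omega>\<close>, so it has a positive distance
        \<open>e\<close> from the complement. Radii smaller than \<open>e\<close> are admissible.\<close>
      let ?K = "(\<lambda>(s, w). x + s *\<^sub>R w) ` ({0..1} \<times> ?W)"
      have "compact ?K"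
        by (intro compact_continuous_image compact_Times) (auto simp: split_beta intro!: continuous_intros)
      moreover have "?K \<subseteq> \<Omega>" using U[OF x] by auto
      ultimately obtain e where e: "e > 0" "(\<Union>y\<in>?K. cball y e) \<subseteq> \<Omega>"
        using compact_subset_open_imp_cball_epsilon_subset[OF _ \<Omega>] by metis
      have "eventually (\<lambda>j. d j < e) sequentially"
        using order_tendstoD(2)[OF d0 e(1)] .
      then have ev: "eventually (\<lambda>j. emeasure lborel ?W * ennreal \<bar>mollify \<eta> (d j) (f []) x\<bar> \<le>
          ?N + ennreal c ^ m * ennreal (mollify \<eta> (d j) r x)) sequentially"
      proof eventually_elim
        case (elim j)
        have "emeasure lborel ?W * ennreal \<bar>mollify \<eta> (d j) (f []) x\<bar> \<le>
          ?N + ennreal c ^ m * (\<integral>\<^sup>+ z. R (x - d j *\<^sub>R z) * ennreal (\<eta> z) \<partial>lborel)"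
          unfolding R_def F_def
        proof (rule mollified_cone_bound[OF \<eta> dpos m f weak _ _ c])
          fix w and s :: real assume ws: "w \<in> ?W" "0 \<le> s" "s \<le> 1"
          have "cball (x + s *\<^sub>R w) e \<subseteq> \<Omega>" using e(2) ws by force
          then show "cball (x + s *\<^sub>R w) (d j) \<subseteq> \<Omega>"
            using elim subset_cball[of "d j" e] by (meson less_imp_le order_trans)
        qed auto
        then show ?case by (simp add: avg[OF dpos])
      qed
      have L1: "(\<lambda>j. emeasure lborel ?W * ennreal \<bar>mollify \<eta> (d j) (f []) x\<bar>) \<longlonglongrightarrow> emeasure lborel ?W * ennreal \<bar>f [] x\<bar>"
      proof (rule ennreal_tendsto_cmult)
        show "emeasure lborel ?W < top" using emeasure_bounded_finite[OF bounded_cball, of w0 \<kappa>] by simp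
        have "(\<lambda>j. mollify \<eta> (d j) (f []) x) \<longlonglongrightarrow> f [] x"
          using LIMSEQ_subseq_LIMSEQ[OF elim(1) r2(1)] by (simp add: o_def d_def)
        then show "(\<lambda>j. ennreal \<bar>mollify \<eta> (d j) (f []) x\<bar>) \<longlonglongrightarrow> ennreal \<bar>f [] x\<bar>"
          by (intro tendsto_ennrealI tendsto_rabs)
      qed
      have L2: "(\<lambda>j. ?N + ennreal c ^ m * ennreal (mollify \<eta> (d j) r x)) \<longlonglongrightarrow> ?N + ennreal c ^ m * ennreal (r x)"
        using elim(2) unfolding d_def
        by (intro tendsto_add tendsto_const ennreal_tendsto_cmult tendsto_ennrealI)
           (auto simp: power_less_top_ennreal)
      have "emeasure lborel ?W * ennreal \<bar>f [] x\<bar> \<le> ?N + ennreal c ^ m * ennreal (r x)"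
        by (rule tendsto_le[OF sequentially_bot L2 L1 ev])
      then show "emeasure lborel ?W * ennreal \<bar>f [] x\<bar> \<le> ?N + ennreal c ^ m * cone_potential ?W m (\<lambda>y. \<Sum>I | length I = m. ennreal \<bar>f I y\<bar>) x"
        using elim(3) by (simp add: R_def F_def)
    qed
  qed
qed

section \<open>The cone condition and a pointwise bound by a potential\<close>

text \<open>Near a boundary point, \<open>\<Omega>\<close> lies above the graph of a Lipschitz function, and moving in the
  direction \<open>e\<close> leads into \<open>\<Omega>\<close>. The same holds for all directions sufficiently close to
  \<open>\<rho> e\<close>: along such a direction, the gain in height exceeds the change of the Lipschitz
  function. For interior points, a small ball of directions serves.\<close>

lemma lipschitz_domain_local_cone:
  fixes \<Omega> :: "(real ^ 'n) set"
  assumes \<Omega>: "bounded_lipschitz_domain \<Omega>" and p: "p \<in> closure \<Omega>"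
  shows "\<exists>r w0 \<kappa>. r > 0 \<and> \<kappa> > 0 \<and>
    (\<forall>x\<in>\<Omega> \<inter> ball p r. \<forall>w\<in>cball w0 \<kappa>. \<forall>s. 0 \<le> s \<and> s \<le> 1 \<longrightarrow> x + s *\<^sub>R w \<in> \<Omega>)"
proof (cases "p \<in> \<Omega>")
  case True
  then obtain e where e: "e > 0" "ball p e \<subseteq> \<Omega>"
    using \<Omega> by (meson bounded_lipschitz_domain_def openE)
  have "x + s *\<^sub>R w \<in> \<Omega>" if x: "x \<in> ball p (e / 2)" and w: "w \<in> cball 0 (e / 2)" and s: "0 \<le> s" "s \<le> 1" for x w s
  proof -
    have "dist p (x + s *\<^sub>R w) \<le> dist p x + norm (s *\<^sub>R w)"
      using dist_triangle[of p "x + s *\<^sub>R w" x] by (simp add: dist_norm)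
    also have "norm (s *\<^sub>R w) \<le> 1 * norm w"
      using s by (simp add: mult_left_le_one_le)
    finally show ?thesis using x w e by auto
  qed
  then show ?thesis using e by (intro exI[of _ "e / 2"] exI[of _ 0]) auto
next
  case False
  then have "p \<in> frontier \<Omega>"
    using p \<Omega> by (simp add: frontier_def bounded_lipschitz_domain_def interior_open)
  then obtain r e \<gamma> L where r: "r > 0" and e: "norm e = 1" and \<gamma>: "L-lipschitz_on {z. z \<bullet> e = 0} \<gamma>"
    and graph: "\<Omega> \<inter> ball p r = {y \<in> ball p r. y \<bullet> e > \<gamma> (y - (y \<bullet> e) *\<^sub>R e)}"
    using \<Omega> unfolding bounded_lipschitz_domain_def lipschitz_boundary_def by blast
  have L: "L \<ge> 0" using \<gamma> by (rule lipschitz_on_nonneg)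
  have ee: "e \<bullet> e = 1" using e by (simp add: dot_square_norm)
  define \<rho> where "\<rho> = r / 4"
  \<comment> \<open>For \<open>w\<close> within \<open>\<kappa>\<close> of \<open>\<rho> e\<close>, the height grows by at least \<open>s (\<rho> - \<kappa>)\<close> and the graph by
    at most \<open>2 L \<kappa> s\<close>. This value of \<open>\<kappa>\<close> makes the two bounds equal.\<close>
  define \<kappa> where "\<kappa> = \<rho> / (1 + 2 * L)"
  have \<rho>: "\<rho> > 0" using r by (simp add: \<rho>_def)
  have \<kappa>: "\<kappa> > 0" "\<kappa> \<le> \<rho>" "\<kappa> * (1 + 2 * L) = \<rho>"
    using \<rho> L by (auto simp: \<kappa>_def divide_le_eq)
  let ?\<pi> = "\<lambda>y. y - (y \<bullet> e) *\<^sub>R e"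
  have \<pi>0: "?\<pi> y \<in> {z. z \<bullet> e = 0}" for y by (simp add: inner_diff_left ee)
  have "x + s *\<^sub>R w \<in> \<Omega>"
    if x: "x \<in> \<Omega> \<inter> ball p (r / 2)" and w: "w \<in> cball (\<rho> *\<^sub>R e) \<kappa>" and s: "0 \<le> s" "s \<le> 1" for x w s
  proof -
    define v where "v = w - \<rho> *\<^sub>R e"
    have v: "norm v \<le> \<kappa>" using w by (simp add: v_def dist_norm norm_minus_commute)
    have wv: "w = \<rho> *\<^sub>R e + v" by (simp add: v_def)
    have ve: "\<bar>v \<bullet> e\<bar> \<le> norm v" using Cauchy_Schwarz_ineq2[of v e] e by simp
    have "norm w \<le> \<rho> + \<kappa>" using norm_triangle_ineq[of "\<rho> *\<^sub>R e" v] v e \<rho> by (simp add: wv)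
    then have nw: "norm w \<le> r / 2" using \<kappa>(2) by (simp add: \<rho>_def)
    have "dist p (x + s *\<^sub>R w) \<le> dist p x + norm (s *\<^sub>R w)"
      using dist_triangle[of p "x + s *\<^sub>R w" x] by (simp add: dist_norm)
    also have "norm (s *\<^sub>R w) \<le> norm w"
      using s by (simp add: mult_left_le_one_le)
    finally have inball: "x + s *\<^sub>R w \<in> ball p r" using x nw by auto
    have "x \<in> \<Omega> \<inter> ball p r" using x r by auto
    then have xe: "x \<bullet> e > \<gamma> (?\<pi> x)" using graph by blast
    have we: "w \<bullet> e \<ge> \<rho> - \<kappa>" using ve v by (simp add: wv inner_add_left ee)
    have \<pi>d: "?\<pi> (x + s *\<^sub>R w) - ?\<pi> x = s *\<^sub>R (v - (v \<bullet> e) *\<^sub>R e)"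
      by (simp add: wv inner_add_left ee algebra_simps)
    have "norm (v - (v \<bullet> e) *\<^sub>R e) \<le> 2 * \<kappa>"
      using norm_triangle_ineq4[of v "(v \<bullet> e) *\<^sub>R e"] ve v e by simp
    then have "dist (?\<pi> (x + s *\<^sub>R w)) (?\<pi> x) \<le> s * (2 * \<kappa>)"
      unfolding dist_norm \<pi>d using s by (simp add: mult_left_mono)
    then have "L * dist (?\<pi> (x + s *\<^sub>R w)) (?\<pi> x) \<le> L * (s * (2 * \<kappa>))"
      using L by (rule mult_left_mono)
    moreover have "dist (\<gamma> (?\<pi> (x + s *\<^sub>R w))) (\<gamma> (?\<pi> x)) \<le> L * dist (?\<pi> (x + s *\<^sub>R w)) (?\<pi> x)"
      by (rule lipschitz_onD[OF \<gamma> \<pi>0 \<pi>0])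
    ultimately have "\<gamma> (?\<pi> (x + s *\<^sub>R w)) \<le> \<gamma> (?\<pi> x) + L * (s * (2 * \<kappa>))"
      by (simp add: dist_real_def)
    also have "L * (s * (2 * \<kappa>)) = s * (\<rho> - \<kappa>)"
      using \<kappa>(3) by (simp add: algebra_simps flip: \<kappa>(3))
    also have "\<dots> \<le> s * (w \<bullet> e)" using we s by (intro mult_left_mono)
    finally have "\<gamma> (?\<pi> (x + s *\<^sub>R w)) < (x + s *\<^sub>R w) \<bullet> e"
      using xe by (simp add: inner_add_left)
    then show ?thesis using inball graph by blast
  qed
  then show ?thesis using r \<kappa> by (intro exI[of _ "r / 2"] exI[of _ "\<rho> *\<^sub>R e"] exI[of _ \<kappa>]) auto
qed

lemma lipschitz_domain_cone_condition:
  fixes \<Omega> :: "(real ^ 'n) set"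
  assumes \<Omega>: "bounded_lipschitz_domain \<Omega>"
  obtains P :: "(real ^ 'n) set" and r \<kappa> :: "real ^ 'n \<Rightarrow> real" and w0 :: "real ^ 'n \<Rightarrow> real ^ 'n" where
    "finite P" "\<Omega> \<subseteq> (\<Union>p\<in>P. ball p (r p))" "\<And>p. p \<in> P \<Longrightarrow> \<kappa> p > 0"
    "\<And>p x w s. p \<in> P \<Longrightarrow> x \<in> \<Omega> \<inter> ball p (r p) \<Longrightarrow> w \<in> cball (w0 p) (\<kappa> p) \<Longrightarrow> 0 \<le> s \<Longrightarrow> s \<le> 1 \<Longrightarrow> x + s *\<^sub>R w \<in> \<Omega>"
proof -
  have "\<forall>p\<in>closure \<Omega>. \<exists>r w0 \<kappa>. r > 0 \<and> \<kappa> > 0 \<and>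
    (\<forall>x\<in>\<Omega> \<inter> ball p r. \<forall>w\<in>cball w0 \<kappa>. \<forall>s. 0 \<le> s \<and> s \<le> 1 \<longrightarrow> x + s *\<^sub>R w \<in> \<Omega>)"
    using lipschitz_domain_local_cone[OF \<Omega>] by blast
  then obtain r w0 \<kappa> where *: "\<And>p. p \<in> closure \<Omega> \<Longrightarrow> r p > 0 \<and> \<kappa> p > 0 \<and>
    (\<forall>x\<in>\<Omega> \<inter> ball p (r p). \<forall>w\<in>cball (w0 p) (\<kappa> p). \<forall>s. 0 \<le> s \<and> s \<le> 1 \<longrightarrow> x + s *\<^sub>R w \<in> \<Omega>)"
    by metis
  have "compact (closure \<Omega>)" using \<Omega> by (simp add: bounded_lipschitz_domain_def)
  moreover have "closure \<Omega> \<subseteq> (\<Union>p\<in>closure \<Omega>. ball p (r p))" using * by force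
  ultimately obtain P where P: "P \<subseteq> closure \<Omega>" "finite P" "closure \<Omega> \<subseteq> (\<Union>p\<in>P. ball p (r p))"
    using compactE_image[of "closure \<Omega>" "closure \<Omega>" "\<lambda>p. ball p (r p)"] by (metis open_ball)
  show ?thesis
  proof (rule that[of P r \<kappa> w0])
    show "\<Omega> \<subseteq> (\<Union>p\<in>P. ball p (r p))" using P(3) closure_subset by blast
    show "\<kappa> p > 0" if "p \<in> P" for p using * P(1) that by blast
    show "x + s *\<^sub>R w \<in> \<Omega>" if "p \<in> P" "x \<in> \<Omega> \<inter> ball p (r p)" "w \<in> cball (w0 p) (\<kappa> p)" "0 \<le> s" "s \<le> 1" for p x w s
      using *[of p] P(1) that by blast
  qed (rule P)
qed

lemma weak_partial_spec:
  assumes "weakly_differentiable m \<Omega> u" "length I \<le> m"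
  shows "has_weak_partial \<Omega> I u (weak_partial \<Omega> I u)"
proof (cases "I = []")
  case True
  obtain v where "has_weak_partial \<Omega> [] u v"
    using assms unfolding weakly_differentiable_def by (metis list.size(3) zero_le)
  then show ?thesis using True by (simp add: has_weak_partial_def weak_partial_def)
next
  case False
  then show ?thesis
    using assms unfolding weakly_differentiable_def weak_partial_def by (metis someI_ex)
qed

text \<open>Weak derivatives can be taken one direction at a time. The new direction is appended at
  the end of the list because it acts first on the test function.\<close>

lemma weak_partial_snoc:
  assumes u: "weakly_differentiable m \<Omega> u" and I: "length I < m" and \<phi>: "test_function \<Omega> \<phi>"
  shows "(LINT x|lebesgue_on \<Omega>. weak_partial \<Omega> I u x * partial_deriv i \<phi> x) =
    - (LINT x|lebesgue_on \<Omega>. weak_partial \<Omega> (I @ [i]) u x * \<phi> x)"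
proof -
  have d: "test_function \<Omega> (partial_deriv i \<phi>)"
    using test_function_partial_derivs[OF \<phi>, of "[i]"] by simp
  have 1: "(LINT x|lebesgue_on \<Omega>. u x * partial_derivs I (partial_deriv i \<phi>) x) =
      (-1) ^ length I * (LINT x|lebesgue_on \<Omega>. weak_partial \<Omega> I u x * partial_deriv i \<phi> x)"
    using weak_partial_spec[OF u, of I] I d by (simp add: has_weak_partial_def)
  have 2: "(LINT x|lebesgue_on \<Omega>. u x * partial_derivs (I @ [i]) \<phi> x) =
      (-1) ^ length (I @ [i]) * (LINT x|lebesgue_on \<Omega>. weak_partial \<Omega> (I @ [i]) u x * \<phi> x)"
    using weak_partial_spec[OF u, of "I @ [i]"] I \<phi> unfolding has_weak_partial_def by force
  have "(-1) ^ length I * (LINT x|lebesgue_on \<Omega>. weak_partial \<Omega> I u x * partial_deriv i \<phi> x) =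
      (-1) ^ length I * - (LINT x|lebesgue_on \<Omega>. weak_partial \<Omega> (I @ [i]) u x * \<phi> x)"
    using 1 2 by (simp add: partial_derivs_append)
  then show ?thesis by (rule mult_left_cancel[THEN iffD1, rotated]) simp
qed

lemma integral_borel_version:
  fixes f h :: "real ^ 'n \<Rightarrow> real"
  assumes \<Omega>: "open \<Omega>" and f: "f \<in> borel_measurable borel" and h: "h \<in> borel_measurable borel"
    and v: "integrable (lebesgue_on \<Omega>) v"
    and ae: "AE x in lebesgue. indicator \<Omega> x *\<^sub>R v x = f x"
  shows "(LINT x|lborel. f x * h x) = (LINT x|lebesgue_on \<Omega>. v x * h x)"
proof -
  have iv: "integrable lebesgue (\<lambda>x. indicator \<Omega> x *\<^sub>R v x)"
    using v \<Omega> by (subst (asm) integrable_restrict_space) auto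
  have "(LINT x|lborel. f x * h x) = (LINT x|lebesgue. f x * h x)"
    using f h by (intro integral_completion[symmetric]) auto
  also have "\<dots> = (LINT x|lebesgue. (indicator \<Omega> x *\<^sub>R v x) * h x)"
  proof (rule integral_cong_AE)
    show "(\<lambda>x. f x * h x) \<in> borel_measurable lebesgue"
      using f h by (intro measurable_completion) auto
    show "(\<lambda>x. indicator \<Omega> x *\<^sub>R v x * h x) \<in> borel_measurable lebesgue"
      using iv h by (intro borel_measurable_times) (auto intro!: measurable_completion)
    show "AE x in lebesgue. f x * h x = indicator \<Omega> x *\<^sub>R v x * h x"
      using ae by eventually_elim simp
  qed
  also have "\<dots> = (LINT x|lebesgue. indicator \<Omega> x *\<^sub>R (v x * h x))"
    by (simp add: mult.assoc)
  also have "\<dots> = (LINT x|lebesgue_on \<Omega>. v x * h x)"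
    using \<Omega> by (subst integral_restrict_space) auto
  finally show ?thesis .
qed

lemma sum_weak_partial_le_grad_length:
  fixes u :: "real ^ 'n \<Rightarrow> real"
  shows "(\<Sum>I | length I = k. \<bar>weak_partial \<Omega> I u x\<bar>) \<le> real (CARD('n) ^ k) * weak_grad_length \<Omega> k u x"
proof -
  have "(\<Sum>I | length I = k. \<bar>weak_partial \<Omega> I u x\<bar>) \<le> (\<Sum>I :: 'n list | length I = k. weak_grad_length \<Omega> k u x)"
  proof (rule sum_mono)
    fix I :: "'n list" assume "I \<in> {I. length I = k}"
    then have "\<bar>weak_partial \<Omega> I u x\<bar> \<le> L2_set (\<lambda>I. \<bar>weak_partial \<Omega> I u x\<bar>) {I. length I = k}"
      by (intro member_le_L2_set) auto
    then show "\<bar>weak_partial \<Omega> I u x\<bar> \<le> weak_grad_length \<Omega> k u x"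
      by (simp add: weak_grad_length_def L2_set_def)
  qed
  also have "\<dots> = real (CARD('n) ^ k) * weak_grad_length \<Omega> k u x"
    using card_lists_length_eq[of "UNIV :: 'n set" k] by simp
  finally show ?thesis .
qed

lemma nn_integral_lebesgue_on:
  fixes f :: "real ^ 'n \<Rightarrow> ennreal"
  assumes "open \<Omega>"
  shows "(\<integral>\<^sup>+ x. f x \<partial>lebesgue_on \<Omega>) = (\<integral>\<^sup>+ x. f x * indicator \<Omega> x \<partial>lebesgue)"
  using assms by (subst nn_integral_restrict_space) auto

text \<open>The domain is covered by finitely many neighbourhoods with a cone of directions each, and
  all these cones are enclosed in one ball of radius \<open>\<rho>\<close>. The function \<open>F\<close> is a Borel
  version of the sum of the absolute values of all weak derivatives of order \<open>m\<close>, extended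
  by zero.\<close>

proposition sobolev_potential_bound:
  fixes \<Omega> :: "(real ^ 'n) set"
  assumes \<Omega>: "bounded_lipschitz_domain \<Omega>" and m: "m \<ge> 1"
  obtains C \<rho> :: real where "C > 0" "\<rho> > 0"
    "\<And>u. weakly_differentiable m \<Omega> u \<Longrightarrow>
      (\<And>I. length I \<le> m \<Longrightarrow> integrable (lebesgue_on \<Omega>) (weak_partial \<Omega> I u)) \<Longrightarrow>
      \<exists>F\<in>borel_measurable borel.
        (AE x in lebesgue. F x \<le> ennreal (indicator \<Omega> x * (real (CARD('n) ^ m) * weak_grad_length \<Omega> m u x))) \<and>
        (AE x in lebesgue. x \<in> \<Omega> \<longrightarrow> ennreal \<bar>u x\<bar> \<le>
          ennreal C * ((\<Sum>k<m. \<integral>\<^sup>+ y. ennreal (weak_grad_length \<Omega> k u y) \<partial>lebesgue_on \<Omega>) +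
            cone_potential (cball 0 \<rho>) m F x))"
proof -
  have op: "open \<Omega>" using \<Omega> by (simp add: bounded_lipschitz_domain_def)
  obtain P r \<kappa> and w0 :: "real ^ 'n \<Rightarrow> real ^ 'n" where P: "finite P" "\<Omega> \<subseteq> (\<Union>p\<in>P. ball p (r p))"
    "\<And>p. p \<in> P \<Longrightarrow> \<kappa> p > 0"
    "\<And>p x w s. p \<in> P \<Longrightarrow> x \<in> \<Omega> \<inter> ball p (r p) \<Longrightarrow> w \<in> cball (w0 p) (\<kappa> p) \<Longrightarrow> 0 \<le> s \<Longrightarrow> s \<le> 1 \<Longrightarrow> x + s *\<^sub>R w \<in> \<Omega>"
    by (rule lipschitz_domain_cone_condition[OF \<Omega>]) blast
  define \<rho> where "\<rho> = 1 + (\<Sum>p\<in>P. norm (w0 p) + \<kappa> p)"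
  have \<rho>: "\<rho> \<ge> 1" unfolding \<rho>_def using P(3) by (simp add: sum_nonneg less_imp_le)
  have sub: "cball (w0 p) (\<kappa> p) \<subseteq> cball 0 \<rho>" if "p \<in> P" for p
  proof
    fix w assume "w \<in> cball (w0 p) (\<kappa> p)"
    then have "norm w \<le> norm (w0 p) + \<kappa> p"
      using norm_triangle_ineq2[of w "w0 p"] by (simp add: dist_norm norm_minus_commute)
    also have "\<dots> \<le> (\<Sum>p\<in>P. norm (w0 p) + \<kappa> p)"
      using P(1) P(3)[THEN less_imp_le] that
      by (intro member_le_sum[of p P "\<lambda>p. norm (w0 p) + \<kappa> p"]) simp_all
    finally show "w \<in> cball 0 \<rho>" by (simp add: \<rho>_def)
  qed
  define \<mu> where "\<mu> p = measure lborel (cball (w0 p) (\<kappa> p))" for p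
  have \<mu>: "emeasure lborel (cball (w0 p) (\<kappa> p)) = ennreal (\<mu> p)" for p
    unfolding \<mu>_def using emeasure_bounded_finite[OF bounded_cball, of "w0 p" "\<kappa> p"]
    by (simp add: emeasure_eq_ennreal_measure less_top)
  have \<mu>0: "\<mu> p > 0" if "p \<in> P" for p
    unfolding \<mu>_def using content_cball_pos[OF P(3)[OF that], of "w0 p"] by simp
  define K where "K = \<rho> ^ m * real (CARD('n) ^ m)"
  have K: "K > 0" using \<rho> by (simp add: K_def)
  define C where "C = 1 + (\<Sum>p\<in>P. inverse (\<mu> p) * K)"
  have Cp: "inverse (\<mu> p) * K \<le> C" if "p \<in> P" for p
    unfolding C_def using P(1) \<mu>0 K that
    by (intro order_trans[OF member_le_sum[of p P "\<lambda>p. inverse (\<mu> p) * K"]]) (auto simp: less_imp_le)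
  have C0: "C > 0" unfolding C_def using \<mu>0 K by (simp add: add_pos_nonneg sum_nonneg less_imp_le)
  show ?thesis
  proof (rule that[OF C0])
    show "\<rho> > 0" using \<rho> by simp
    fix u :: "real ^ 'n \<Rightarrow> real"
    assume u: "weakly_differentiable m \<Omega> u"
      and int: "\<And>I. length I \<le> m \<Longrightarrow> integrable (lebesgue_on \<Omega>) (weak_partial \<Omega> I u)"
    \<comment> \<open>Borel versions of the weak derivatives, extended by zero, are needed for the bound on
      cones. Derivatives of order greater than \<open>m\<close> do not occur there and are replaced by
      zero.\<close>
    have "\<exists>f. integrable lborel f \<and> (length I \<le> m \<longrightarrow> (AE x in lebesgue. indicator \<Omega> x *\<^sub>R weak_partial \<Omega> I u x = f x))" for I
    proof (cases "length I \<le> m")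
      case True
      have "integrable lebesgue (\<lambda>x. indicator \<Omega> x *\<^sub>R weak_partial \<Omega> I u x)"
        using int[OF True] op by (subst (asm) integrable_restrict_space) auto
      then show ?thesis by (rule integrable_lebesgue_borel_version) blast
    qed (auto intro: exI[of _ "\<lambda>_. 0"])
    then obtain f where f: "\<And>I. integrable lborel (f I)"
      and fae: "\<And>I. length I \<le> m \<Longrightarrow> AE x in lebesgue. indicator \<Omega> x *\<^sub>R weak_partial \<Omega> I u x = f I x"
      by metis
    have [measurable]: "f I \<in> borel_measurable borel" for I using f[of I] by auto
    have weak: "(LINT y|lborel. f I y * partial_deriv i \<phi> y) = - (LINT y|lborel. f (I @ [i]) y * \<phi> y)"
      if I: "length I < m" and \<phi>: "test_function \<Omega> \<phi>" for I i \<phi>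
    proof -
      have sm: "smooth \<phi>" using \<phi> by (rule test_functionE)
      have "(LINT y|lborel. f I y * partial_deriv i \<phi> y) = (LINT y|lebesgue_on \<Omega>. weak_partial \<Omega> I u y * partial_deriv i \<phi> y)"
        by (rule integral_borel_version[OF op _ _ int fae])
           (use I smooth_borel[OF smooth_partial_deriv[OF sm]] in auto)
      also have "\<dots> = - (LINT y|lebesgue_on \<Omega>. weak_partial \<Omega> (I @ [i]) u y * \<phi> y)"
        by (rule weak_partial_snoc[OF u I \<phi>])
      also have "(LINT y|lebesgue_on \<Omega>. weak_partial \<Omega> (I @ [i]) u y * \<phi> y) = (LINT y|lborel. f (I @ [i]) y * \<phi> y)"
        by (rule integral_borel_version[OF op _ _ int fae, symmetric])
           (use I smooth_borel[OF sm] in auto)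
      finally show ?thesis .
    qed
    have gm [measurable]: "weak_grad_length \<Omega> k u \<in> borel_measurable (lebesgue_on \<Omega>)" if "k \<le> m" for k
      unfolding weak_grad_length_def L2_set_def
      using int that
      by (intro measurable_compose[OF _ borel_measurable_sqrt] borel_measurable_sum borel_measurable_power) auto
    have g0: "weak_grad_length \<Omega> k u x \<ge> 0" for k x by (simp add: weak_grad_length_def)
    have sumle: "AE x in lebesgue. (\<Sum>I | length I = k. ennreal \<bar>f I x\<bar>) \<le>
        ennreal (indicator \<Omega> x * (real (CARD('n) ^ k) * weak_grad_length \<Omega> k u x))" if k: "k \<le> m" for k
    proof -
      have "AE x in lebesgue. \<forall>I\<in>{I :: 'n list. length I = k}. indicator \<Omega> x *\<^sub>R weak_partial \<Omega> I u x = f I x"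
        using fae k by (intro AE_finite_allI) auto
      then show ?thesis
      proof eventually_elim
        case (elim x)
        then have "(\<Sum>I | length I = k. ennreal \<bar>f I x\<bar>) = ennreal (\<Sum>I | length I = k. \<bar>indicator \<Omega> x *\<^sub>R weak_partial \<Omega> I u x\<bar>)"
          by simp
        also have "(\<Sum>I | length I = k. \<bar>indicator \<Omega> x *\<^sub>R weak_partial \<Omega> I u x\<bar>) =
            indicator \<Omega> x * (\<Sum>I | length I = k. \<bar>weak_partial \<Omega> I u x\<bar>)"
          by (simp add: abs_mult sum_distrib_left)
        also have "\<dots> \<le> indicator \<Omega> x * (real (CARD('n) ^ k) * weak_grad_length \<Omega> k u x)"
          by (intro mult_left_mono sum_weak_partial_le_grad_length) auto
        finally show ?case by (simp add: ennreal_leI)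
      qed
    qed
    have Nle: "(\<Sum>I | length I = k. \<integral>\<^sup>+ y. ennreal \<bar>f I y\<bar> \<partial>lborel) \<le>
        ennreal (real (CARD('n) ^ m)) * (\<integral>\<^sup>+ y. ennreal (weak_grad_length \<Omega> k u y) \<partial>lebesgue_on \<Omega>)" if k: "k \<le> m" for k
    proof -
      have "(\<Sum>I | length I = k. \<integral>\<^sup>+ y. ennreal \<bar>f I y\<bar> \<partial>lborel) = (\<integral>\<^sup>+ y. (\<Sum>I | length I = k. ennreal \<bar>f I y\<bar>) \<partial>lborel)"
        by (subst nn_integral_sum) (simp_all del: sum_ennreal)
      also have "\<dots> = (\<integral>\<^sup>+ y. (\<Sum>I | length I = k. ennreal \<bar>f I y\<bar>) \<partial>lebesgue)"
        by (simp only: nn_integral_completion)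
      also have "\<dots> \<le> (\<integral>\<^sup>+ y. ennreal (indicator \<Omega> y * (real (CARD('n) ^ k) * weak_grad_length \<Omega> k u y)) \<partial>lebesgue)"
        by (rule nn_integral_mono_AE[OF sumle[OF k]])
      also have "\<dots> \<le> (\<integral>\<^sup>+ y. ennreal (real (CARD('n) ^ m)) * ennreal (weak_grad_length \<Omega> k u y) * indicator \<Omega> y \<partial>lebesgue)"
        using k by (intro nn_integral_mono)
          (auto simp: indicator_def g0 simp flip: ennreal_mult intro!: ennreal_leI mult_right_mono power_increasing)
      also have "\<dots> = (\<integral>\<^sup>+ y. ennreal (real (CARD('n) ^ m)) * ennreal (weak_grad_length \<Omega> k u y) \<partial>lebesgue_on \<Omega>)"
        by (rule nn_integral_lebesgue_on[OF op, symmetric])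
      also have "\<dots> = ennreal (real (CARD('n) ^ m)) * (\<integral>\<^sup>+ y. ennreal (weak_grad_length \<Omega> k u y) \<partial>lebesgue_on \<Omega>)"
        using gm[OF k] by (intro nn_integral_cmult) simp
      finally show ?thesis .
    qed
    define F where "F = (\<lambda>y. \<Sum>I | length I = m. ennreal \<bar>f I y\<bar>)"
    let ?N = "\<Sum>k<m. \<integral>\<^sup>+ y. ennreal (weak_grad_length \<Omega> k u y) \<partial>lebesgue_on \<Omega>"
    show "\<exists>F\<in>borel_measurable borel.
        (AE x in lebesgue. F x \<le> ennreal (indicator \<Omega> x * (real (CARD('n) ^ m) * weak_grad_length \<Omega> m u x))) \<and>
        (AE x in lebesgue. x \<in> \<Omega> \<longrightarrow> ennreal \<bar>u x\<bar> \<le> ennreal C * (?N + cone_potential (cball 0 \<rho>) m F x))"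
    proof (intro bexI[of _ F] conjI)
      show "F \<in> borel_measurable borel" unfolding F_def by measurable
      show "AE x in lebesgue. F x \<le> ennreal (indicator \<Omega> x * (real (CARD('n) ^ m) * weak_grad_length \<Omega> m u x))"
        unfolding F_def by (rule sumle) simp
      have "AE x in lebesgue. x \<in> \<Omega> \<inter> ball p (r p) \<longrightarrow> emeasure lborel (cball (w0 p) (\<kappa> p)) * ennreal \<bar>f [] x\<bar> \<le>
          (\<Sum>k<m. ennreal \<rho> ^ k * (\<Sum>I | length I = k. \<integral>\<^sup>+ y. ennreal \<bar>f I y\<bar> \<partial>lborel)) +
          ennreal \<rho> ^ m * cone_potential (cball (w0 p) (\<kappa> p)) m F x" if p: "p \<in> P" for p
        unfolding F_def
      proof (rule AE_completion, rule sobolev_cone_bound[OF op m f weak P(4)[OF p]])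
        show "\<bar>w $ i\<bar> \<le> \<rho>" if "w \<in> cball (w0 p) (\<kappa> p)" for w i
          using sub[OF p] that component_le_norm_cart[of w i] by auto
      qed auto
      then have "AE x in lebesgue. \<forall>p\<in>P. x \<in> \<Omega> \<inter> ball p (r p) \<longrightarrow> emeasure lborel (cball (w0 p) (\<kappa> p)) * ennreal \<bar>f [] x\<bar> \<le>
          (\<Sum>k<m. ennreal \<rho> ^ k * (\<Sum>I | length I = k. \<integral>\<^sup>+ y. ennreal \<bar>f I y\<bar> \<partial>lborel)) +
          ennreal \<rho> ^ m * cone_potential (cball (w0 p) (\<kappa> p)) m F x"
        by (intro AE_finite_allI P) auto
      moreover have "AE x in lebesgue. indicator \<Omega> x *\<^sub>R u x = f [] x"
        using fae[of "[]"] by (simp add: weak_partial_def)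
      ultimately show "AE x in lebesgue. x \<in> \<Omega> \<longrightarrow> ennreal \<bar>u x\<bar> \<le> ennreal C * (?N + cone_potential (cball 0 \<rho>) m F x)"
      proof eventually_elim
        case (elim x)
        show ?case
        proof
          assume x: "x \<in> \<Omega>"
          then obtain p where p: "p \<in> P" "x \<in> ball p (r p)" using P(2) by blast
          have fx: "f [] x = u x" using elim(2) x by simp
          have \<rho>k: "ennreal \<rho> ^ k \<le> ennreal (\<rho> ^ m)" if "k \<le> m" for k
            using \<rho> that by (simp add: ennreal_power power_increasing ennreal_leI)
          have "ennreal (\<mu> p) * ennreal \<bar>u x\<bar> \<le> (\<Sum>k<m. ennreal \<rho> ^ k * (\<Sum>I | length I = k. \<integral>\<^sup>+ y. ennreal \<bar>f I y\<bar> \<partial>lborel)) +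
              ennreal \<rho> ^ m * cone_potential (cball (w0 p) (\<kappa> p)) m F x"
            using elim(1) p x fx \<mu> by auto
          also have "\<dots> \<le> (\<Sum>k<m. ennreal (\<rho> ^ m) * (ennreal (real (CARD('n) ^ m)) * (\<integral>\<^sup>+ y. ennreal (weak_grad_length \<Omega> k u y) \<partial>lebesgue_on \<Omega>))) +
              ennreal (\<rho> ^ m) * (ennreal (real (CARD('n) ^ m)) * cone_potential (cball 0 \<rho>) m F x)"
          proof (intro add_mono sum_mono mult_mono \<rho>k Nle)
            have "cone_potential (cball (w0 p) (\<kappa> p)) m F x \<le> 1 * cone_potential (cball 0 \<rho>) m F x"
              using cone_potential_mono_set[OF sub[OF p(1)]] by simp
            also have "\<dots> \<le> ennreal (real (CARD('n) ^ m)) * cone_potential (cball 0 \<rho>) m F x"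
              by (intro mult_right_mono) (auto simp flip: ennreal_1 intro!: ennreal_leI)
            finally show "cone_potential (cball (w0 p) (\<kappa> p)) m F x \<le> ennreal (real (CARD('n) ^ m)) * cone_potential (cball 0 \<rho>) m F x" .
          qed auto
          also have "\<dots> = ennreal K * (?N + cone_potential (cball 0 \<rho>) m F x)"
            using \<rho> by (simp add: K_def ennreal_mult distrib_left sum_distrib_left mult.assoc)
          finally have le: "ennreal (\<mu> p) * ennreal \<bar>u x\<bar> \<le> ennreal K * (?N + cone_potential (cball 0 \<rho>) m F x)" .
          have "ennreal \<bar>u x\<bar> = ennreal (inverse (\<mu> p)) * (ennreal (\<mu> p) * ennreal \<bar>u x\<bar>)"
            using \<mu>0[OF p(1)] by (simp flip: ennreal_mult)
          also have "\<dots> \<le> ennreal (inverse (\<mu> p)) * (ennreal K * (?N + cone_potential (cball 0 \<rho>) m F x))"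
            by (intro mult_left_mono le) auto
          also have "\<dots> = ennreal (inverse (\<mu> p) * K) * (?N + cone_potential (cball 0 \<rho>) m F x)"
            using K \<mu>0[OF p(1)] by (simp add: ennreal_mult mult.assoc)
          also have "\<dots> \<le> ennreal C * (?N + cone_potential (cball 0 \<rho>) m F x)"
            by (intro mult_right_mono ennreal_leI Cp p) auto
          finally show "ennreal \<bar>u x\<bar> \<le> ennreal C * (?N + cone_potential (cball 0 \<rho>) m F x)" .
        qed
      qed
    qed
  qed
qed

section \<open>Potentials of functions with a bound on height and mass\<close>

lemma cone_potential_le_sup:
  fixes F :: "real ^ 'n \<Rightarrow> ennreal"
  assumes F: "\<And>y. F y \<le> S" and [measurable]: "W \<in> sets borel"
  shows "cone_potential W m F x \<le> emeasure lborel W * S"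
proof -
  have "cone_potential W m F x \<le> (\<integral>\<^sup>+ w. \<integral>\<^sup>+ s. indicator W w * (indicator {0..1::real} s * S) \<partial>lborel \<partial>lborel)"
    unfolding cone_potential_def
  proof (intro nn_integral_mono mult_left_mono)
    fix w :: "real ^ 'n" and s :: real
    show "indicator {0..1} s * ennreal (s ^ (m - 1)) * F (x + s *\<^sub>R w) \<le> indicator {0..1} s * S"
    proof (cases "s \<in> {0..1}")
      case True
      then have "ennreal (s ^ (m - 1)) \<le> 1" by (simp add: power_le_one ennreal_le_1)
      then have "ennreal (s ^ (m - 1)) * F (x + s *\<^sub>R w) \<le> 1 * S" by (intro mult_mono F) auto
      then show ?thesis using True by simp
    qed simp
  qed auto
  also have "\<dots> = emeasure lborel W * S"
    by (simp add: nn_integral_multc nn_integral_cmult)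
  finally show ?thesis .
qed

lemma nn_integral_inverse_square_le:
  assumes "\<tau> > 0"
  shows "(\<integral>\<^sup>+ s. indicator {\<tau>..1} s * ennreal (1 / s ^ 2) \<partial>lborel) \<le> ennreal (1 / \<tau>)"
proof (cases "\<tau> \<le> 1")
  case True
  have "(\<integral>\<^sup>+ s. ennreal (1 / s ^ 2) * indicator {\<tau>..1} s \<partial>lborel) = ennreal (- 1 / 1 - - 1 / \<tau>)"
    by (rule nn_integral_FTC_Icc)
       (use assms True in \<open>auto intro!: derivative_eq_intros simp: power2_eq_square\<close>)
  also have "\<dots> \<le> ennreal (1 / \<tau>)" by (intro ennreal_leI) simp
  finally show ?thesis by (simp add: mult.commute)
qed simp

text \<open>The integral over \<open>s\<close> is split at \<open>\<tau>\<close>. For \<open>s \<le> \<tau>\<close> the bound \<open>F \<le> S\<close> is used, and for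
  \<open>s > \<tau>\<close> dilation invariance bounds the integral of \<open>F (x + s w)\<close> over \<open>w\<close> by \<open>N / s\<^sup>n\<close>.
  With \<open>\<tau>\<^sup>n = N / S\<close> the two contributions balance.\<close>

lemma cone_potential_level_bound:
  fixes F :: "real ^ 'n \<Rightarrow> ennreal" and W :: "(real ^ 'n) set"
  assumes [measurable]: "F \<in> borel_measurable borel" "W \<in> sets borel"
    and S: "\<And>y. F y \<le> S" and N: "(\<integral>\<^sup>+ y. F y \<partial>lborel) \<le> N"
    and m: "1 \<le> m" "m < CARD('n)" and \<tau>: "\<tau> > 0"
  shows "cone_potential W m F x \<le> emeasure lborel W * S * ennreal (\<tau> ^ m) + N * ennreal (\<tau> ^ m / \<tau> ^ CARD('n))"
proof -
  let ?n = "CARD('n)"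
  let ?\<Phi> = "\<lambda>s. \<integral>\<^sup>+ w. indicator W w * F (x + s *\<^sub>R w) \<partial>lborel"
  have "cone_potential W m F x = (\<integral>\<^sup>+ s. \<integral>\<^sup>+ w. indicator W w * (indicator {0..1} s * ennreal (s ^ (m - 1)) * F (x + s *\<^sub>R w)) \<partial>lborel \<partial>lborel)"
    unfolding cone_potential_def by (rule lborel_pair.Fubini') measurable
  also have "\<dots> = (\<integral>\<^sup>+ s. indicator {0..1} s * ennreal (s ^ (m - 1)) * ?\<Phi> s \<partial>lborel)"
    by (intro nn_integral_cong) (subst nn_integral_cmult[symmetric], simp_all add: mult_ac)
  also have "\<dots> \<le> (\<integral>\<^sup>+ s. indicator {0..\<tau>} s * (ennreal (\<tau> ^ (m - 1)) * (emeasure lborel W * S)) +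
      N * ennreal (1 / \<tau> ^ (?n - m - 1)) * (indicator {\<tau>..1} s * ennreal (1 / s ^ 2)) \<partial>lborel)"
  proof (rule nn_integral_mono)
    fix s :: real
    show "indicator {0..1} s * ennreal (s ^ (m - 1)) * ?\<Phi> s \<le> indicator {0..\<tau>} s * (ennreal (\<tau> ^ (m - 1)) * (emeasure lborel W * S)) +
      N * ennreal (1 / \<tau> ^ (?n - m - 1)) * (indicator {\<tau>..1} s * ennreal (1 / s ^ 2))"
    proof (cases "0 \<le> s \<and> s \<le> 1")
      case s: True
      show ?thesis
      proof (cases "s \<le> \<tau>")
        case True
        have "?\<Phi> s \<le> (\<integral>\<^sup>+ w. indicator W w * S \<partial>lborel)"
          by (intro nn_integral_mono mult_left_mono S) auto
        also have "\<dots> = emeasure lborel W * S" by (simp add: nn_integral_multc)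
        finally have "ennreal (s ^ (m - 1)) * ?\<Phi> s \<le> ennreal (\<tau> ^ (m - 1)) * (emeasure lborel W * S)"
          using s True by (intro mult_mono ennreal_leI power_mono) auto
        then show ?thesis using s True by (simp add: add_increasing2)
      next
        case False
        then have sp: "s > 0" and ts: "\<tau> < s" using \<tau> by auto
        have "ennreal (\<bar>s\<bar> ^ ?n) * (\<integral>\<^sup>+ w. F (x + s *\<^sub>R w) \<partial>lborel) \<le> N"
          using nn_integral_dilate[of F s x] N sp by simp
        then have "ennreal (1 / s ^ ?n) * (ennreal (s ^ ?n) * (\<integral>\<^sup>+ w. F (x + s *\<^sub>R w) \<partial>lborel)) \<le> ennreal (1 / s ^ ?n) * N"
          using sp by (intro mult_left_mono) auto
        also have "ennreal (1 / s ^ ?n) * (ennreal (s ^ ?n) * (\<integral>\<^sup>+ w. F (x + s *\<^sub>R w) \<partial>lborel)) = (\<integral>\<^sup>+ w. F (x + s *\<^sub>R w) \<partial>lborel)"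
          using sp by (simp add: mult.assoc[symmetric] flip: ennreal_mult)
        finally have "?\<Phi> s \<le> ennreal (1 / s ^ ?n) * N"
          by (rule order_trans[rotated]) (intro nn_integral_mono, auto simp: indicator_def)
        then have "ennreal (s ^ (m - 1)) * ?\<Phi> s \<le> ennreal (s ^ (m - 1)) * (ennreal (1 / s ^ ?n) * N)"
          by (rule mult_left_mono) simp
        also have "\<dots> = N * ennreal (s ^ (m - 1) / s ^ ?n)"
        proof -
          have "ennreal (s ^ (m - 1)) * ennreal (1 / s ^ ?n) = ennreal (s ^ (m - 1) / s ^ ?n)"
            using sp by (simp flip: ennreal_mult)
          then show ?thesis by (simp only: mult.assoc[symmetric]) (simp only: mult.commute)
        qed
        \<comment> \<open>Since \<open>n - m - 1 \<ge> 0\<close>, this power of \<open>s\<close> is at most \<open>1/s\<^sup>2\<close> times its value at \<open>\<tau>\<close>,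
          and \<open>1/s\<^sup>2\<close> has an elementary antiderivative.\<close>
        also have "s ^ (m - 1) / s ^ ?n = 1 / s ^ (?n - m - 1) * (1 / s ^ 2)"
        proof -
          have "?n = (m - 1) + ((?n - m - 1) + 2)" using m by simp
          then have "s ^ ?n = s ^ (m - 1) * (s ^ (?n - m - 1) * s ^ 2)"
            using arg_cong[of _ _ "\<lambda>k. s ^ k"] by (simp only: power_add[symmetric])
          then show ?thesis using sp by simp
        qed
        also have "ennreal \<dots> \<le> ennreal (1 / \<tau> ^ (?n - m - 1) * (1 / s ^ 2))"
          using sp \<tau> ts by (intro ennreal_leI mult_right_mono divide_left_mono power_mono) auto
        also have "\<dots> = ennreal (1 / \<tau> ^ (?n - m - 1)) * ennreal (1 / s ^ 2)"
          using \<tau> by (intro ennreal_mult') simp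
        finally have "ennreal (s ^ (m - 1)) * ?\<Phi> s \<le> N * (ennreal (1 / \<tau> ^ (?n - m - 1)) * ennreal (1 / s ^ 2))"
          by (simp add: mult_left_mono)
        then show ?thesis using s ts False by (simp add: mult.assoc)
      qed
    qed auto
  qed
  also have "\<dots> = ennreal \<tau> * (ennreal (\<tau> ^ (m - 1)) * (emeasure lborel W * S)) +
      N * ennreal (1 / \<tau> ^ (?n - m - 1)) * (\<integral>\<^sup>+ s. indicator {\<tau>..1} s * ennreal (1 / s ^ 2) \<partial>lborel)"
    using \<tau> by (subst nn_integral_add) (auto simp: nn_integral_multc nn_integral_cmult)
  also have "\<dots> \<le> ennreal \<tau> * (ennreal (\<tau> ^ (m - 1)) * (emeasure lborel W * S)) +
      N * ennreal (1 / \<tau> ^ (?n - m - 1)) * ennreal (1 / \<tau>)"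
    by (intro add_left_mono mult_left_mono nn_integral_inverse_square_le \<tau>) auto
  also have "ennreal \<tau> * (ennreal (\<tau> ^ (m - 1)) * (emeasure lborel W * S)) = emeasure lborel W * S * ennreal (\<tau> ^ m)"
    using \<tau> m by (cases m) (auto simp: ennreal_mult' mult_ac)
  also have "N * ennreal (1 / \<tau> ^ (?n - m - 1)) * ennreal (1 / \<tau>) = N * ennreal (\<tau> ^ m / \<tau> ^ ?n)"
  proof -
    have "?n = m + ((?n - m - 1) + 1)" using m by simp
    then have "\<tau> ^ ?n = \<tau> ^ m * (\<tau> ^ (?n - m - 1) * \<tau>)" by (simp only: power_add[symmetric] power_Suc2[symmetric]) simp
    then have "1 / \<tau> ^ (?n - m - 1) * (1 / \<tau>) = \<tau> ^ m / \<tau> ^ ?n" using \<tau> by simp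
    then show ?thesis using \<tau> by (simp add: mult.assoc flip: ennreal_mult)
  qed
  finally show ?thesis .
qed

section \<open>Rearrangements and the Lorentz--Zygmund norm\<close>

lemma emeasure_ennreal_interval:
  "emeasure lborel {l::real. 0 \<le> l \<and> ennreal l < y} = y"
proof (cases y)
  case (real r)
  then have "{l::real. 0 \<le> l \<and> ennreal l < y} = {0..<r}" by (auto simp: ennreal_less_iff)
  then show ?thesis using real by simp
next
  case top
  have "emeasure lborel {0::real..} = \<infinity>"
  proof (rule ccontr)
    assume "\<not> ?thesis"
    then obtain r where r: "r \<ge> 0" "emeasure lborel {0::real..} = ennreal r"
      by (cases "emeasure lborel {0::real..}") auto
    have "emeasure lborel {0..r + 1} \<le> emeasure lborel {0::real..}" by (intro emeasure_mono) auto
    then show False using r by simp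
  qed
  moreover have "{l::real. 0 \<le> l \<and> ennreal l < y} = {0..}" using top by auto
  ultimately show ?thesis using top by simp
qed

lemma nn_integral_layer_cake:
  fixes b :: "real ^ 'n \<Rightarrow> ennreal"
  assumes [measurable]: "b \<in> borel_measurable borel"
  shows "(\<integral>\<^sup>+ l. indicator {0..} l * emeasure lborel {x. ennreal l < b x} \<partial>lborel) = (\<integral>\<^sup>+ x. b x \<partial>lborel)"
proof -
  have "(\<integral>\<^sup>+ l. indicator {0..} l * emeasure lborel {x. ennreal l < b x} \<partial>lborel) =
      (\<integral>\<^sup>+ l. \<integral>\<^sup>+ x. indicator {0..} l * indicator {x. ennreal l < b x} x \<partial>lborel \<partial>lborel)"
    by (intro nn_integral_cong) (simp add: nn_integral_cmult)
  also have "\<dots> = (\<integral>\<^sup>+ l. \<integral>\<^sup>+ x. (if 0 \<le> l \<and> ennreal l < b x then 1 else 0) \<partial>lborel \<partial>lborel)"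
    by (intro nn_integral_cong) (simp add: indicator_def)
  also have "\<dots> = (\<integral>\<^sup>+ x. \<integral>\<^sup>+ l. (if 0 \<le> l \<and> ennreal l < b x then 1 else 0) \<partial>lborel \<partial>lborel)"
    by (rule lborel_pair.Fubini'[symmetric]) measurable
  also have "\<dots> = (\<integral>\<^sup>+ x. b x \<partial>lborel)"
  proof (rule nn_integral_cong)
    fix x
    have "(\<integral>\<^sup>+ l. (if 0 \<le> l \<and> ennreal l < b x then 1 else 0) \<partial>lborel) =
        (\<integral>\<^sup>+ l. indicator {l. 0 \<le> l \<and> ennreal l < b x} l \<partial>lborel)"
      by (intro nn_integral_cong) (simp add: indicator_def)
    also have "\<dots> = b x"
      by (subst nn_integral_indicator) (auto simp: emeasure_ennreal_interval)
    finally show "(\<integral>\<^sup>+ l. (if 0 \<le> l \<and> ennreal l < b x then 1 else 0) \<partial>lborel) = b x" .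
  qed
  finally show ?thesis .
qed

text \<open>If \<open>u\<close> is bounded by \<open>\<alpha> + b\<close>, then its rearrangement is bounded by \<open>\<alpha>\<close> plus the
  rearrangement of \<open>b\<close>, which has the same integral as \<open>b\<close>.\<close>

lemma max_rearrangement_le:
  fixes u :: "real ^ 'n \<Rightarrow> real" and b :: "real ^ 'n \<Rightarrow> ennreal"
  assumes b [measurable]: "b \<in> borel_measurable borel" and \<alpha>: "\<alpha> \<ge> 0" and t: "t > 0"
    and ub: "AE x in lebesgue. x \<in> \<Omega> \<longrightarrow> ennreal \<bar>u x\<bar> \<le> ennreal \<alpha> + b x"
  shows "max_rearrangement \<Omega> u t \<le> ennreal \<alpha> + (\<integral>\<^sup>+ x. b x \<partial>lborel) / ennreal t"
proof -
  define D where "D l = emeasure lborel {x. ennreal l < b x}" for l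
  have D_eq: "D l = (\<integral>\<^sup>+ x. (if ennreal l < b x then 1 else 0) \<partial>lborel)" for l
  proof -
    have "(\<integral>\<^sup>+ x. (if ennreal l < b x then 1 else 0) \<partial>lborel) = (\<integral>\<^sup>+ x. indicator {x. ennreal l < b x} x \<partial>lborel)"
      by (intro nn_integral_cong) (simp add: indicator_def)
    then show ?thesis by (simp add: D_def)
  qed
  have Dm [measurable]: "D \<in> borel_measurable borel"
    unfolding D_eq[abs_def] by measurable
  have Dmono: "D l' \<le> D l" if "l \<le> l'" for l l'
    unfolding D_def using that
    by (intro emeasure_mono) (auto intro: le_less_trans ennreal_leI)
  have dist: "distribution_fun \<Omega> u (\<alpha> + l) \<le> D l" if l: "l \<ge> 0" for l
  proof -
    have "{x. ennreal l < b x} \<in> sets lborel" by measurable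
    then have "emeasure lebesgue {x. ennreal l < b x} = D l" by (simp add: D_def)
    moreover have "emeasure lebesgue {x \<in> \<Omega>. \<bar>u x\<bar> > \<alpha> + l} \<le> emeasure lebesgue {x. ennreal l < b x}"
    proof (rule emeasure_mono_AE)
      show "{x. ennreal l < b x} \<in> sets lebesgue" by simp
      show "AE x in lebesgue. x \<in> {x \<in> \<Omega>. \<alpha> + l < \<bar>u x\<bar>} \<longrightarrow> x \<in> {x. ennreal l < b x}"
        using ub
      proof eventually_elim
        case (elim x)
        show ?case
        proof
          assume x: "x \<in> {x \<in> \<Omega>. \<alpha> + l < \<bar>u x\<bar>}"
          show "x \<in> {x. ennreal l < b x}"
          proof (rule ccontr)
            assume "x \<notin> {x. ennreal l < b x}"
            then have "ennreal \<bar>u x\<bar> \<le> ennreal \<alpha> + ennreal l"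
              using elim x by (auto simp: not_less intro: order_trans add_left_mono)
            then show False using x \<alpha> l by (simp flip: ennreal_plus)
          qed
        qed
      qed
    qed
    ultimately show ?thesis by (simp add: distribution_fun_def)
  qed
  \<comment> \<open>This is the decreasing rearrangement of \<open>b\<close>, written as the length of the set of levels
    at which the distribution function exceeds \<open>s\<close>. In this form its integral is computed by
    Fubini's theorem.\<close>
  define \<Psi> where "\<Psi> s = (\<integral>\<^sup>+ l. (if 0 \<le> l \<and> ennreal s < D l then 1 else 0) \<partial>lborel)" for s
  have [measurable]: "\<Psi> \<in> borel_measurable borel"
    unfolding \<Psi>_def[abs_def] by measurable
  have rle: "rearrangement \<Omega> u s \<le> ennreal \<alpha> + \<Psi> s" for s
  proof (cases "\<Psi> s = \<infinity>")
    case False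
    then obtain \<psi> where \<psi>: "\<psi> \<ge> 0" "\<Psi> s = ennreal \<psi>" by (cases "\<Psi> s") auto
    have "rearrangement \<Omega> u s \<le> ennreal (\<alpha> + \<psi>)"
    proof (rule ennreal_le_epsilon)
      fix e :: real assume e: "e > 0"
      have "D (\<psi> + e) \<le> ennreal s"
      proof (rule ccontr)
        assume "\<not> D (\<psi> + e) \<le> ennreal s"
        then have "ennreal s < D l" if "l \<le> \<psi> + e" for l
          using Dmono[OF that] by (simp add: not_le)
        then have "(\<integral>\<^sup>+ l. indicator {0..\<psi> + e} l \<partial>lborel) \<le> \<Psi> s"
          unfolding \<Psi>_def by (intro nn_integral_mono) (auto simp: indicator_def)
        then show False using \<psi> e by simp
      qed
      then have "distribution_fun \<Omega> u (\<alpha> + (\<psi> + e)) \<le> ennreal s"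
        using dist[of "\<psi> + e"] \<psi> e by (auto intro: order_trans)
      then have "rearrangement \<Omega> u s \<le> ennreal (\<alpha> + (\<psi> + e))"
        unfolding rearrangement_def using \<alpha> \<psi> e by (intro Inf_lower CollectI exI conjI) (rule refl, simp_all)
      also have "\<dots> = ennreal (\<alpha> + \<psi>) + ennreal e" using \<alpha> \<psi> e by (simp add: add.assoc flip: ennreal_plus)
      finally show "rearrangement \<Omega> u s \<le> ennreal (\<alpha> + \<psi>) + ennreal e" .
    qed
    then show ?thesis using \<psi> \<alpha> by simp
  qed simp
  have "(\<integral>\<^sup>+ s\<in>{0..t}. rearrangement \<Omega> u s \<partial>lborel) \<le> (\<integral>\<^sup>+ s. ennreal \<alpha> * indicator {0..t} s + \<Psi> s * indicator {0..t} s \<partial>lborel)"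
    using rle by (intro nn_integral_mono) (auto simp: indicator_def)
  also have "\<dots> = ennreal \<alpha> * ennreal t + (\<integral>\<^sup>+ s. \<Psi> s * indicator {0..t} s \<partial>lborel)"
    using t by (subst nn_integral_add) (auto simp: nn_integral_cmult)
  also have "(\<integral>\<^sup>+ s. \<Psi> s * indicator {0..t} s \<partial>lborel) = (\<integral>\<^sup>+ s. \<integral>\<^sup>+ l. (if 0 \<le> l \<and> ennreal s < D l then 1 else 0) * indicator {0..t} s \<partial>lborel \<partial>lborel)"
    unfolding \<Psi>_def by (intro nn_integral_cong nn_integral_multc[symmetric]) measurable
  also have "\<dots> = (\<integral>\<^sup>+ l. \<integral>\<^sup>+ s. (if 0 \<le> l \<and> ennreal s < D l then 1 else 0) * indicator {0..t} s \<partial>lborel \<partial>lborel)"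
    by (rule lborel_pair.Fubini'[symmetric]) measurable
  also have "\<dots> \<le> (\<integral>\<^sup>+ l. indicator {0..} l * D l \<partial>lborel)"
  proof (rule nn_integral_mono)
    fix l :: real
    have "(\<integral>\<^sup>+ s. (if 0 \<le> l \<and> ennreal s < D l then 1 else 0) * indicator {0..t} s \<partial>lborel) \<le>
        (\<integral>\<^sup>+ s. indicator {0..} l * indicator {s. 0 \<le> s \<and> ennreal s < D l} s \<partial>lborel)"
      by (intro nn_integral_mono) (auto simp: indicator_def)
    also have "\<dots> = indicator {0..} l * D l"
      by (subst nn_integral_cmult) (auto simp: emeasure_ennreal_interval)
    finally show "(\<integral>\<^sup>+ s. (if 0 \<le> l \<and> ennreal s < D l then 1 else 0) * indicator {0..t} s \<partial>lborel) \<le> indicator {0..} l * D l" .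
  qed
  also have "\<dots> = (\<integral>\<^sup>+ x. b x \<partial>lborel)"
    unfolding D_def by (rule nn_integral_layer_cake[OF b])
  finally have "(\<integral>\<^sup>+ s\<in>{0..t}. rearrangement \<Omega> u s \<partial>lborel) / ennreal t \<le> (ennreal \<alpha> * ennreal t + (\<integral>\<^sup>+ x. b x \<partial>lborel)) / ennreal t"
    by (intro divide_right_mono_ennreal) (simp add: add_left_mono)
  also have "\<dots> = ennreal \<alpha> + (\<integral>\<^sup>+ x. b x \<partial>lborel) / ennreal t"
    using t by (simp add: add_divide_distrib_ennreal mult_divide_eq_ennreal)
  finally show ?thesis by (simp add: max_rearrangement_def)
qed

lemma max_rearrangement_ge:
  fixes u :: "real ^ 'n \<Rightarrow> real"
  assumes u: "u \<in> borel_measurable (lebesgue_on \<Omega>)" and \<Omega>: "\<Omega> \<in> sets lebesgue"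
    and E: "E \<subseteq> \<Omega>" "\<And>x. x \<in> E \<Longrightarrow> \<bar>u x\<bar> \<ge> p" "emeasure lebesgue E > ennreal t" and t: "t > 0"
  shows "max_rearrangement \<Omega> u t \<ge> ennreal p"
proof -
  have r: "rearrangement \<Omega> u s \<ge> ennreal p" if s: "s \<in> {0..t}" for s
    unfolding rearrangement_def
  proof (rule Inf_greatest, clarify)
    fix l assume l: "0 \<le> l" "distribution_fun \<Omega> u l \<le> ennreal s"
    show "ennreal p \<le> ennreal l"
    proof (rule ccontr)
      assume "\<not> ?thesis"
      then have "l < p" by (meson ennreal_leI not_le)
      then have "E \<subseteq> {x \<in> \<Omega>. \<bar>u x\<bar> > l}" using E by force
      moreover have "{x \<in> \<Omega>. \<bar>u x\<bar> > l} \<in> sets lebesgue"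
      proof -
        have "{x \<in> space (lebesgue_on \<Omega>). \<bar>u x\<bar> > l} \<in> sets (lebesgue_on \<Omega>)"
          using u by measurable
        then show ?thesis using \<Omega> by (simp add: sets_restrict_space_iff)
      qed
      ultimately have "emeasure lebesgue E \<le> distribution_fun \<Omega> u l"
        unfolding distribution_fun_def by (rule emeasure_mono)
      also have "\<dots> \<le> ennreal t" using l(2) s by (meson atLeastAtMost_iff ennreal_leI order_trans)
      finally show False using E(3) by simp
    qed
  qed
  have "ennreal p * ennreal t = (\<integral>\<^sup>+ s. ennreal p * indicator {0..t} s \<partial>lborel)"
    using t by (simp add: nn_integral_cmult)
  also have "\<dots> \<le> (\<integral>\<^sup>+ s\<in>{0..t}. rearrangement \<Omega> u s \<partial>lborel)"
    using r by (intro nn_integral_mono) (auto simp: indicator_def)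
  finally have "ennreal p * ennreal t / ennreal t \<le> max_rearrangement \<Omega> u t"
    unfolding max_rearrangement_def by (rule divide_right_mono_ennreal)
  then show ?thesis using t by (simp add: mult_divide_eq_ennreal)
qed

text \<open>The norms of the relevant functions reduce to this integral. The condition \<open>\<gamma> > 1\<close> is what
  makes it converge at \<open>0\<close>.\<close>

lemma nn_integral_log_weight:
  assumes \<gamma>: "\<gamma> > 1" and t0: "0 < t0" "t0 \<le> 1"
  shows "(\<integral>\<^sup>+ t\<in>{0<..<t0}. ennreal ((1 - ln t) powr (- \<gamma>) / t) \<partial>lborel) = ennreal ((1 - ln t0) powr (1 - \<gamma>) / (\<gamma> - 1))"
proof -
  let ?f = "\<lambda>t. (1 - ln t) powr (- \<gamma>) / t"
  let ?F = "\<lambda>t. (1 - ln t) powr (1 - \<gamma>) / (\<gamma> - 1)"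
  have pos: "1 - ln t > 0" if "0 < t" "t < 1" for t :: real
    using that by (simp add: less_le_trans[OF ln_less_zero])
  have D: "(?F has_real_derivative ?f t) (at t)" if "0 < t" "t < t0" for t
  proof -
    have L: "1 - ln t > 0" using pos[of t] that t0 by simp
    have "((\<lambda>t. 1 - ln t) has_real_derivative - (1 / t)) (at t)"
      using that by (auto intro!: derivative_eq_intros)
    from DERIV_cdivide[OF DERIV_chain2[OF has_real_derivative_powr[OF L, of "1 - \<gamma>"] this], of "\<gamma> - 1"]
    show ?thesis
      by (rule DERIV_cong) (use \<gamma> that in \<open>simp add: field_simps\<close>)
  qed
  have c: "isCont ?f t" if "0 < t" "t < t0" for t
    using pos[of t] that t0 by (intro continuous_intros) auto
  have nn: "?f t \<ge> 0" if "0 < t" for t using that by simp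
  have lim0: "(?F \<longlongrightarrow> 0) (at_right 0)"
  proof -
    have "filterlim (\<lambda>t::real. 1 - ln t) at_top (at_right 0)"
    proof -
      have "filterlim (\<lambda>t::real. - ln t) at_top (at_right 0)"
        using ln_at_0 by (simp add: filterlim_uminus_at_top)
      from filterlim_tendsto_add_at_top[OF tendsto_const[of 1] this] show ?thesis by simp
    qed
    then have "((\<lambda>t. (1 - ln t) powr (1 - \<gamma>)) \<longlongrightarrow> 0) (at_right 0)"
      using \<gamma> by (intro tendsto_neg_powr) auto
    then show ?thesis by (intro tendsto_divide_zero)
  qed
  have lim1: "(?F \<longlongrightarrow> ?F t0) (at_left t0)"
  proof -
    have "isCont ?F t0"
      using t0 \<gamma> by (intro continuous_intros) (auto simp: ln_ge_zero_iff dest: ln_le_zero_iff[THEN iffD2])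
    then show ?thesis by (simp add: isCont_def filterlim_at_split)
  qed
  have t0': "ereal 0 < ereal t0" using t0 by simp
  have D': "(?F has_real_derivative ?f t) (at t)" if "ereal 0 < ereal t" "ereal t < ereal t0" for t
    using D that by simp
  have c': "isCont ?f t" if "ereal 0 < ereal t" "ereal t < ereal t0" for t
    using c that by simp
  have nn': "AE t in lborel. ereal 0 < ereal t \<longrightarrow> ereal t < ereal t0 \<longrightarrow> 0 \<le> ?f t"
    using nn by (intro AE_I2) auto
  have lim0': "((?F \<circ> real_of_ereal) \<longlongrightarrow> 0) (at_right (ereal 0))"
    using lim0 by (simp add: ereal_tendsto_simps)
  have lim1': "((?F \<circ> real_of_ereal) \<longlongrightarrow> ?F t0) (at_left (ereal t0))"
    using lim1 by (simp add: ereal_tendsto_simps)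
  note FTC = interval_integral_FTC_nonneg[OF t0' D' c' nn' lim0' lim1']
  have si: "set_integrable lborel (einterval (ereal 0) (ereal t0)) ?f"
    and I: "(LBINT t=ereal 0..ereal t0. ?f t) = ?F t0 - 0"
    by (rule FTC; assumption)+
  have "(\<integral>\<^sup>+ t\<in>{0<..<t0}. ennreal (?f t) \<partial>lborel) = (\<integral>\<^sup>+ t. ennreal (indicator {0<..<t0} t *\<^sub>R ?f t) \<partial>lborel)"
    by (intro nn_integral_cong) (auto simp: indicator_def)
  also have "\<dots> = ennreal (LINT t|lborel. indicator {0<..<t0} t *\<^sub>R ?f t)"
    using si nn by (intro nn_integral_eq_integral) (auto simp: set_integrable_def einterval_eq indicator_def)
  also have "(LINT t|lborel. indicator {0<..<t0} t *\<^sub>R ?f t) = ?F t0"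
    using I t0 by (simp add: interval_lebesgue_integral_def set_lebesgue_integral_def einterval_eq)
  finally show ?thesis .
qed

lemma ennreal_powr_mono: "p \<ge> 0 \<Longrightarrow> x \<le> y \<Longrightarrow> ennreal_powr x p \<le> ennreal_powr y p"
  by (auto simp: ennreal_powr_def top_unique less_top intro!: ennreal_leI powr_mono2 enn2real_mono)

lemma ennreal_powr_ennreal: "x \<ge> 0 \<Longrightarrow> ennreal_powr (ennreal x) p = ennreal (x powr p)"
  by (simp add: ennreal_powr_def)

lemma powr_root_mult:
  fixes M X q :: real
  assumes "M \<ge> 0" "X \<ge> 0" "q > 0"
  shows "(M powr q * X) powr (1 / q) = M * X powr (1 / q)"
proof -
  have "(M powr q * X) powr (1 / q) = (M powr q) powr (1 / q) * X powr (1 / q)"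
    using assms by (simp add: powr_mult)
  also have "(M powr q) powr (1 / q) = M" using assms by (simp add: powr_powr)
  finally show ?thesis .
qed

text \<open>The integrand of the norm is at most a multiple of \<open>(1 - ln t)\<close> to the power \<open>-(1 - \<beta>) q\<close>,
  divided by \<open>t\<close>.\<close>

lemma LZ_norm_le:
  fixes u :: "real ^ 'n \<Rightarrow> real"
  assumes q: "q > 1" and \<beta>: "(1 - \<beta>) * q > 1" and M: "M \<ge> 0"
    and u: "\<And>t. 0 < t \<Longrightarrow> t < 1 \<Longrightarrow> max_rearrangement \<Omega> u t \<le> ennreal (M * (1 - ln t) powr \<beta>)"
  shows "LZ_norm q \<Omega> u \<le> ennreal (M * (1 / ((1 - \<beta>) * q - 1)) powr (1 / q))"
proof -
  let ?\<gamma> = "(1 - \<beta>) * q"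
  have "(\<integral>\<^sup>+ t\<in>{0<..<1}. ennreal_powr (max_rearrangement \<Omega> u t / ennreal (1 - ln t)) q / ennreal t \<partial>lborel)
      \<le> (\<integral>\<^sup>+ t. ennreal (M powr q) * (ennreal ((1 - ln t) powr (- ?\<gamma>) / t) * indicator {0<..<1} t) \<partial>lborel)"
  proof (rule nn_integral_mono)
    fix t :: real
    show "ennreal_powr (max_rearrangement \<Omega> u t / ennreal (1 - ln t)) q / ennreal t * indicator {0<..<1} t \<le>
        ennreal (M powr q) * (ennreal ((1 - ln t) powr (- ?\<gamma>) / t) * indicator {0<..<1} t)"
    proof (cases "t \<in> {0<..<1}")
      case True
      then have t: "0 < t" "t < 1" by auto
      have L: "1 - ln t > 0" using t by (simp add: less_le_trans[OF ln_less_zero])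
      have "max_rearrangement \<Omega> u t / ennreal (1 - ln t) \<le> ennreal (M * (1 - ln t) powr \<beta>) / ennreal (1 - ln t)"
        by (intro divide_right_mono_ennreal u t)
      also have "\<dots> = ennreal (M * (1 - ln t) powr (\<beta> - 1))"
        using L M by (simp add: divide_ennreal powr_diff)
      finally have "ennreal_powr (max_rearrangement \<Omega> u t / ennreal (1 - ln t)) q \<le> ennreal_powr (ennreal (M * (1 - ln t) powr (\<beta> - 1))) q"
        using q by (intro ennreal_powr_mono) auto
      also have "\<dots> = ennreal (M powr q * (1 - ln t) powr (- ?\<gamma>))"
        using M L by (simp add: ennreal_powr_ennreal powr_mult powr_powr algebra_simps)
      finally have "ennreal_powr (max_rearrangement \<Omega> u t / ennreal (1 - ln t)) q / ennreal t \<le> ennreal (M powr q * (1 - ln t) powr (- ?\<gamma>)) / ennreal t"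
        by (rule divide_right_mono_ennreal)
      also have "\<dots> = ennreal (M powr q) * ennreal ((1 - ln t) powr (- ?\<gamma>) / t)"
        using t by (simp add: divide_ennreal flip: ennreal_mult)
      finally show ?thesis using True by simp
    qed simp
  qed
  also have "\<dots> = ennreal (M powr q) * ennreal (1 / (?\<gamma> - 1))"
    using nn_integral_log_weight[OF \<beta>, of 1] by (subst nn_integral_cmult) auto
  also have "\<dots> = ennreal (M powr q * (1 / (?\<gamma> - 1)))"
    using \<beta> by (simp flip: ennreal_mult)
  finally have "LZ_norm q \<Omega> u \<le> ennreal_powr (ennreal (M powr q * (1 / (?\<gamma> - 1)))) (1 / q)"
    unfolding LZ_norm_def using q by (intro ennreal_powr_mono) auto
  also have "\<dots> = ennreal (M * (1 / (?\<gamma> - 1)) powr (1 / q))"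
    using q M \<beta> by (subst ennreal_powr_ennreal, simp, subst powr_root_mult) auto
  finally show ?thesis .
qed

text \<open>Only the interval \<open>(0, t\<^sub>0)\<close> is used. If \<open>u\<close> is at least \<open>p\<close> on a set of measure \<open>t\<^sub>0\<close>, the
  norm is at least of order \<open>p\<close> times a negative power of \<open>1 - ln t\<^sub>0\<close>.\<close>

lemma LZ_norm_ge:
  fixes u :: "real ^ 'n \<Rightarrow> real"
  assumes q: "q > 1" and p: "p \<ge> 0" and t0: "0 < t0" "t0 \<le> 1"
    and u: "\<And>t. 0 < t \<Longrightarrow> t < t0 \<Longrightarrow> max_rearrangement \<Omega> u t \<ge> ennreal p"
  shows "LZ_norm q \<Omega> u \<ge> ennreal (p * ((1 - ln t0) powr (1 - q) / (q - 1)) powr (1 / q))"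
proof -
  have "ennreal (p powr q) * ennreal ((1 - ln t0) powr (1 - q) / (q - 1)) =
      (\<integral>\<^sup>+ t. ennreal (p powr q) * (ennreal ((1 - ln t) powr (- q) / t) * indicator {0<..<t0} t) \<partial>lborel)"
    using nn_integral_log_weight[OF q t0] by (subst nn_integral_cmult) auto
  also have "\<dots> \<le> (\<integral>\<^sup>+ t\<in>{0<..<1}. ennreal_powr (max_rearrangement \<Omega> u t / ennreal (1 - ln t)) q / ennreal t \<partial>lborel)"
  proof (rule nn_integral_mono)
    fix t :: real
    show "ennreal (p powr q) * (ennreal ((1 - ln t) powr (- q) / t) * indicator {0<..<t0} t) \<le>
      ennreal_powr (max_rearrangement \<Omega> u t / ennreal (1 - ln t)) q / ennreal t * indicator {0<..<1} t"
    proof (cases "t \<in> {0<..<t0}")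
      case True
      then have t: "0 < t" "t < 1" "t < t0" using t0 by auto
      have L: "1 - ln t > 0" using t by (simp add: less_le_trans[OF ln_less_zero])
      have "ennreal (p powr q) * ennreal ((1 - ln t) powr (- q) / t) = ennreal ((p / (1 - ln t)) powr q) / ennreal t"
      proof -
        have "(p / (1 - ln t)) powr q / t = p powr q * ((1 - ln t) powr (- q) / t)"
          using p L by (simp add: powr_divide powr_minus_divide)
        then show ?thesis using t p L by (simp add: divide_ennreal flip: ennreal_mult)
      qed
      also have "ennreal ((p / (1 - ln t)) powr q) = ennreal_powr (ennreal p / ennreal (1 - ln t)) q"
        using L p by (simp add: divide_ennreal ennreal_powr_ennreal)
      also have "\<dots> / ennreal t \<le> ennreal_powr (max_rearrangement \<Omega> u t / ennreal (1 - ln t)) q / ennreal t"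
        using q t by (intro divide_right_mono_ennreal ennreal_powr_mono u) auto
      finally show ?thesis using True t by simp
    qed simp
  qed
  finally have "ennreal_powr (ennreal (p powr q * ((1 - ln t0) powr (1 - q) / (q - 1)))) (1 / q) \<le> LZ_norm q \<Omega> u"
    unfolding LZ_norm_def
    by (intro ennreal_powr_mono, use q in simp, subst ennreal_mult'[OF powr_ge_zero])
  also have "ennreal_powr (ennreal (p powr q * ((1 - ln t0) powr (1 - q) / (q - 1)))) (1 / q) =
      ennreal (p * ((1 - ln t0) powr (1 - q) / (q - 1)) powr (1 / q))"
    using q p by (subst ennreal_powr_ennreal, simp, subst powr_root_mult) auto
  finally show ?thesis .
qed

section \<open>Quasi-convex functions with linear pieces\<close>

lemma quasi_convex_mono:
  assumes A: "quasi_convex A" and "s \<le> t" "t < \<infinity>"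
  shows "A s \<le> A t"
proof (cases "s = 0")
  case True
  then show ?thesis using A by (simp add: quasi_convex_def)
next
  case False
  then have s: "0 < s" "s < \<infinity>" and t: "0 < t" "t < \<infinity>" using assms by (auto simp: zero_less_iff_neq_zero)
  have "A s / s \<le> A t / t" using A s assms unfolding quasi_convex_def by blast
  then have "A s / s * s \<le> A t / t * t"
    using assms by (intro mult_mono) auto
  moreover have "x / r * r = x" if "0 < r" "r < \<infinity>" for x r :: ennreal
    using that by (auto simp: ennreal_divide_times intro!: mult_divide_eq_ennreal)
  ultimately show ?thesis using s t by simp
qed

lemma orlicz_norm_less_imp:
  assumes A: "quasi_convex A" and f: "orlicz_norm A \<Omega> f < ennreal l"
  shows "(\<integral>\<^sup>+ x. A (ennreal (\<bar>f x\<bar> / l)) \<partial>lebesgue_on \<Omega>) \<le> 1"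
proof -
  obtain l' where l': "l' > 0" "(\<integral>\<^sup>+ x. A (ennreal (\<bar>f x\<bar> / l')) \<partial>lebesgue_on \<Omega>) \<le> 1" "ennreal l' < ennreal l"
    using f unfolding orlicz_norm_def Inf_less_iff by auto
  then have ll: "l' < l" by (simp add: ennreal_less_iff)
  have "(\<integral>\<^sup>+ x. A (ennreal (\<bar>f x\<bar> / l)) \<partial>lebesgue_on \<Omega>) \<le> (\<integral>\<^sup>+ x. A (ennreal (\<bar>f x\<bar> / l')) \<partial>lebesgue_on \<Omega>)"
    using ll l' by (intro nn_integral_mono quasi_convex_mono[OF A] ennreal_leI divide_left_mono) auto
  with l'(2) show ?thesis by simp
qed

definition step_threshold :: "(nat \<Rightarrow> real) \<Rightarrow> nat \<Rightarrow> real" where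
  "step_threshold S k = (if k = 0 then 0 else S (k - 1))"

text \<open>For nondecreasing \<open>S\<close> and \<open>c\<close>, this is \<open>c\<^sub>k s\<close> for \<open>S\<^sub>k\<^sub>-\<^sub>1 < s \<le> S\<^sub>k\<close>, with \<open>S\<^sub>-\<^sub>1 = 0\<close>. As a
  supremum of functions that are left-continuous and have nondecreasing quotient by \<open>s\<close>, it
  inherits both properties.\<close>

definition step_young :: "(nat \<Rightarrow> real) \<Rightarrow> (nat \<Rightarrow> real) \<Rightarrow> ennreal \<Rightarrow> ennreal" where
  "step_young S c s = (SUP k. if ennreal (step_threshold S k) < s then ennreal (c k) * s else 0)"

lemma step_young_ge: "ennreal (step_threshold S k) < s \<Longrightarrow> ennreal (c k) * s \<le> step_young S c s"
  unfolding step_young_def by (rule SUP_upper2[of k]) auto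

lemma step_young_mono: "s \<le> t \<Longrightarrow> step_young S c s \<le> step_young S c t"
  unfolding step_young_def
  by (rule SUP_subset_mono[OF subset_refl]) (auto intro!: mult_left_mono dest: less_le_trans)

lemma step_young_le:
  assumes "mono S" "mono c" "s \<le> ennreal (S k)"
  shows "step_young S c s \<le> ennreal (c k) * s"
  unfolding step_young_def
proof (rule SUP_least)
  fix j
  show "(if ennreal (step_threshold S j) < s then ennreal (c j) * s else 0) \<le> ennreal (c k) * s"
  proof (cases "j \<le> k")
    case True
    then show ?thesis using monoD[OF assms(2) True] by (auto intro!: mult_right_mono ennreal_leI)
  next
    case False
    then have "S k \<le> step_threshold S j"
      using monoD[OF assms(1), of k "j - 1"] by (auto simp: step_threshold_def)
    then have "\<not> ennreal (step_threshold S j) < s"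
      using assms(3) by (meson ennreal_leI leD le_less_trans order_trans)
    then show ?thesis by simp
  qed
qed

lemma step_young_quasi_convex:
  assumes S: "mono S" "S 0 > 0" and c: "mono c" "c 0 > 0"
  shows "quasi_convex (step_young S c)"
  unfolding quasi_convex_def
proof (intro conjI allI impI)
  fix t :: ennreal assume t: "0 < t"
  show "continuous (at_left t) (step_young S c)"
    unfolding continuous_within
  proof (rule order_tendstoI)
    fix a assume "a < step_young S c t"
    then obtain k where k: "a < (if ennreal (step_threshold S k) < t then ennreal (c k) * t else 0)"
      unfolding step_young_def less_SUP_iff by blast
    then have th: "ennreal (step_threshold S k) < t" and a: "a < ennreal (c k) * t"
      by (auto split: if_splits)
    have "((\<lambda>s. ennreal (c k) * s) \<longlongrightarrow> ennreal (c k) * t) (at_left t)"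
      by (intro ennreal_tendsto_cmult tendsto_ident_at) simp
    then have "eventually (\<lambda>s. a < ennreal (c k) * s) (at_left t)"
      using a by (rule order_tendstoD)
    moreover have "eventually (\<lambda>s. ennreal (step_threshold S k) < s) (at_left t)"
      using th by (rule order_tendstoD(1)[OF tendsto_ident_at])
    ultimately show "eventually (\<lambda>s. a < step_young S c s) (at_left t)"
      by eventually_elim (rule less_le_trans[OF _ step_young_ge])
  next
    fix a assume a: "step_young S c t < a"
    have "eventually (\<lambda>s. s < t) (at_left t)"
      by (simp add: eventually_at_filter)
    then show "eventually (\<lambda>s. step_young S c s < a) (at_left t)"
      by eventually_elim (rule le_less_trans[OF step_young_mono a], simp)
  qed
next
  have "ennreal (c 0) * 1 \<le> step_young S c 1"
    by (rule step_young_ge) (simp add: step_threshold_def)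
  then have "step_young S c 1 > 0" using c by (auto intro: less_le_trans[of 0 "ennreal (c 0)"])
  then show "\<not> (\<forall>t>0. step_young S c t = 0)" by (metis less_irrefl zero_less_one)
next
  have "step_young S c (ennreal (S 0)) \<le> ennreal (c 0) * ennreal (S 0)"
    by (rule step_young_le[OF S(1) c(1)]) simp
  also have "\<dots> < \<infinity>" by (simp add: ennreal_mult_less_top)
  finally show "\<not> (\<forall>t>0. step_young S c t = \<infinity>)" using S(2) by (auto intro!: exI[of _ "ennreal (S 0)"])
next
  show "step_young S c 0 = 0" by (simp add: step_young_def)
next
  fix s t :: ennreal assume st: "0 < s \<and> s \<le> t \<and> t < \<infinity>"
  then have t0: "t \<noteq> 0" "t < \<infinity>" and s0: "s \<noteq> 0" "s < \<infinity>" by (auto simp: zero_less_iff_neq_zero)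
  have "step_young S c s \<le> s * (step_young S c t / t)"
    unfolding step_young_def[of S c s]
  proof (rule SUP_least)
    fix k
    show "(if ennreal (step_threshold S k) < s then ennreal (c k) * s else 0) \<le> s * (step_young S c t / t)"
    proof (cases "ennreal (step_threshold S k) < s")
      case True
      then have "ennreal (c k) * t \<le> step_young S c t"
        using st by (intro step_young_ge) (auto intro: less_le_trans)
      then have "ennreal (c k) * t / t \<le> step_young S c t / t" by (rule divide_right_mono_ennreal)
      then have "ennreal (c k) \<le> step_young S c t / t"
        using t0 by (simp add: mult_divide_eq_ennreal)
      then show ?thesis using True by (simp add: mult.commute mult_left_mono)
    qed simp
  qed
  then have "step_young S c s / s \<le> s * (step_young S c t / t) / s" by (rule divide_right_mono_ennreal)
  also have "\<dots> = step_young S c t / t"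
    using s0 by (simp add: mult.commute[of s] mult_divide_eq_ennreal)
  finally show "step_young S c s / s \<le> step_young S c t / t" .
qed

text \<open>This is the decisive estimate for the embedding. Since the step function is at least
  \<open>c\<^sub>k s\<close> above the \<open>k\<close>-th threshold, the mass of \<open>f\<close> above this threshold is at most
  \<open>1 / c\<^sub>k\<close>. Choose the first threshold \<open>S\<^sub>j\<close> above which this bound is at most \<open>t\<close>; what lies
  above it is \<open>f2\<close>. What lies below it has a bounded potential: the values up to the
  previous threshold are at most a power of the logarithm of \<open>c\<^sub>j\<close> by hypothesis, and the
  values between the two thresholds have height at most \<open>S\<^sub>j\<close> and mass at most \<open>1 / c\<^sub>j\<close>.
  Since \<open>c\<^sub>j < 1 / t\<close>, the logarithm of \<open>c\<^sub>j\<close> is at most that of \<open>1 / t\<close>.\<close>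

lemma step_young_potential_split:
  fixes f :: "real ^ 'n \<Rightarrow> ennreal" and W :: "(real ^ 'n) set"
  assumes m: "1 \<le> m" "m < CARD('n)"
    and S: "mono S" "\<And>k. S k > 0" and c: "\<And>k. c k \<ge> 1" and clim: "filterlim c at_top sequentially"
    and \<beta>: "\<beta> \<ge> 0" and K0: "K0 \<ge> 0"
    and th: "\<And>k. step_threshold S k \<le> K0 * (1 + ln (c k)) powr \<beta>"
    and lev: "\<And>k. S k * (c k * S k) powr (- real m / real CARD('n)) \<le> K0 * (1 + ln (c k)) powr \<beta>"
    and f [measurable]: "f \<in> borel_measurable borel" and B: "(\<integral>\<^sup>+ x. step_young S c (f x) \<partial>lborel) \<le> 1"
    and W [measurable]: "W \<in> sets borel" and w: "emeasure lborel W = ennreal w" "w \<ge> 0"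
    and t: "0 < t" "t < 1"
  obtains f1 f2 where "f1 \<in> borel_measurable borel" "f2 \<in> borel_measurable borel" "\<And>x. f x = f1 x + f2 x"
    "\<And>x. cone_potential W m f1 x \<le> ennreal (2 * (w + 1) * K0 * (1 - ln t) powr \<beta>)"
    "(\<integral>\<^sup>+ x. f2 x \<partial>lborel) \<le> ennreal t"
proof -
  have tail: "(\<integral>\<^sup>+ x. f x * indicator {x. ennreal (step_threshold S k) < f x} x \<partial>lborel) \<le> ennreal (1 / c k)" for k
  proof -
    have ck: "c k > 0" using c[of k] by linarith
    have "(\<integral>\<^sup>+ x. f x * indicator {x. ennreal (step_threshold S k) < f x} x \<partial>lborel) \<le>
        (\<integral>\<^sup>+ x. ennreal (1 / c k) * step_young S c (f x) \<partial>lborel)"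
    proof (rule nn_integral_mono)
      fix x
      show "f x * indicator {x. ennreal (step_threshold S k) < f x} x \<le> ennreal (1 / c k) * step_young S c (f x)"
      proof (cases "ennreal (step_threshold S k) < f x")
        case True
        have "ennreal (1 / c k) * (ennreal (c k) * f x) \<le> ennreal (1 / c k) * step_young S c (f x)"
          by (intro mult_left_mono step_young_ge True) auto
        moreover have "ennreal (1 / c k) * (ennreal (c k) * f x) = f x"
          using ck by (simp add: mult.assoc[symmetric] flip: ennreal_mult)
        ultimately show ?thesis using True by simp
      qed simp
    qed
    also have "\<dots> = ennreal (1 / c k) * (\<integral>\<^sup>+ x. step_young S c (f x) \<partial>lborel)"
    proof (rule nn_integral_cmult)
      have "(\<lambda>x. if ennreal (step_threshold S k) < f x then ennreal (c k) * f x else 0) \<in> borel_measurable borel" for k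
        by measurable
      then show "(\<lambda>x. step_young S c (f x)) \<in> borel_measurable lborel"
        unfolding step_young_def by (intro borel_measurable_SUP) auto
    qed
    also have "\<dots> \<le> ennreal (1 / c k) * 1" by (intro mult_left_mono B) auto
    finally show ?thesis by simp
  qed
  have "eventually (\<lambda>k. c k \<ge> 1 / t) sequentially"
    using clim by (simp add: filterlim_at_top)
  then have ex: "\<exists>k. 1 / t \<le> c k" by (auto simp: eventually_sequentially)
  \<comment> \<open>The least index gives both the mass bound \<open>t\<close> above the threshold and, at the preceding
    index, \<open>c < 1 / t\<close>.\<close>
  define K where "K = (LEAST k. 1 / t \<le> c k)"
  have K: "1 / t \<le> c K" unfolding K_def using ex by (rule LeastI_ex)
  have Kmin: "c k < 1 / t" if "k < K" for k using not_less_Least[of k] that unfolding K_def by force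
  define \<theta> where "\<theta> = ennreal (step_threshold S K)"
  define f1 where "f1 = (\<lambda>x. f x * indicator {x. f x \<le> \<theta>} x)"
  define f2 where "f2 = (\<lambda>x. f x * indicator {x. \<theta> < f x} x)"
  show ?thesis
  proof (rule that[of f1 f2])
    show "f1 \<in> borel_measurable borel" "f2 \<in> borel_measurable borel"
      unfolding f1_def f2_def by measurable
    show "f x = f1 x + f2 x" for x by (auto simp: f1_def f2_def indicator_def)
    have "(\<integral>\<^sup>+ x. f2 x \<partial>lborel) \<le> ennreal (1 / c K)" unfolding f2_def \<theta>_def by (rule tail)
    also have "\<dots> \<le> ennreal t"
    proof (rule ennreal_leI)
      have "c K > 0" using c[of K] by linarith
      then show "1 / c K \<le> t" using K t by (simp add: field_simps)
    qed
    finally show "(\<integral>\<^sup>+ x. f2 x \<partial>lborel) \<le> ennreal t" .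
    fix x
    show "cone_potential W m f1 x \<le> ennreal (2 * (w + 1) * K0 * (1 - ln t) powr \<beta>)"
    proof (cases K)
      case 0
      then have "f1 = (\<lambda>x. 0)" by (auto simp: f1_def \<theta>_def step_threshold_def fun_eq_iff indicator_def)
      then show ?thesis by (simp add: cone_potential_def)
    next
      case (Suc j)
      define \<theta>' where "\<theta>' = ennreal (step_threshold S j)"
      have \<theta>S: "\<theta> = ennreal (S j)" by (simp add: \<theta>_def step_threshold_def Suc)
      define g where "g = (\<lambda>x. f x * indicator {x. f x \<le> \<theta>'} x)"
      define h where "h = (\<lambda>x. f x * indicator {x. \<theta>' < f x \<and> f x \<le> \<theta>} x)"
      have [measurable]: "g \<in> borel_measurable borel" "h \<in> borel_measurable borel"
        unfolding g_def h_def by measurable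
      have cj: "c j \<ge> 1" "c j < 1 / t" using c Kmin Suc by auto
      have L: "(1 + ln (c j)) powr \<beta> \<le> (1 - ln t) powr \<beta>"
      proof (rule powr_mono2)
        have "ln (c j) \<le> ln (1 / t)" using cj t by (subst ln_le_cancel_iff) auto
        then show "1 + ln (c j) \<le> 1 - ln t" using t by (simp add: ln_div)
        show "0 \<le> 1 + ln (c j)" using cj by simp
      qed (rule \<beta>)
      have "f1 x \<le> g x + h x" for x
        by (auto simp: f1_def g_def h_def indicator_def not_less)
      then have "cone_potential W m f1 x \<le> cone_potential W m (\<lambda>x. g x + h x) x"
        by (rule cone_potential_mono)
      also have "\<dots> = cone_potential W m g x + cone_potential W m h x"
        by (rule cone_potential_add) measurable
      also have "cone_potential W m g x \<le> emeasure lborel W * \<theta>'"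
        by (rule cone_potential_le_sup) (auto simp: g_def indicator_def)
      also have "\<dots> \<le> ennreal (w * (K0 * (1 - ln t) powr \<beta>))"
        unfolding w(1) \<theta>'_def
      proof (subst ennreal_mult'[OF w(2)], intro mult_left_mono ennreal_leI)
        show "step_threshold S j \<le> K0 * (1 - ln t) powr \<beta>"
          using th[of j] mult_left_mono[OF L K0] by linarith
      qed simp
      also have "cone_potential W m h x \<le> ennreal ((w + 1) * (K0 * (1 - ln t) powr \<beta>))"
      proof -
        let ?n = "CARD('n)"
        define X where "X = c j * S j"
        have X: "X > 0" using cj S(2)[of j] by (simp add: X_def)
        \<comment> \<open>This is the balancing choice \<open>\<tau>\<^sup>n = N / S\<close> for height \<open>S\<^sub>j\<close> and mass \<open>N = 1 / c\<^sub>j\<close>.\<close>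
        define \<tau> where "\<tau> = X powr (- 1 / real ?n)"
        have \<tau>: "\<tau> > 0" using X by (simp add: \<tau>_def)
        have \<tau>k: "\<tau> ^ k = X powr (- real k / real ?n)" for k
          using X \<tau> by (subst powr_realpow[symmetric]) (simp_all add: \<tau>_def powr_powr)
        have \<tau>n: "\<tau> ^ ?n = 1 / (c j * S j)"
          using X by (simp add: \<tau>k powr_minus_divide flip: X_def)
        have \<tau>m: "\<tau> ^ m = (c j * S j) powr (- real m / real ?n)"
          by (simp add: \<tau>k flip: X_def)
        have "cone_potential W m h x \<le> emeasure lborel W * ennreal (S j) * ennreal (\<tau> ^ m) + ennreal (1 / c j) * ennreal (\<tau> ^ m / \<tau> ^ ?n)"
        proof (rule cone_potential_level_bound[OF _ _ _ _ m \<tau>])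
          show "h y \<le> ennreal (S j)" for y by (auto simp: h_def \<theta>S indicator_def)
          have "(\<integral>\<^sup>+ y. h y \<partial>lborel) \<le> (\<integral>\<^sup>+ x. f x * indicator {x. \<theta>' < f x} x \<partial>lborel)"
            by (intro nn_integral_mono) (auto simp: h_def indicator_def)
          also have "\<dots> \<le> ennreal (1 / c j)" unfolding \<theta>'_def by (rule tail)
          finally show "(\<integral>\<^sup>+ y. h y \<partial>lborel) \<le> ennreal (1 / c j)" .
        qed auto
        also have "\<dots> = ennreal (w * S j * \<tau> ^ m + 1 / c j * (\<tau> ^ m / \<tau> ^ ?n))"
        proof -
          have "ennreal (1 / c j) * ennreal (\<tau> ^ m / \<tau> ^ ?n) = ennreal (1 / c j * (\<tau> ^ m / \<tau> ^ ?n))"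
            using cj by (intro ennreal_mult'[symmetric]) simp
          moreover have "emeasure lborel W * ennreal (S j) * ennreal (\<tau> ^ m) = ennreal (w * S j * \<tau> ^ m)"
            using w S(2)[of j] by (simp add: ennreal_mult')
          ultimately show ?thesis
            using w S(2)[of j] \<tau> cj by (subst ennreal_plus) simp_all
        qed
        also have "w * S j * \<tau> ^ m + 1 / c j * (\<tau> ^ m / \<tau> ^ ?n) = (w + 1) * (S j * \<tau> ^ m)"
          using cj unfolding \<tau>n by (simp add: field_simps)
        also have "ennreal \<dots> \<le> ennreal ((w + 1) * (K0 * (1 - ln t) powr \<beta>))"
          using lev[of j] mult_left_mono[OF L K0] w by (intro ennreal_leI mult_left_mono) (auto simp: \<tau>m)
        finally show ?thesis .
      qed
      finally have "cone_potential W m f1 x \<le> ennreal (w * (K0 * (1 - ln t) powr \<beta>)) + ennreal ((w + 1) * (K0 * (1 - ln t) powr \<beta>))"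
        by (simp add: add_mono)
      also have "\<dots> = ennreal (w * (K0 * (1 - ln t) powr \<beta>) + (w + 1) * (K0 * (1 - ln t) powr \<beta>))"
        using w K0 by (intro ennreal_plus[symmetric]) auto
      also have "\<dots> \<le> ennreal (2 * (w + 1) * K0 * (1 - ln t) powr \<beta>)"
        using K0 by (intro ennreal_leI) (simp add: algebra_simps)
      finally show ?thesis .
    qed
  qed
qed

section \<open>The embedding for functions with linear pieces\<close>

text \<open>On an exhaustion of \<open>\<Omega>\<close> by compact sets, \<open>v\<close> is integrable and hence measurable. The
  restrictions converge to \<open>v\<close> pointwise.\<close>

lemma locally_integrable_measurable:
  fixes v :: "real ^ 'n \<Rightarrow> real"
  assumes \<Omega>: "open \<Omega>" and v: "locally_integrable_on v \<Omega>"
  shows "v \<in> borel_measurable (lebesgue_on \<Omega>)"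
proof -
  obtain C where C: "\<And>n::nat. compact (C n)" "\<And>n. C n \<subseteq> \<Omega>" "\<And>n. C n \<subseteq> interior (C (Suc n))" "\<Union> (range C) = \<Omega>"
    using open_Union_compact_subsets[OF \<Omega>] by metis
  have "incseq C" using C(3) interior_subset by (intro incseq_SucI) blast
  have m: "(\<lambda>x. indicator (C n) x *\<^sub>R v x) \<in> borel_measurable lebesgue" for n
    using v C(1,2) unfolding locally_integrable_on_def set_integrable_def by (metis borel_measurable_integrable)
  have "(\<lambda>x. indicator \<Omega> x *\<^sub>R v x) \<in> borel_measurable lebesgue"
  proof (rule borel_measurable_LIMSEQ_real[OF _ m])
    fix x
    show "(\<lambda>n. indicator (C n) x *\<^sub>R v x) \<longlonglongrightarrow> indicator \<Omega> x *\<^sub>R v x"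
    proof (cases "x \<in> \<Omega>")
      case True
      then obtain N where "x \<in> C N" using C(4) by blast
      then have "x \<in> C n" if "n \<ge> N" for n
        using incseqD[OF \<open>incseq C\<close> that] by blast
      then have "eventually (\<lambda>n. indicator \<Omega> x *\<^sub>R v x = indicator (C n) x *\<^sub>R v x) sequentially"
        using True by (intro eventually_sequentiallyI[of N]) simp
      then show ?thesis by (rule Lim_transform_eventually[OF tendsto_const])
    next
      case False
      then have "x \<notin> C n" for n using C(2) by blast
      then show ?thesis using False by simp
    qed
  qed
  then show ?thesis using \<Omega> by (subst borel_measurable_restrict_space_iff) auto
qed

text \<open>The hypothesis \<open>th\<close> says that consecutive thresholds are far apart, and \<open>lev\<close> bounds the
  potential of a function of height \<open>S\<^sub>k\<close> and mass \<open>1 / c\<^sub>k\<close>. For every \<open>0 < t < 1\<close> these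
  hypotheses yield a splitting of the potential that bounds \<open>\<bar>u\<bar>\<close> into a part bounded by a
  multiple of \<open>(1 - ln t)\<^sup>\<beta>\<close> and a part of mass at most a multiple of \<open>t\<close>. Hence \<open>u\<^sup>*\<^sup>*(t)\<close> is
  at most a multiple of \<open>(1 - ln t)\<^sup>\<beta>\<close>, and the condition on \<open>\<beta>\<close> makes the norm finite.\<close>

proposition step_young_embedded:
  fixes \<Omega> :: "(real ^ 'n) set"
  assumes \<Omega>: "bounded_lipschitz_domain \<Omega>"
    and m: "1 \<le> m" "m < CARD('n)"
    and S: "mono S" "\<And>k. S k > 0" and cmono: "mono c" and c: "\<And>k. c k \<ge> 1" and clim: "filterlim c at_top sequentially"
    and \<beta>: "\<beta> \<ge> 0" "(1 - \<beta>) * (real CARD('n) / real m) > 1" and K0: "K0 \<ge> 0"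
    and th: "\<And>k. step_threshold S k \<le> K0 * (1 + ln (c k)) powr \<beta>"
    and lev: "\<And>k. S k * (c k * S k) powr (- real m / real CARD('n)) \<le> K0 * (1 + ln (c k)) powr \<beta>"
  shows "continuously_embedded
    (orlicz_sobolev_space m (step_young S c) \<Omega>) (orlicz_sobolev_norm m (step_young S c) \<Omega>)
    (LZ_space (real CARD('n) / real m) \<Omega>) (LZ_norm (real CARD('n) / real m) \<Omega>)"
proof -
  let ?n = "CARD('n)"
  let ?q = "real ?n / real m"
  let ?B = "step_young S c"
  have q: "?q > 1" using m by simp
  have op: "open \<Omega>" using \<Omega> by (simp add: bounded_lipschitz_domain_def)
  have c0: "c 0 > 0" using c[of 0] by linarith
  have qc: "quasi_convex ?B" by (rule step_young_quasi_convex[OF S(1) S(2) cmono c0])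
  obtain C \<rho> where C: "C > 0" "\<rho> > 0"
    and pot: "\<And>u. weakly_differentiable m \<Omega> u \<Longrightarrow>
      (\<And>I. length I \<le> m \<Longrightarrow> integrable (lebesgue_on \<Omega>) (weak_partial \<Omega> I u)) \<Longrightarrow>
      \<exists>F\<in>borel_measurable borel.
        (AE x in lebesgue. F x \<le> ennreal (indicator \<Omega> x * (real (?n ^ m) * weak_grad_length \<Omega> m u x))) \<and>
        (AE x in lebesgue. x \<in> \<Omega> \<longrightarrow> ennreal \<bar>u x\<bar> \<le>
          ennreal C * ((\<Sum>k<m. \<integral>\<^sup>+ y. ennreal (weak_grad_length \<Omega> k u y) \<partial>lebesgue_on \<Omega>) +
            cone_potential (cball 0 \<rho>) m F x))"
    using sobolev_potential_bound[OF \<Omega> m(1)] by blast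
  define W where "W = cball (0 :: real ^ 'n) \<rho>"
  have W [measurable]: "W \<in> sets borel" by (simp add: W_def)
  define w where "w = measure lborel W"
  have w: "emeasure lborel W = ennreal w" "w \<ge> 0"
    using emeasure_bounded_finite[OF bounded_cball, of "0 :: real ^ 'n" \<rho>]
    by (simp_all add: w_def W_def emeasure_eq_ennreal_measure less_top)
  define a where "a = real (?n ^ m)"
  have a: "a > 0" by (simp add: a_def)
  define M where "M = C * (real m / c 0 + a * (2 * (w + 1) * K0) + a * w)"
  have M: "M \<ge> 0" using C a w K0 c0 by (simp add: M_def)
  define K1 where "K1 = (1 / ((1 - \<beta>) * ?q - 1)) powr (1 / ?q)"
  have K1: "K1 \<ge> 0" by (simp add: K1_def)
  \<comment> \<open>The norm bound is first proved with any \<open>l\<close> above the Orlicz norms of the derivatives,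
    so that the modulars at scale \<open>l\<close> are at most one.\<close>
  have key: "LZ_norm ?q \<Omega> u \<le> ennreal (l * (M * K1))"
    if u: "u \<in> orlicz_sobolev_space m ?B \<Omega>" and l: "l > 0" "\<And>k. k \<le> m \<Longrightarrow> orlicz_norm ?B \<Omega> (weak_grad_length \<Omega> k u) < ennreal l" for u l
  proof -
    let ?g = "\<lambda>k. weak_grad_length \<Omega> k u"
    have wd: "weakly_differentiable m \<Omega> u" using u by (simp add: orlicz_sobolev_space_def)
    have g0: "?g k x \<ge> 0" for k x by (simp add: weak_grad_length_def)
    have gm [measurable]: "?g k \<in> borel_measurable (lebesgue_on \<Omega>)" if "k \<le> m" for k
      using u that by (auto simp: orlicz_sobolev_space_def orlicz_space_def)
    have gB: "(\<integral>\<^sup>+ x. ?B (ennreal (?g k x / l)) \<partial>lebesgue_on \<Omega>) \<le> 1" if k: "k \<le> m" for k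
      using orlicz_norm_less_imp[OF qc l(2)[OF k]] by (simp add: g0)
    have gL1: "(\<integral>\<^sup>+ x. ennreal (?g k x) \<partial>lebesgue_on \<Omega>) \<le> ennreal (l / c 0)" if k: "k \<le> m" for k
    proof -
      have "(\<integral>\<^sup>+ x. ennreal (?g k x) \<partial>lebesgue_on \<Omega>) = (\<integral>\<^sup>+ x. ennreal (l / c 0) * (ennreal (c 0) * ennreal (?g k x / l)) \<partial>lebesgue_on \<Omega>)"
        using l(1) c0 by (intro nn_integral_cong) (simp add: g0 flip: ennreal_mult)
      also have "\<dots> = ennreal (l / c 0) * (\<integral>\<^sup>+ x. ennreal (c 0) * ennreal (?g k x / l) \<partial>lebesgue_on \<Omega>)"
        using gm[OF k] by (intro nn_integral_cmult) auto
      also have "(\<integral>\<^sup>+ x. ennreal (c 0) * ennreal (?g k x / l) \<partial>lebesgue_on \<Omega>) \<le> (\<integral>\<^sup>+ x. ?B (ennreal (?g k x / l)) \<partial>lebesgue_on \<Omega>)"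
      proof (rule nn_integral_mono)
        fix x
        show "ennreal (c 0) * ennreal (?g k x / l) \<le> ?B (ennreal (?g k x / l))"
        proof (cases "?g k x / l > 0")
          case True then show ?thesis by (intro step_young_ge) (simp add: step_threshold_def)
        next
          case False then show ?thesis by (simp add: ennreal_neg)
        qed
      qed
      also have "\<dots> \<le> 1" by (rule gB[OF k])
      finally show ?thesis by (simp add: mult_left_mono)
    qed
    have int: "integrable (lebesgue_on \<Omega>) (weak_partial \<Omega> I u)" if I: "length I \<le> m" for I
    proof -
      have "locally_integrable_on (weak_partial \<Omega> I u) \<Omega>"
        using weak_partial_spec[OF wd I] by (simp add: has_weak_partial_def)
      then have meas: "weak_partial \<Omega> I u \<in> borel_measurable (lebesgue_on \<Omega>)"
        by (rule locally_integrable_measurable[OF op])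
      have "(\<integral>\<^sup>+ x. ennreal (norm (weak_partial \<Omega> I u x)) \<partial>lebesgue_on \<Omega>) \<le> (\<integral>\<^sup>+ x. ennreal (?g (length I) x) \<partial>lebesgue_on \<Omega>)"
      proof (intro nn_integral_mono ennreal_leI)
        fix x
        have "\<bar>weak_partial \<Omega> I u x\<bar> \<le> L2_set (\<lambda>I. \<bar>weak_partial \<Omega> I u x\<bar>) {J. length J = length I}"
          by (intro member_le_L2_set) auto
        then show "norm (weak_partial \<Omega> I u x) \<le> ?g (length I) x"
          by (simp add: weak_grad_length_def L2_set_def)
      qed
      also have "\<dots> \<le> ennreal (l / c 0)" by (rule gL1[OF I])
      finally show ?thesis using meas by (intro integrableI_bounded) (auto intro: le_less_trans)
    qed
    obtain F where F [measurable]: "F \<in> borel_measurable borel"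
      and Fle: "AE x in lebesgue. F x \<le> ennreal (indicator \<Omega> x * (a * ?g m x))"
      and uF: "AE x in lebesgue. x \<in> \<Omega> \<longrightarrow> ennreal \<bar>u x\<bar> \<le>
          ennreal C * ((\<Sum>k<m. \<integral>\<^sup>+ y. ennreal (?g k y) \<partial>lebesgue_on \<Omega>) + cone_potential W m F x)"
      using pot[OF wd int] unfolding a_def W_def by blast
    \<comment> \<open>The multiple of \<open>F\<close> that is bounded by \<open>\<bar>\<nabla>\<^sup>mu\<bar> / l\<close> and therefore has modular at most
      one.\<close>
    define f where "f = (\<lambda>x. ennreal (1 / (a * l)) * F x)"
    have [measurable]: "f \<in> borel_measurable borel" unfolding f_def by measurable
    have Ff: "F x = ennreal (a * l) * f x" for x
      using a l by (simp add: f_def mult.assoc[symmetric] flip: ennreal_mult)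
    have "AE x in lebesgue. f x \<le> ennreal (indicator \<Omega> x * (?g m x / l))"
      using Fle
    proof eventually_elim
      case (elim x)
      then have "f x \<le> ennreal (1 / (a * l)) * ennreal (indicator \<Omega> x * (a * ?g m x))"
        unfolding f_def by (intro mult_left_mono) auto
      also have "\<dots> = ennreal (indicator \<Omega> x * (?g m x / l))"
        using a l by (simp add: g0 field_simps flip: ennreal_mult')
      finally show ?case .
    qed
    then have "AE x in lebesgue. ?B (f x) \<le> ?B (ennreal (?g m x / l)) * indicator \<Omega> x"
    proof eventually_elim
      case (elim x)
      then have "?B (f x) \<le> ?B (ennreal (indicator \<Omega> x * (?g m x / l)))" by (rule step_young_mono)
      also have "\<dots> = ?B (ennreal (?g m x / l)) * indicator \<Omega> x"
        using qc by (simp add: indicator_def quasi_convex_def)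
      finally show ?case .
    qed
    then have "(\<integral>\<^sup>+ x. ?B (f x) \<partial>lebesgue) \<le> (\<integral>\<^sup>+ x. ?B (ennreal (?g m x / l)) * indicator \<Omega> x \<partial>lebesgue)"
      by (rule nn_integral_mono_AE)
    also have "\<dots> = (\<integral>\<^sup>+ x. ?B (ennreal (?g m x / l)) \<partial>lebesgue_on \<Omega>)"
      by (rule nn_integral_lebesgue_on[OF op, symmetric])
    also have "\<dots> \<le> 1" by (rule gB) simp
    finally have fB: "(\<integral>\<^sup>+ x. ?B (f x) \<partial>lborel) \<le> 1" by (simp add: nn_integral_completion)
    have "LZ_norm ?q \<Omega> u \<le> ennreal ((l * M) * (1 / ((1 - \<beta>) * ?q - 1)) powr (1 / ?q))"
    proof (rule LZ_norm_le[OF q \<beta>(2)])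
      fix t :: real assume t: "0 < t" "t < 1"
      have ln1: "1 - ln t \<ge> 1" using t by simp
      then have L1: "(1 - ln t) powr \<beta> \<ge> 1" using \<beta>(1) by (simp add: ge_one_powr_ge_zero)
      let ?X = "(1 - ln t) powr \<beta>"
      obtain f1 f2 where f12 [measurable]: "f1 \<in> borel_measurable borel" "f2 \<in> borel_measurable borel"
        and f: "\<And>x. f x = f1 x + f2 x"
        and b1: "\<And>x. cone_potential W m f1 x \<le> ennreal (2 * (w + 1) * K0 * ?X)"
        and b2: "(\<integral>\<^sup>+ x. f2 x \<partial>lborel) \<le> ennreal t"
        using step_young_potential_split[OF m S c clim \<beta>(1) K0 th lev _ fB W w t] by auto
      \<comment> \<open>\<open>\<bar>u\<bar> \<le> \<alpha> + b\<close>: the constant \<open>\<alpha>\<close> collects the \<open>L\<^sup>1\<close> norms and the potential of the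
        part \<open>f1\<close>, and \<open>b\<close> is the potential of \<open>f2\<close>, with mass at most a multiple of \<open>t\<close>.\<close>
      define \<alpha> where "\<alpha> = C * (real m * (l / c 0) + a * l * (2 * (w + 1) * K0 * ?X))"
      define b where "b = (\<lambda>x. ennreal (C * (a * l)) * cone_potential W m f2 x)"
      have [measurable]: "b \<in> borel_measurable borel" unfolding b_def by measurable
      have \<alpha>0: "\<alpha> \<ge> 0" using C a l w K0 c0 by (simp add: \<alpha>_def)
      have ub: "AE x in lebesgue. x \<in> \<Omega> \<longrightarrow> ennreal \<bar>u x\<bar> \<le> ennreal \<alpha> + b x"
        using uF
      proof eventually_elim
        case (elim x)
        show ?case
        proof
          assume x: "x \<in> \<Omega>"
          have N: "(\<Sum>k<m. \<integral>\<^sup>+ y. ennreal (?g k y) \<partial>lebesgue_on \<Omega>) \<le> ennreal (real m * (l / c 0))"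
          proof -
            have "(\<Sum>k<m. \<integral>\<^sup>+ y. ennreal (?g k y) \<partial>lebesgue_on \<Omega>) \<le> (\<Sum>k<m. ennreal (l / c 0))"
              by (intro sum_mono gL1) simp
            also have "\<dots> = ennreal (real m * (l / c 0))"
              using l c0 by (subst ennreal_mult) (auto simp: ennreal_of_nat_eq_real_of_nat)
            finally show ?thesis .
          qed
          have "cone_potential W m F x = ennreal (a * l) * cone_potential W m f x"
            unfolding Ff[abs_def] by (rule cone_potential_cmult) measurable
          also have "cone_potential W m f x = cone_potential W m f1 x + cone_potential W m f2 x"
            unfolding f[abs_def] by (rule cone_potential_add) measurable
          finally have cF: "cone_potential W m F x = ennreal (a * l) * (cone_potential W m f1 x + cone_potential W m f2 x)" .
          have "ennreal \<bar>u x\<bar> \<le> ennreal C * ((\<Sum>k<m. \<integral>\<^sup>+ y. ennreal (?g k y) \<partial>lebesgue_on \<Omega>) + cone_potential W m F x)"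
            using elim x by blast
          also have "\<dots> \<le> ennreal C * (ennreal (real m * (l / c 0)) + ennreal (a * l) * (ennreal (2 * (w + 1) * K0 * ?X) + cone_potential W m f2 x))"
            unfolding cF by (intro mult_left_mono add_mono N b1) auto
          also have "\<dots> = ennreal \<alpha> + b x"
          proof -
            have "ennreal \<alpha> = ennreal C * (ennreal (real m * (l / c 0)) + ennreal (a * l) * ennreal (2 * (w + 1) * K0 * ?X))"
              unfolding \<alpha>_def using C a l w K0 c0
              by (subst ennreal_mult, simp, simp, subst ennreal_plus, simp, simp, subst ennreal_mult) auto
            then show ?thesis
              unfolding b_def using C a l by (simp add: distrib_left ennreal_mult add.assoc mult.assoc)
          qed
          finally show "ennreal \<bar>u x\<bar> \<le> ennreal \<alpha> + b x" .
        qed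
      qed
      have "max_rearrangement \<Omega> u t \<le> ennreal \<alpha> + (\<integral>\<^sup>+ x. b x \<partial>lborel) / ennreal t"
        by (rule max_rearrangement_le[OF _ \<alpha>0 t(1) ub]) simp
      also have "(\<integral>\<^sup>+ x. b x \<partial>lborel) / ennreal t \<le> ennreal (C * (a * l) * w * t) / ennreal t"
      proof (rule divide_right_mono_ennreal)
        have "(\<integral>\<^sup>+ x. b x \<partial>lborel) = ennreal (C * (a * l)) * (\<integral>\<^sup>+ x. cone_potential W m f2 x \<partial>lborel)"
          unfolding b_def by (rule nn_integral_cmult) simp
        also have "\<dots> \<le> ennreal (C * (a * l)) * (emeasure lborel W * (\<integral>\<^sup>+ x. f2 x \<partial>lborel))"
          by (intro mult_left_mono nn_integral_cone_potential_le) auto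
        also have "\<dots> \<le> ennreal (C * (a * l)) * (ennreal w * ennreal t)"
          unfolding w(1) by (intro mult_left_mono b2) auto
        also have "\<dots> = ennreal (C * (a * l) * w * t)"
          using C a l w t by (simp add: ennreal_mult mult.assoc)
        finally show "(\<integral>\<^sup>+ x. b x \<partial>lborel) \<le> ennreal (C * (a * l) * w * t)" .
      qed
      also have "ennreal (C * (a * l) * w * t) / ennreal t = ennreal (C * (a * l) * w)"
        using C a l w t by (subst divide_ennreal) auto
      finally have "max_rearrangement \<Omega> u t \<le> ennreal \<alpha> + ennreal (C * (a * l) * w)"
        by (simp add: add_left_mono)
      also have "\<dots> = ennreal (\<alpha> + C * (a * l) * w)"
        using \<alpha>0 C a l w by simp
      also have "\<dots> \<le> ennreal (l * M * ?X)"
      proof (rule ennreal_leI)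
        have "C * (real m * (l / c 0)) \<le> C * (real m * (l / c 0)) * ?X"
          "C * (a * l) * w \<le> C * (a * l) * w * ?X"
          using mult_left_mono[OF L1, of "C * (real m * (l / c 0))"] mult_left_mono[OF L1, of "C * (a * l) * w"]
            C a l w c0 by simp_all
        then show "\<alpha> + C * (a * l) * w \<le> l * M * ?X"
          by (simp add: \<alpha>_def M_def algebra_simps)
      qed
      finally show "max_rearrangement \<Omega> u t \<le> ennreal (l * M * ?X)" .
    qed (use l M in simp)
    then show ?thesis by (simp add: K1_def mult.assoc)
  qed
  \<comment> \<open>The summand \<open>1\<close> makes the embedding constant positive.\<close>
  have bound: "LZ_norm ?q \<Omega> u \<le> ennreal (M * K1 + 1) * orlicz_sobolev_norm m ?B \<Omega> u"
    and fin: "orlicz_sobolev_norm m ?B \<Omega> u < \<infinity>" if u: "u \<in> orlicz_sobolev_space m ?B \<Omega>" for u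
  proof -
    let ?N = "orlicz_sobolev_norm m ?B \<Omega> u"
    show fin: "?N < \<infinity>"
      using u by (simp add: orlicz_sobolev_norm_def orlicz_sobolev_space_def orlicz_space_def)
    then obtain x where x: "x \<ge> 0" "?N = ennreal x" by (cases ?N) auto
    have nk: "orlicz_norm ?B \<Omega> (weak_grad_length \<Omega> k u) \<le> ?N" if "k \<le> m" for k
      unfolding orlicz_sobolev_norm_def using that by (intro member_le_sum) auto
    have "LZ_norm ?q \<Omega> u \<le> ennreal (x * (M * K1))"
    proof (rule ennreal_le_epsilon)
      fix e :: real assume e: "e > 0"
      \<comment> \<open>The bound \<open>key\<close> requires \<open>l\<close> to be strictly above the norms, which may be zero;
        therefore \<open>l\<close> exceeds the Sobolev norm by an arbitrarily small amount.\<close>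
      define e' where "e' = e / (M * K1 + 1)"
      have MK: "M * K1 \<ge> 0" using M K1 by simp
      have e': "e' > 0" using e MK by (simp add: e'_def)
      have "LZ_norm ?q \<Omega> u \<le> ennreal ((x + e') * (M * K1))"
      proof (rule key[OF u])
        show "orlicz_norm ?B \<Omega> (weak_grad_length \<Omega> k u) < ennreal (x + e')" if "k \<le> m" for k
          using nk[OF that] x e' by (auto simp: ennreal_less_iff intro: le_less_trans)
      qed (use x e' in simp)
      also have "\<dots> \<le> ennreal (x * (M * K1) + e)"
      proof (rule ennreal_leI)
        have "e' * (M * K1) \<le> e' * (M * K1 + 1)" using e' by simp
        also have "\<dots> = e" using MK by (simp add: e'_def)
        finally show "(x + e') * (M * K1) \<le> x * (M * K1) + e" by (simp add: distrib_right)
      qed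
      also have "\<dots> = ennreal (x * (M * K1)) + ennreal e"
        using x MK e by (intro ennreal_plus) auto
      finally show "LZ_norm ?q \<Omega> u \<le> ennreal (x * (M * K1)) + ennreal e" .
    qed
    also have "\<dots> \<le> ennreal ((M * K1 + 1) * x)"
      using x by (intro ennreal_leI) (simp add: algebra_simps)
    also have "\<dots> = ennreal (M * K1 + 1) * ?N"
      using x M K1 by (simp add: ennreal_mult)
    finally show "LZ_norm ?q \<Omega> u \<le> ennreal (M * K1 + 1) * ?N" .
  qed
  show ?thesis
    unfolding continuously_embedded_def
  proof (intro conjI exI[of _ "M * K1 + 1"] subsetI ballI bound)
    fix u assume u: "u \<in> orlicz_sobolev_space m ?B \<Omega>"
    have "ennreal (M * K1 + 1) * orlicz_sobolev_norm m ?B \<Omega> u < \<infinity>"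
      using fin[OF u] by (simp add: ennreal_mult_less_top)
    then have "LZ_norm ?q \<Omega> u < \<infinity>" using bound[OF u] by (rule le_less_trans[rotated])
    then show "u \<in> LZ_space ?q \<Omega>"
      using u by (simp add: LZ_space_def orlicz_sobolev_space_def)
  qed (use M K1 in \<open>simp_all add: add_nonneg_pos\<close>)
qed

section \<open>Orlicz and Sobolev norms of sums of dyadic bumps\<close>

lemma finite_lists_upto [simp]: "finite {I :: 'n :: finite list. length I \<le> m}"
  using finite_lists_length_le[of "UNIV :: 'n set" m] by simp

text \<open>The function \<open>u M\<close> is the sum of the bumps \<open>\<psi>(2\<^sup>j(x - x\<^sub>0) / r)\<close> for \<open>M \<le> j \<le> 2M\<close>. Each
  differentiation costs a factor \<open>2\<^sup>j / r\<close> in the \<open>j\<close>-th bump, which is supported in the ball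
  of radius \<open>r / 2\<^sup>j\<close>. Near \<open>x\<^sub>0\<close>, all \<open>M + 1\<close> bumps are bounded below.\<close>

lemma multiscale_bump:
  fixes \<Omega> :: "(real ^ 'n) set"
  assumes \<Omega>: "open \<Omega>" and x0: "x0 \<in> \<Omega>"
  obtains u :: "nat \<Rightarrow> real ^ 'n \<Rightarrow> real" and r \<rho> p D :: real where
    "0 < r" "0 < \<rho>" "0 < p" "0 < D" "ball x0 \<rho> \<subseteq> \<Omega>"
    "\<And>M. test_function \<Omega> (u M)"
    "\<And>M J x. length J \<le> m \<Longrightarrow> \<bar>partial_derivs J (u M) x\<bar> \<le> D * (\<Sum>j | j \<in> {M..2 * M} \<and> dist x0 x \<le> r / 2 ^ j. 2 ^ (j * m))"
    "\<And>M x. dist x0 x < \<rho> / 4 ^ M \<Longrightarrow> p * real (M + 1) \<le> u M x"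
proof -
  obtain e where e: "e > 0" "cball x0 e \<subseteq> \<Omega>"
    using \<Omega> x0 unfolding open_contains_cball by meson
  \<comment> \<open>The bound \<open>r \<le> 1\<close> makes all scaling factors at least one, so derivatives of lower order
    satisfy the bound for order \<open>m\<close>.\<close>
  define r where "r = min e 1"
  have r: "r > 0" "r \<le> 1" "cball x0 r \<subseteq> \<Omega>" using e by (auto simp: r_def)
  obtain \<psi> :: "real ^ 'n \<Rightarrow> real" where \<psi>: "smooth \<psi>" "\<And>x. \<psi> x \<ge> 0" "\<And>x. norm x \<ge> 1 \<Longrightarrow> \<psi> x = 0" "\<psi> 0 > 0"
    using smooth_bump_exists by blast
  have d0: "partial_derivs J \<psi> x = 0" if "x \<notin> cball 0 1" for J x
    by (rule partial_derivs_eq_0[OF closed_cball _ that]) (use \<psi>(3) in auto)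
  have "\<exists>D>0. \<forall>x. \<bar>partial_derivs J \<psi> x\<bar> \<le> D" for J
  proof -
    have "continuous_on UNIV (partial_derivs J \<psi>)"
      by (rule smooth_continuous[OF smooth_partial_derivs[OF \<psi>(1)]])
    from continuous_compact_support_bounded[OF this compact_cball[of 0 1] d0] show ?thesis by blast
  qed
  then obtain B where B: "\<And>J. B J > 0" "\<And>J x. \<bar>partial_derivs J \<psi> x\<bar> \<le> B J" by metis
  define D where "D = (1 + (\<Sum>J | length J \<le> m. B J)) / r ^ m"
  have Bsum: "B J \<le> 1 + (\<Sum>J | length J \<le> m. B J)" if "length J \<le> m" for J
    using member_le_sum[of J "{J. length J \<le> m}" B] B(1) that by (force simp: less_imp_le)
  have D: "D > 0" unfolding D_def using r(1) B(1) by (simp add: add_pos_nonneg sum_nonneg less_imp_le)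
  define p where "p = \<psi> 0 / 2"
  have p: "p > 0" using \<psi> by (simp add: p_def)
  have "isCont \<psi> 0" using smooth_continuous[OF \<psi>(1), of UNIV] by (simp add: continuous_on_eq_continuous_at)
  then obtain s where s: "s > 0" "\<And>x. dist x 0 < s \<Longrightarrow> dist (\<psi> x) (\<psi> 0) < p"
    using p unfolding continuous_at_eps_delta by (metis dist_norm)
  have ps: "\<psi> x \<ge> p" if "norm x < s" for x
  proof -
    have "\<bar>\<psi> x - \<psi> 0\<bar> < \<psi> 0 / 2" using s(2)[of x] that by (simp add: dist_real_def p_def)
    then show ?thesis unfolding p_def by linarith
  qed
  define \<rho> where "\<rho> = r * min s 1"
  have \<rho>: "\<rho> > 0" "\<rho> \<le> r" "\<rho> \<le> r * s" using r s by (auto simp: \<rho>_def)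
  define sc where "sc j = 2 ^ j / r" for j :: nat
  have sc: "sc j \<ge> 1" "sc j > 0" for j
    using r by (auto simp: sc_def le_divide_eq intro: order_trans[OF _ one_le_power])
  define \<phi> where "\<phi> j = (\<lambda>x. 1 * \<psi> (sc j *\<^sub>R x + (- sc j) *\<^sub>R x0))" for j
  have \<phi>s: "smooth (\<phi> j)" for j unfolding \<phi>_def by (rule smooth_affine[OF \<psi>(1)])
  have arg: "sc j *\<^sub>R x + (- sc j) *\<^sub>R x0 = sc j *\<^sub>R (x - x0)" for j x by (simp add: algebra_simps)
  have narg: "norm (sc j *\<^sub>R x + (- sc j) *\<^sub>R x0) = sc j * dist x0 x" for j x
    unfolding arg using sc(2)[of j] by (simp add: dist_norm norm_minus_commute)
  have \<phi>d: "partial_derivs J (\<phi> j) x = sc j ^ length J * partial_derivs J \<psi> (sc j *\<^sub>R x + (- sc j) *\<^sub>R x0)" for J j x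
    unfolding \<phi>_def by (subst partial_derivs_affine[OF \<psi>(1)]) simp
  define u where "u M = (\<lambda>x. \<Sum>j\<in>{M..2 * M}. \<phi> j x)" for M
  show ?thesis
  proof (rule that[OF r(1) \<rho>(1) p D])
    show "ball x0 \<rho> \<subseteq> \<Omega>" using \<rho>(2) r(3) by (meson ball_subset_cball order_trans subset_cball)
  next
    fix M
    show "test_function \<Omega> (u M)"
    proof (rule test_functionI[OF _ compact_cball _ r(3)])
      show "smooth (u M)" unfolding u_def by (intro smooth_sum \<phi>s) simp
      fix x assume "x \<notin> cball x0 r"
      then have x: "dist x0 x > r" by simp
      have "\<phi> j x = 0" for j
      proof -
        have "sc j * dist x0 x \<ge> sc j * r" using x sc(2)[of j] by (intro mult_left_mono) auto
        moreover have "sc j * r \<ge> 1" using r(1) by (simp add: sc_def)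
        ultimately have "norm (sc j *\<^sub>R x + (- sc j) *\<^sub>R x0) \<ge> 1" unfolding narg by linarith
        then show ?thesis unfolding \<phi>_def by (simp only: \<psi>(3))
      qed
      then show "u M x = 0" by (simp add: u_def)
    qed
  next
    fix M J x assume J: "length (J :: 'n list) \<le> m"
    have "partial_derivs J (u M) x = (\<Sum>j\<in>{M..2 * M}. partial_derivs J (\<phi> j) x)"
      unfolding u_def by (subst partial_derivs_sum) (auto intro: \<phi>s)
    also have "\<bar>\<dots>\<bar> \<le> (\<Sum>j\<in>{M..2 * M}. if dist x0 x \<le> r / 2 ^ j then D * 2 ^ (j * m) else 0)"
    proof (intro order_trans[OF sum_abs] sum_mono)
      fix j
      show "\<bar>partial_derivs J (\<phi> j) x\<bar> \<le> (if dist x0 x \<le> r / 2 ^ j then D * 2 ^ (j * m) else 0)"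
      proof (cases "dist x0 x \<le> r / 2 ^ j")
        case True
        have "\<bar>partial_derivs J (\<phi> j) x\<bar> = sc j ^ length J * \<bar>partial_derivs J \<psi> (sc j *\<^sub>R x + (- sc j) *\<^sub>R x0)\<bar>"
          unfolding \<phi>d using sc(2)[of j] by (simp add: abs_mult)
        also have "\<dots> \<le> sc j ^ m * (1 + (\<Sum>J | length J \<le> m. B J))"
          using sc[of j] J Bsum[OF J] B(2)[of J]
          by (intro mult_mono power_increasing) (auto intro: order_trans)
        also have "\<dots> = D * 2 ^ (j * m)"
          by (simp add: D_def sc_def power_divide power_mult mult.commute)
        finally show ?thesis using True by simp
      next
        case False
        then have "sc j * dist x0 x > sc j * (r / 2 ^ j)"
          using sc(2)[of j] by (intro mult_strict_left_mono) auto
        moreover have "sc j * (r / 2 ^ j) = 1" using r(1) by (simp add: sc_def)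
        ultimately have "norm (sc j *\<^sub>R x + (- sc j) *\<^sub>R x0) > 1" unfolding narg by linarith
        then have "sc j *\<^sub>R x + (- sc j) *\<^sub>R x0 \<notin> cball 0 1"
          by (simp only: mem_cball_0 not_le)
        from d0[OF this, of J] have "partial_derivs J (\<phi> j) x = 0"
          unfolding \<phi>d by (simp only: mult_zero_right)
        then show ?thesis using False by simp
      qed
    qed
    also have "\<dots> = D * (\<Sum>j | j \<in> {M..2 * M} \<and> dist x0 x \<le> r / 2 ^ j. 2 ^ (j * m))"
      by (simp add: sum.inter_filter[symmetric] sum_distrib_left Collect_conj_eq)
    finally show "\<bar>partial_derivs J (u M) x\<bar> \<le> D * (\<Sum>j | j \<in> {M..2 * M} \<and> dist x0 x \<le> r / 2 ^ j. 2 ^ (j * m))" .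
  next
    fix M x assume x: "dist x0 x < \<rho> / 4 ^ M"
    have "\<phi> j x \<ge> p" if j: "j \<in> {M..2 * M}" for j
    proof -
      \<comment> \<open>The narrowest bump has scale \<open>2\<^sup>-\<^sup>2\<^sup>M = 4\<^sup>-\<^sup>M\<close>.\<close>
      have "(2::real) ^ j \<le> 2 ^ (2 * M)" using j by (intro power_increasing) auto
      then have 24: "(2::real) ^ j \<le> 4 ^ M" by (simp add: power_mult)
      have "sc j * dist x0 x < sc j * (\<rho> / 4 ^ M)" using x sc(2)[of j] by (intro mult_strict_left_mono) auto
      also have "\<dots> \<le> sc j * (r * s / 2 ^ j)"
        using \<rho> 24 r s sc(2)[of j] by (intro mult_left_mono frac_le) auto
      also have "\<dots> = s" using r(1) by (simp add: sc_def)
      finally have "norm (sc j *\<^sub>R x + (- sc j) *\<^sub>R x0) < s" unfolding narg .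
      from ps[OF this] show ?thesis by (simp add: \<phi>_def)
    qed
    then have "(\<Sum>j\<in>{M..2 * M}. p) \<le> u M x" unfolding u_def by (rule sum_mono)
    then show "p * real (M + 1) \<le> u M x" by (simp add: mult.commute)
  qed
qed

text \<open>The ratio of consecutive terms is \<open>2\<^sup>m \<ge> 2\<close>, so the largest term dominates the sum.\<close>

lemma dyadic_sum_le:
  fixes d r :: real
  assumes m: "m \<ge> 1" and i: "i \<in> {M..N}" "d \<le> r / 2 ^ i" and max: "\<And>j. j \<in> {M..N} \<Longrightarrow> d \<le> r / 2 ^ j \<Longrightarrow> j \<le> i"
  shows "(\<Sum>j | j \<in> {M..N} \<and> d \<le> r / 2 ^ j. (2::real) ^ (j * m)) \<le> 2 * 2 ^ (i * m)"
proof -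
  have "(\<Sum>j | j \<in> {M..N} \<and> d \<le> r / 2 ^ j. (2::real) ^ (j * m)) \<le> (\<Sum>j\<le>i. (2 ^ m) ^ j)"
  proof -
    have "(\<Sum>j | j \<in> {M..N} \<and> d \<le> r / 2 ^ j. (2::real) ^ (j * m)) \<le> (\<Sum>j\<le>i. 2 ^ (j * m))"
      using max by (intro sum_mono2) auto
    then show ?thesis by (simp add: power_mult[symmetric] mult.commute)
  qed
  also have "\<dots> \<le> 2 * (2 ^ m) ^ i"
  proof (induction i)
    case (Suc i)
    have "(2::real) \<le> 2 ^ m" using m by (intro self_le_power) auto
    then have "2 * (2 ^ m) ^ i \<le> (2 ^ m :: real) * (2 ^ m) ^ i" by (intro mult_right_mono) auto
    then show ?case using Suc by (simp only: sum.atMost_Suc power_Suc)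
  qed simp
  also have "(2 ^ m) ^ i = (2::real) ^ (i * m)" by (simp add: power_mult[symmetric] mult.commute)
  finally show ?thesis .
qed

text \<open>The chosen weak derivatives of a test function agree almost everywhere with the classical
  ones, by uniqueness.\<close>

lemma weak_grad_length_test_function_le:
  fixes \<Omega> :: "(real ^ 'n) set"
  assumes \<Omega>: "open \<Omega>" and u: "test_function \<Omega> u"
    and b: "\<And>J x. length J = k \<Longrightarrow> \<bar>partial_derivs J u x\<bar> \<le> b x"
  shows "AE x in lebesgue. x \<in> \<Omega> \<longrightarrow> weak_grad_length \<Omega> k u x \<le> real (CARD('n) ^ k) * b x"
proof -
  have "AE x in lebesgue. x \<in> \<Omega> \<longrightarrow> weak_partial \<Omega> I u x = partial_derivs (rev I) u x" for I
  proof (cases "I = []")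
    case False
    have h: "has_weak_partial \<Omega> I u (partial_derivs (rev I) u)"
      by (rule test_function_has_weak_partial[OF \<Omega> u])
    then have "has_weak_partial \<Omega> I u (weak_partial \<Omega> I u)"
      using False unfolding weak_partial_def by (simp, metis someI_ex)
    from has_weak_partial_unique[OF \<Omega> this h] show ?thesis .
  qed (simp add: weak_partial_def)
  then have "AE x in lebesgue. \<forall>I\<in>{I :: 'n list. length I = k}. x \<in> \<Omega> \<longrightarrow> weak_partial \<Omega> I u x = partial_derivs (rev I) u x"
    by (intro AE_finite_allI) auto
  then show ?thesis
  proof eventually_elim
    case (elim x)
    show ?case
    proof
      assume x: "x \<in> \<Omega>"
      have "weak_grad_length \<Omega> k u x \<le> (\<Sum>I | length I = k. \<bar>weak_partial \<Omega> I u x\<bar>)"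
        unfolding weak_grad_length_def by (rule L2_set_le_sum_abs)
      also have "\<dots> \<le> (\<Sum>I :: 'n list | length I = k. b x)"
        using elim x by (intro sum_mono) (auto intro: b)
      also have "\<dots> = real (CARD('n) ^ k) * b x"
        using card_lists_length_eq[of "UNIV :: 'n set" k] by simp
      finally show "weak_grad_length \<Omega> k u x \<le> real (CARD('n) ^ k) * b x" .
    qed
  qed
qed

lemma test_function_weakly_differentiable:
  assumes "open \<Omega>" "test_function \<Omega> u"
  shows "weakly_differentiable m \<Omega> u"
  unfolding weakly_differentiable_def using test_function_has_weak_partial[OF assms] by blast

lemma borel_measurable_weak_grad_length:
  fixes \<Omega> :: "(real ^ 'n) set"
  assumes "open \<Omega>" "weakly_differentiable m \<Omega> u" "k \<le> m"
  shows "weak_grad_length \<Omega> k u \<in> borel_measurable (lebesgue_on \<Omega>)"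
  unfolding weak_grad_length_def L2_set_def
proof (intro measurable_compose[OF _ borel_measurable_sqrt] borel_measurable_sum borel_measurable_power)
  fix I :: "'n list" assume "I \<in> {I. length I = k}"
  then have "locally_integrable_on (weak_partial \<Omega> I u) \<Omega>"
    using weak_partial_spec[OF assms(2), of I] assms(3) by (simp add: has_weak_partial_def)
  then show "weak_partial \<Omega> I u \<in> borel_measurable (lebesgue_on \<Omega>)"
    by (rule locally_integrable_measurable[OF assms(1)])
qed

text \<open>On the shell between the radii \<open>r / 2\<^sup>i\<^sup>+\<^sup>1\<close> and \<open>r / 2\<^sup>i\<close>, the function \<open>g / l\<close> is at most of
  size \<open>2\<^sup>i\<^sup>m / l\<close>. There the critical power \<open>n/m\<close> of this size is \<open>2\<^sup>i\<^sup>n\<close> up to constants,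
  which cancels against the volume of the ball. Hence each of the \<open>M + 1\<close> scales contributes
  the same amount to the integral of \<open>A\<close>.\<close>

lemma multiscale_orlicz_norm_le:
  fixes \<Omega> :: "(real ^ 'n) set"
  assumes A: "quasi_convex A" and small: "\<And>s. s \<ge> s0 \<Longrightarrow> A (ennreal s) \<le> ennreal (\<epsilon> * s powr (real CARD('n) / real m))"
    and m: "m \<ge> 1" and \<epsilon>: "\<epsilon> > 0" and r: "r > 0" and G: "G > 0" and l: "l > 0"
    and \<Omega>: "open \<Omega>"
    and g: "AE x in lebesgue. x \<in> \<Omega> \<longrightarrow> \<bar>g x\<bar> \<le> G * (\<Sum>j | j \<in> {M..2 * M} \<and> dist x0 x \<le> r / 2 ^ j. 2 ^ (j * m))"
    and big: "s0 \<le> 2 * G * 2 ^ (M * m) / l"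
    and lval: "real (M + 1) * (\<epsilon> * (2 * G / l) powr (real CARD('n) / real m) * (unit_ball_vol (real CARD('n)) * r ^ CARD('n))) \<le> 1"
  shows "orlicz_norm A \<Omega> g \<le> ennreal l"
proof -
  let ?n = "CARD('n)"
  let ?q = "real ?n / real m"
  let ?V = "unit_ball_vol (real ?n) * r ^ ?n"
  have V: "?V \<ge> 0" using r by simp
  let ?h = "\<lambda>x. \<Sum>j | j \<in> {M..2 * M} \<and> dist x0 x \<le> r / 2 ^ j. (2::real) ^ (j * m)"
  let ?a = "\<lambda>j. A (ennreal (2 * G * 2 ^ (j * m) / l))"
  have A0: "A 0 = 0" using A by (simp add: quasi_convex_def)
  \<comment> \<open>Instead of disjoint shells, a sum over nested balls is used: at each point, the largest
    scale among those in reach already majorizes the left-hand side.\<close>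
  have pt: "A (ennreal (G * ?h x / l)) \<le> (\<Sum>j\<in>{M..2 * M}. ?a j * indicator (cball x0 (r / 2 ^ j)) x)" for x
  proof (cases "\<exists>j. j \<in> {M..2 * M} \<and> dist x0 x \<le> r / 2 ^ j")
    case True
    let ?J = "{j. j \<in> {M..2 * M} \<and> dist x0 x \<le> r / 2 ^ j}"
    define i where "i = Max ?J"
    have fin: "finite ?J" by simp
    have i: "i \<in> ?J" unfolding i_def using True by (intro Max_in fin) auto
    have "?h x \<le> 2 * 2 ^ (i * m)"
      by (rule dyadic_sum_le[OF m]) (use i Max_ge[OF fin] in \<open>auto simp: i_def\<close>)
    then have "G * ?h x / l \<le> G * (2 * 2 ^ (i * m)) / l"
      using G l by (intro divide_right_mono mult_left_mono) auto
    then have "A (ennreal (G * ?h x / l)) \<le> ?a i"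
      by (intro quasi_convex_mono[OF A] ennreal_leI) (auto simp: mult_ac)
    also have "\<dots> = ?a i * indicator (cball x0 (r / 2 ^ i)) x" using i by simp
    also have "\<dots> \<le> (\<Sum>j\<in>{M..2 * M}. ?a j * indicator (cball x0 (r / 2 ^ j)) x)"
      using i by (intro member_le_sum) auto
    finally show ?thesis .
  next
    case False
    then have "{j. j \<in> {M..2 * M} \<and> dist x0 x \<le> r / 2 ^ j} = {}" by blast
    then have "?h x = 0" by (simp only: sum.empty)
    then show ?thesis by (simp add: A0)
  qed
  have aj: "?a j * emeasure lebesgue (cball x0 (r / 2 ^ j)) \<le> ennreal (\<epsilon> * (2 * G / l) powr ?q * ?V)" if j: "j \<in> {M..2 * M}" for j
  proof -
    have "(2::real) ^ (M * m) \<le> 2 ^ (j * m)" using j by (intro power_increasing) auto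
    then have "2 * G * 2 ^ (M * m) / l \<le> 2 * G * 2 ^ (j * m) / l"
      using G l by (intro divide_right_mono mult_left_mono) auto
    then have "?a j \<le> ennreal (\<epsilon> * (2 * G * 2 ^ (j * m) / l) powr ?q)"
      using big by (intro small) linarith
    moreover have "(2 * G * 2 ^ (j * m) / l) powr ?q = (2 * G / l) powr ?q * (2 ^ j) ^ ?n"
    proof -
      have "(2 * G * 2 ^ (j * m) / l) powr ?q = (2 * G / l) powr ?q * (2 ^ (j * m)) powr ?q"
        using G l by (subst powr_mult[symmetric]) (auto simp: mult_ac)
      also have "((2::real) ^ (j * m)) powr ?q = 2 powr (real (j * m) * ?q)"
        by (simp only: powr_powr powr_realpow[symmetric] zero_less_numeral)
      also have "real (j * m) * ?q = real (j * ?n)" using m by simp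
      also have "2 powr real (j * ?n) = (2 ^ j) ^ ?n"
        by (simp only: powr_realpow zero_less_numeral power_mult)
      finally show ?thesis .
    qed
    moreover have "emeasure lebesgue (cball x0 (r / 2 ^ j)) = ennreal (unit_ball_vol (real ?n) * (r / 2 ^ j) ^ ?n)"
      using r emeasure_cball[of "r / 2 ^ j" x0] by simp
    ultimately have "?a j * emeasure lebesgue (cball x0 (r / 2 ^ j)) \<le>
        ennreal (\<epsilon> * ((2 * G / l) powr ?q * (2 ^ j) ^ ?n)) * ennreal (unit_ball_vol (real ?n) * (r / 2 ^ j) ^ ?n)"
      by (metis mult_right_mono zero_le)
    also have "\<dots> = ennreal (\<epsilon> * ((2 * G / l) powr ?q * (2 ^ j) ^ ?n) * (unit_ball_vol (real ?n) * (r / 2 ^ j) ^ ?n))"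
      using \<epsilon> by (intro ennreal_mult'[symmetric]) simp
    also have "\<epsilon> * ((2 * G / l) powr ?q * (2 ^ j) ^ ?n) * (unit_ball_vol (real ?n) * (r / 2 ^ j) ^ ?n) = \<epsilon> * (2 * G / l) powr ?q * ?V"
      by (simp add: power_divide)
    finally show ?thesis .
  qed
  have "(\<integral>\<^sup>+ x. A (ennreal (\<bar>g x\<bar> / l)) \<partial>lebesgue_on \<Omega>) = (\<integral>\<^sup>+ x. A (ennreal (\<bar>g x\<bar> / l)) * indicator \<Omega> x \<partial>lebesgue)"
    by (rule nn_integral_lebesgue_on[OF \<Omega>])
  also have "\<dots> \<le> (\<integral>\<^sup>+ x. (\<Sum>j\<in>{M..2 * M}. ?a j * indicator (cball x0 (r / 2 ^ j)) x) \<partial>lebesgue)"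
  proof (rule nn_integral_mono_AE)
    show "AE x in lebesgue. A (ennreal (\<bar>g x\<bar> / l)) * indicator \<Omega> x \<le> (\<Sum>j\<in>{M..2 * M}. ?a j * indicator (cball x0 (r / 2 ^ j)) x)"
      using g
    proof eventually_elim
      case (elim x)
      show ?case
      proof (cases "x \<in> \<Omega>")
        case True
        with elim have "\<bar>g x\<bar> \<le> G * ?h x" by blast
        then have "\<bar>g x\<bar> / l \<le> G * ?h x / l" using l by (intro divide_right_mono) auto
        then have "A (ennreal (\<bar>g x\<bar> / l)) \<le> A (ennreal (G * ?h x / l))"
          by (intro quasi_convex_mono[OF A] ennreal_leI) auto
        then show ?thesis using pt[of x] True by simp
      qed simp
    qed
  qed
  also have "\<dots> = (\<Sum>j\<in>{M..2 * M}. ?a j * emeasure lebesgue (cball x0 (r / 2 ^ j)))"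
  proof -
    have cb: "cball x0 (r / 2 ^ j) \<in> sets lebesgue" for j by simp
    have "(\<integral>\<^sup>+ x. (\<Sum>j\<in>{M..2 * M}. ?a j * indicator (cball x0 (r / 2 ^ j)) x) \<partial>lebesgue) =
        (\<Sum>j\<in>{M..2 * M}. \<integral>\<^sup>+ x. ?a j * indicator (cball x0 (r / 2 ^ j)) x \<partial>lebesgue)"
      by (rule nn_integral_sum) (intro borel_measurable_times_ennreal borel_measurable_const borel_measurable_indicator cb)
    then show ?thesis by (simp only: nn_integral_cmult_indicator[OF cb])
  qed
  also have "\<dots> \<le> (\<Sum>j\<in>{M..2 * M}. ennreal (\<epsilon> * (2 * G / l) powr ?q * ?V))"
    by (intro sum_mono aj)
  also have "\<dots> = ennreal (real (M + 1) * (\<epsilon> * (2 * G / l) powr ?q * ?V))"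
  proof -
    have card: "card {M..2 * M} = M + 1" by simp
    show ?thesis
      by (subst ennreal_mult'[OF of_nat_0_le_iff])
         (simp only: sum_constant card ennreal_of_nat_eq_real_of_nat)
  qed
  also have "\<dots> \<le> 1" using lval by (simp add: ennreal_le_1)
  finally show ?thesis
    unfolding orlicz_norm_def using l by (intro Inf_lower) auto
qed

lemma power2_eventually_dominates:
  fixes a b :: real
  shows "eventually (\<lambda>M. a + b * real M \<le> 2 ^ M) sequentially"
proof -
  have "(\<lambda>M. a * (1 / 2) ^ M + b * (real M * (1 / 2) ^ M)) \<longlonglongrightarrow> a * 0 + b * 0"
    by (intro tendsto_intros LIMSEQ_realpow_zero powser_times_n_limit_0) auto
  then have "eventually (\<lambda>M. a * (1 / 2) ^ M + b * (real M * (1 / 2) ^ M) < 1) sequentially"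
    by (intro order_tendstoD(2)[of _ 0]) auto
  then show ?thesis
  proof eventually_elim
    case (elim M)
    then have "(a + b * real M) * (1 / 2) ^ M < 1" by (simp add: algebra_simps)
    then show ?case by (simp add: power_one_over field_simps)
  qed
qed

text \<open>Otherwise \<open>A(s) \<le> \<epsilon> s\<^sup>q\<close> for all large \<open>s\<close>, with any prescribed \<open>\<epsilon> > 0\<close>. With \<open>N = M + 1\<close>,
  the sum of dyadic bumps then has Sobolev norm at most of order \<open>(\<epsilon> N)\<^sup>1\<^sup>/\<^sup>q\<close> for large \<open>M\<close>,
  with a constant that does not depend on \<open>\<epsilon>\<close>. It is at least of order \<open>N\<close> on a ball of
  measure \<open>t\<^sub>0\<close> with \<open>1 - ln t\<^sub>0\<close> at most of order \<open>N\<close>, so its norm in the target space is at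
  least of order \<open>N \<cdot> N\<^sup>1\<^sup>/\<^sup>q\<^sup>-\<^sup>1 = N\<^sup>1\<^sup>/\<^sup>q\<close>.\<close>

proposition embedded_imp_large:
  fixes \<Omega> :: "(real ^ 'n) set" and A :: "ennreal \<Rightarrow> ennreal"
  assumes \<Omega>: "open \<Omega>" "\<Omega> \<noteq> {}" "emeasure lebesgue \<Omega> = 1" and m: "1 \<le> m" "m < CARD('n)"
    and A: "quasi_convex A"
    and emb: "continuously_embedded
      (orlicz_sobolev_space m A \<Omega>) (orlicz_sobolev_norm m A \<Omega>)
      (LZ_space (real CARD('n) / real m) \<Omega>) (LZ_norm (real CARD('n) / real m) \<Omega>)"
  shows "\<exists>\<epsilon>>0. \<forall>s0. \<exists>s\<ge>s0. A (ennreal s) > ennreal (\<epsilon> * s powr (real CARD('n) / real m))"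
proof (rule ccontr)
  assume "\<not> ?thesis"
  then have small: "\<exists>s0. \<forall>s\<ge>s0. A (ennreal s) \<le> ennreal (\<epsilon> * s powr (real CARD('n) / real m))" if "\<epsilon> > 0" for \<epsilon>
    using that by (meson not_le)
  let ?n = "CARD('n)"
  define q where "q = real ?n / real m"
  have q: "q > 1" using m by (simp add: q_def)
  obtain C where C: "C > 0" "\<And>u. u \<in> orlicz_sobolev_space m A \<Omega> \<Longrightarrow> LZ_norm q \<Omega> u \<le> ennreal C * orlicz_sobolev_norm m A \<Omega> u"
    using emb unfolding continuously_embedded_def q_def by blast
  obtain x0 where x0: "x0 \<in> \<Omega>" using \<Omega> by blast
  obtain u r \<rho> p D where r: "0 < r" and \<rho>: "0 < \<rho>" and p: "0 < p" and D: "0 < D" and sub: "ball x0 \<rho> \<subseteq> \<Omega>"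
    and test: "\<And>M. test_function \<Omega> (u M)"
    and du: "\<And>M J x. length J \<le> m \<Longrightarrow> \<bar>partial_derivs J (u M) x\<bar> \<le> D * (\<Sum>j | j \<in> {M..2 * M} \<and> dist x0 x \<le> r / 2 ^ j. 2 ^ (j * m))"
    and uge: "\<And>M x. dist x0 x < \<rho> / 4 ^ M \<Longrightarrow> p * real (M + 1) \<le> u M x"
    by (rule multiscale_bump[OF \<Omega>(1) x0, where m = m]) blast
  define G where "G = real (?n ^ m) * D"
  have G: "G > 0" using D by (simp add: G_def)
  define V where "V = unit_ball_vol (real ?n) * r ^ ?n"
  have V: "V > 0" using r by (simp add: V_def)
  define U where "U = unit_ball_vol (real ?n) * \<rho> ^ ?n"
  have U: "U > 0" using \<rho> by (simp add: U_def)
  define c2 where "c2 = 1 + \<bar>ln U\<bar> + 2 * real ?n"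
  have c2: "c2 > 0" by (simp add: c2_def add_pos_nonneg)
  define c3 where "c3 = (c2 powr (1 - q) / (q - 1)) powr (1 / q)"
  have c3: "c3 > 0" using c2 q by (simp add: c3_def)
  define Z where "Z = C * real (m + 1) * (2 * G) * V powr (1 / q)"
  have Z: "Z > 0" using C(1) G V by (simp add: Z_def)
  \<comment> \<open>This \<open>\<epsilon>\<close> makes the resulting upper bound half of the lower bound.\<close>
  define \<epsilon> where "\<epsilon> = (p * c3 / (2 * Z)) powr q"
  have \<epsilon>0: "p * c3 / (2 * Z) > 0"
    using p c3 Z by simp
  have \<epsilon>: "\<epsilon> > 0" unfolding \<epsilon>_def by (rule powr_gt_zero[THEN iffD2]) (use \<epsilon>0 in linarith)
  obtain s0 where s0: "\<And>s. s \<ge> s0 \<Longrightarrow> A (ennreal s) \<le> ennreal (\<epsilon> * s powr (real ?n / real m))"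
    using small[OF \<epsilon>] by blast
  \<comment> \<open>For such \<open>M\<close>, the arguments \<open>2 G 2\<^sup>j\<^sup>m / l\<close> with \<open>j \<ge> M\<close>, at which \<open>A\<close> is evaluated, are
    at least \<open>s0\<close>: they are at least of order \<open>2\<^sup>M / l\<close>, and \<open>l\<close> grows at most linearly in
    \<open>M\<close>.\<close>
  obtain M where M: "\<bar>s0\<bar> * (1 + \<epsilon> * V) + \<bar>s0\<bar> * (\<epsilon> * V) * real M \<le> 2 ^ M"
    using eventually_happens'[OF sequentially_bot power2_eventually_dominates] by blast
  define N where "N = real (M + 1)"
  have N: "N \<ge> 1" by (simp add: N_def)
  define \<kappa> where "\<kappa> = (\<epsilon> * V * N) powr (1 / q)"
  have EVN: "\<epsilon> * V * N > 0" using \<epsilon> V N by simp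
  have \<kappa>: "\<kappa> > 0" unfolding \<kappa>_def by (rule powr_gt_zero[THEN iffD2]) (use EVN in linarith)
  have \<kappa>q: "\<kappa> powr q = \<epsilon> * V * N" using EVN q by (simp add: \<kappa>_def powr_powr)
  have \<kappa>le: "\<kappa> \<le> 1 + \<epsilon> * V * N"
  proof -
    have "\<kappa> \<le> (1 + \<epsilon> * V * N) powr (1 / q)"
      unfolding \<kappa>_def using EVN q by (intro powr_mono2) auto
    also have "\<dots> \<le> (1 + \<epsilon> * V * N) powr 1"
      using EVN q by (intro powr_mono) auto
    finally show ?thesis using EVN by simp
  qed
  \<comment> \<open>The value at which the \<open>N\<close> equal contributions to the modular add up to one.\<close>
  define l where "l = 2 * G * \<kappa>"
  have l: "l > 0" using G \<kappa> by (simp add: l_def)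
  have big: "s0 \<le> 2 * G * 2 ^ (M * m) / l"
  proof -
    have "s0 * \<kappa> \<le> \<bar>s0\<bar> * (1 + \<epsilon> * V * N)"
      using \<kappa>le \<kappa> by (intro mult_mono) auto
    also have "\<dots> = \<bar>s0\<bar> * (1 + \<epsilon> * V) + \<bar>s0\<bar> * (\<epsilon> * V) * real M"
      by (simp add: N_def algebra_simps)
    also have "\<dots> \<le> 2 ^ M" by (rule M)
    also have "\<dots> \<le> 2 ^ (M * m)" using m by (intro power_increasing) auto
    finally show ?thesis using G \<kappa> by (simp add: l_def field_simps)
  qed
  have lval: "real (M + 1) * (\<epsilon> * (2 * G / l) powr (real ?n / real m) * (unit_ball_vol (real ?n) * r ^ ?n)) \<le> 1"
  proof -
    have "2 * G / l = 1 / \<kappa>" using G \<kappa> by (simp add: l_def)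
    then have "(2 * G / l) powr q = 1 / (\<epsilon> * V * N)"
      using \<kappa> \<kappa>q by (simp add: powr_divide)
    then show ?thesis using EVN \<epsilon> V N unfolding q_def[symmetric] V_def[symmetric] N_def[symmetric] by simp
  qed
  have wd: "weakly_differentiable m \<Omega> (u M)" by (rule test_function_weakly_differentiable[OF \<Omega>(1) test])
  have norm: "orlicz_norm A \<Omega> (weak_grad_length \<Omega> k (u M)) \<le> ennreal l" if k: "k \<le> m" for k
  proof (rule multiscale_orlicz_norm_le[OF A s0 m(1) \<epsilon> r G l \<Omega>(1) _ big lval])
    let ?h = "\<lambda>x. \<Sum>j | j \<in> {M..2 * M} \<and> dist x0 x \<le> r / 2 ^ j. (2::real) ^ (j * m)"
    have "AE x in lebesgue. x \<in> \<Omega> \<longrightarrow> weak_grad_length \<Omega> k (u M) x \<le> real (?n ^ k) * (D * ?h x)"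
      using k by (intro weak_grad_length_test_function_le[OF \<Omega>(1) test] du) simp
    then show "AE x in lebesgue. x \<in> \<Omega> \<longrightarrow> \<bar>weak_grad_length \<Omega> k (u M) x\<bar> \<le> G * ?h x"
    proof eventually_elim
      case (elim x)
      have "real (?n ^ k) * (D * ?h x) \<le> real (?n ^ m) * (D * ?h x)"
        using k D by (intro mult_right_mono) (auto intro!: power_increasing mult_nonneg_nonneg sum_nonneg)
      with elim show ?case by (auto simp: G_def weak_grad_length_def mult.assoc)
    qed
  qed
  have uspace: "u M \<in> orlicz_sobolev_space m A \<Omega>"
    unfolding orlicz_sobolev_space_def orlicz_space_def
  proof (intro CollectI conjI allI impI wd)
    have "has_weak_partial \<Omega> [] (u M) (u M)" using test_function_has_weak_partial[OF \<Omega>(1) test, of "[]"] by simp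
    then show "u M \<in> borel_measurable (lebesgue_on \<Omega>)"
      by (intro locally_integrable_measurable[OF \<Omega>(1)]) (simp add: has_weak_partial_def)
    fix k assume k: "k \<le> m"
    show "weak_grad_length \<Omega> k (u M) \<in> borel_measurable (lebesgue_on \<Omega>)"
      by (rule borel_measurable_weak_grad_length[OF \<Omega>(1) wd k])
    show "orlicz_norm A \<Omega> (weak_grad_length \<Omega> k (u M)) < \<infinity>"
      using norm[OF k] by (auto intro: le_less_trans)
  qed
  have Wnorm: "orlicz_sobolev_norm m A \<Omega> (u M) \<le> ennreal (real (m + 1) * l)"
  proof -
    have "orlicz_sobolev_norm m A \<Omega> (u M) \<le> (\<Sum>k\<le>m. ennreal l)"
      unfolding orlicz_sobolev_norm_def by (intro sum_mono norm) simp
    also have "\<dots> = ennreal (real (m + 1) * l)"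
      using l by (subst ennreal_mult) (simp_all add: ennreal_of_nat_eq_real_of_nat[symmetric])
    finally show ?thesis .
  qed
  \<comment> \<open>The measure of the ball of radius \<open>\<rho> / 4\<^sup>M\<close>. Its logarithm is linear in \<open>M\<close>.\<close>
  define t0 where "t0 = U / (4 ^ M) ^ ?n"
  have t0: "t0 > 0" using U by (simp add: t0_def)
  have E: "emeasure lebesgue (ball x0 (\<rho> / 4 ^ M)) = ennreal t0"
    using \<rho> emeasure_ball[of "\<rho> / 4 ^ M" x0] by (simp add: t0_def U_def power_divide)
  have Esub: "ball x0 (\<rho> / 4 ^ M) \<subseteq> \<Omega>"
    using sub \<rho> by (intro order_trans[OF subset_ball sub]) (simp add: divide_le_eq one_le_power)
  have t01: "t0 \<le> 1"
    using emeasure_mono[OF Esub, of lebesgue] \<Omega> E by (simp add: ennreal_le_1)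
  have "ennreal (p * N * ((1 - ln t0) powr (1 - q) / (q - 1)) powr (1 / q)) \<le> LZ_norm q \<Omega> (u M)"
  proof (rule LZ_norm_ge[OF q _ t0 t01])
    fix t assume t: "0 < t" "t < t0"
    show "ennreal (p * N) \<le> max_rearrangement \<Omega> (u M) t"
    proof (rule max_rearrangement_ge[OF _ _ Esub])
      show "u M \<in> borel_measurable (lebesgue_on \<Omega>)" using uspace by (simp add: orlicz_sobolev_space_def)
      show "p * N \<le> \<bar>u M x\<bar>" if "x \<in> ball x0 (\<rho> / 4 ^ M)" for x
        using uge[of x M] that by (auto simp: N_def intro: order_trans)
      show "ennreal t < emeasure lebesgue (ball x0 (\<rho> / 4 ^ M))" unfolding E using t by (simp add: ennreal_less_iff)
    qed (use \<Omega> t in auto)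
  qed (use p N in simp)
  also have "\<dots> \<le> ennreal C * orlicz_sobolev_norm m A \<Omega> (u M)" by (rule C(2)[OF uspace])
  also have "\<dots> \<le> ennreal C * ennreal (real (m + 1) * l)" by (intro mult_left_mono Wnorm) simp
  also have "\<dots> = ennreal (C * (real (m + 1) * l))" using C by (intro ennreal_mult'[symmetric]) simp
  finally have main: "p * N * ((1 - ln t0) powr (1 - q) / (q - 1)) powr (1 / q) \<le> C * (real (m + 1) * l)"
    using C l by (subst (asm) ennreal_le_iff) auto
  have lnt0: "1 - ln t0 \<le> c2 * N" "1 - ln t0 > 0"
  proof -
    have "ln t0 = ln U - real ?n * (real M * ln 4)"
      using U by (simp add: t0_def ln_div ln_realpow)
    moreover have "ln (4::real) \<le> 2"
    proof -
      have "ln (4::real) = 2 * ln 2" using ln_realpow[of 2 2] by simp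
      then show ?thesis using ln_2_less_1 by simp
    qed
    then have "real ?n * (real M * ln 4) \<le> real ?n * (real M * 2)" by (intro mult_left_mono) auto
    moreover have "1 + \<bar>ln U\<bar> \<le> (1 + \<bar>ln U\<bar>) * N" using N by (simp add: mult_le_cancel_left1)
    moreover have "real ?n * (real M * 2) \<le> 2 * real ?n * N" by (simp add: N_def algebra_simps)
    moreover have "c2 * N = (1 + \<bar>ln U\<bar>) * N + 2 * real ?n * N" by (simp add: c2_def algebra_simps)
    ultimately show "1 - ln t0 \<le> c2 * N" by linarith
    have "ln t0 \<le> 0" using t0 t01 by simp
    then show "1 - ln t0 > 0" by simp
  qed
  have decr: "(c2 * N) powr (1 - q) \<le> (1 - ln t0) powr (1 - q)"
    using lnt0 q by (intro powr_mono2') auto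
  have "((c2 * N) powr (1 - q) / (q - 1)) powr (1 / q) \<le> ((1 - ln t0) powr (1 - q) / (q - 1)) powr (1 / q)"
    by (rule powr_mono2[OF _ _ divide_right_mono[OF decr]]) (use q in auto)
  then have "p * N * ((c2 * N) powr (1 - q) / (q - 1)) powr (1 / q) \<le> C * (real (m + 1) * l)"
    using main p N by (meson mult_left_mono order_trans mult_nonneg_nonneg less_imp_le zero_le_one)
  also have "((c2 * N) powr (1 - q) / (q - 1)) powr (1 / q) = c3 * N powr ((1 - q) / q)"
  proof -
    have "(c2 * N) powr (1 - q) / (q - 1) = (c2 powr (1 - q) / (q - 1)) * N powr (1 - q)"
      using c2 N by (simp add: powr_mult)
    then have "((c2 * N) powr (1 - q) / (q - 1)) powr (1 / q) = c3 * (N powr (1 - q)) powr (1 / q)"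
      using q unfolding c3_def by (simp only:) (subst powr_mult, auto)
    then show ?thesis by (simp add: powr_powr)
  qed
  also have "p * N * (c3 * N powr ((1 - q) / q)) = p * c3 * N powr (1 / q)"
  proof -
    have "N * N powr ((1 - q) / q) = N powr (1 + (1 - q) / q)" using N by (simp add: powr_add)
    also have "1 + (1 - q) / q = 1 / q" using q by (simp add: field_simps)
    finally show ?thesis by simp
  qed
  also have "C * (real (m + 1) * l) = Z * \<epsilon> powr (1 / q) * N powr (1 / q)"
    using \<epsilon> V N by (simp add: Z_def l_def \<kappa>_def powr_mult)
  also have "\<epsilon> powr (1 / q) = p * c3 / (2 * Z)"
  proof -
    have "\<epsilon> powr (1 / q) = (p * c3 / (2 * Z)) powr 1"
      using q unfolding \<epsilon>_def by (simp add: powr_powr del: powr_one_gt_zero_iff)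
    also have "\<dots> = p * c3 / (2 * Z)" by (rule powr_one) (use \<epsilon>0 in linarith)
    finally show ?thesis .
  qed
  also have "Z * (p * c3 / (2 * Z)) * N powr (1 / q) = p * c3 / 2 * N powr (1 / q)"
    using Z by simp
  finally have "p * c3 * N powr (1 / q) \<le> p * c3 / 2 * N powr (1 / q)" .
  moreover have "p * c3 / 2 * N powr (1 / q) = p * c3 * N powr (1 / q) / 2" by simp
  moreover have "p * c3 * N powr (1 / q) > 0" using p c3 N by simp
  ultimately show False by linarith
qed

section \<open>Sparse thresholds and the contradiction\<close>

lemma powr_ge_of_ge_powr_inverse:
  fixes x K a :: real
  assumes "a > 0" "K \<ge> 0" "x \<ge> K powr (1 / a)"
  shows "x powr a \<ge> K"
proof -
  have "K = (K powr (1 / a)) powr a" using assms by (simp add: powr_powr)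
  also have "\<dots> \<le> x powr a" using assms by (intro powr_mono2) auto
  finally show ?thesis .
qed

text \<open>Since \<open>q - 1 = 2\<delta>\<close> and \<open>ln S \<le> S\<close>, the slope \<open>c\<close> is at least \<open>S\<^sup>\<delta>\<close>. Hence the logarithms of
  \<open>S\<close> and of \<open>c\<close> are comparable, and powers of \<open>ln S\<close> may be replaced by powers of
  \<open>1 + ln c\<close>.\<close>

lemma thresholds_growth:
  fixes S c q \<delta> \<beta> :: real
  assumes \<delta>: "\<delta> > 0" and q: "q - 1 = 2 * \<delta>" and \<beta>: "\<beta> = \<delta> / q" and S: "exp 1 \<le> S"
    and c: "c = S powr (q - 1) * ln S powr (- \<delta>)"
  shows "S powr \<delta> \<le> c" "1 \<le> c" "ln S powr \<beta> \<le> (1 / \<delta>) powr \<beta> * (1 + ln c) powr \<beta>"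
    "S * (c * S) powr (- 1 / q) = ln S powr \<beta>" "c * S = S powr q * ln S powr (- \<delta>)"
proof -
  have S0: "S > 0" using S exp_gt_zero[of "1::real"] by linarith
  have S1: "S \<ge> 1" using S exp_ge_add_one_self[of 1] by linarith
  have L: "ln S \<ge> 1" using S S0 by (simp add: ln_ge_iff)
  have q1: "q > 1" using q \<delta> by simp
  have "ln S powr \<delta> \<le> S powr \<delta>"
    using L \<delta> ln_le_minus_one[OF S0] by (intro powr_mono2) auto
  then have "S powr \<delta> * ln S powr \<delta> \<le> S powr \<delta> * S powr \<delta>"
    by (intro mult_left_mono) auto
  also have "\<dots> = S powr (q - 1)" by (simp add: q powr_add[symmetric])
  finally show cS: "S powr \<delta> \<le> c" using L by (simp add: c powr_minus field_simps)
  have "1 \<le> S powr \<delta>" using S1 \<delta> by (simp add: ge_one_powr_ge_zero)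
  with cS show c1: "1 \<le> c" by linarith
  have "\<delta> * ln S = ln (S powr \<delta>)" using S0 by (simp add: ln_powr)
  also have "\<dots> \<le> ln c" using cS c1 S0 by (subst ln_le_cancel_iff) auto
  finally have "ln S \<le> 1 / \<delta> * (1 + ln c)" using \<delta> by (simp add: field_simps)
  then have "ln S powr \<beta> \<le> (1 / \<delta> * (1 + ln c)) powr \<beta>"
    using L \<delta> q1 \<beta> by (intro powr_mono2) auto
  also have "\<dots> = (1 / \<delta>) powr \<beta> * (1 + ln c) powr \<beta>"
    by (rule powr_mult)
  finally show "ln S powr \<beta> \<le> (1 / \<delta>) powr \<beta> * (1 + ln c) powr \<beta>" .
  have "S powr (q - 1) * S = S powr q"
    using S0 powr_add[of S "q - 1" 1] by simp
  then show cSq: "c * S = S powr q * ln S powr (- \<delta>)" by (simp add: c mult_ac)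
  have "(c * S) powr (- 1 / q) = (S powr q) powr (- 1 / q) * (ln S powr (- \<delta>)) powr (- 1 / q)"
    unfolding cSq by (rule powr_mult)
  also have "(S powr q) powr (- 1 / q) = 1 / S" using q1 S0 by (simp add: powr_powr powr_minus_divide)
  also have "(ln S powr (- \<delta>)) powr (- 1 / q) = ln S powr \<beta>" by (simp add: powr_powr \<beta>)
  finally show "S * (c * S) powr (- 1 / q) = ln S powr \<beta>" using S0 by simp
qed

text \<open>The values are chosen recursively as \<open>S\<^sub>k = (k + 1) s\<close>, where \<open>s\<close> is beyond a bound that
  depends on \<open>k\<close> and on the preceding value, and \<open>A(s)\<close> is large.\<close>

lemma sparse_thresholds:
  fixes A :: "ennreal \<Rightarrow> ennreal" and q \<delta> \<beta> V \<epsilon> :: real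
  assumes \<delta>: "\<delta> > 0" and \<beta>: "\<beta> > 0" and q: "q - 1 = 2 * \<delta>" and V: "V > 0" and \<epsilon>: "\<epsilon> > 0"
    and large: "\<And>s0. \<exists>s\<ge>s0. A (ennreal s) > ennreal (\<epsilon> * s powr q)"
  obtains S :: "nat \<Rightarrow> real" where
    "mono S" "\<And>k. exp 1 \<le> S k" "\<And>k. S k \<le> ln (S (Suc k)) powr \<beta>"
    "mono (\<lambda>k. S k powr (q - 1) * ln (S k) powr (- \<delta>))"
    "\<And>k. real (k + 1) \<le> S k powr \<delta>" "\<And>k. V * S k \<ge> 1"
    "\<And>k. real (k + 1) powr q * 2 ^ (k + 1) / \<epsilon> < ln (S k) powr \<delta>"
    "\<And>k. A (ennreal (S k / real (k + 1))) > ennreal (\<epsilon> * (S k / real (k + 1)) powr q)"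
proof -
  let ?c = "\<lambda>S. S powr (q - 1) * ln S powr (- \<delta>)"
  have c_ge: "S powr \<delta> \<le> ?c S" if "S \<ge> exp 1" for S
    by (rule thresholds_growth(1)[OF \<delta> q refl that refl])
  let ?P = "\<lambda>k S. exp 1 \<le> S \<and> real (k + 1) \<le> S powr \<delta> \<and> V * S \<ge> 1 \<and>
      real (k + 1) powr q * 2 ^ (k + 1) / \<epsilon> < ln S powr \<delta> \<and>
      A (ennreal (S / real (k + 1))) > ennreal (\<epsilon> * (S / real (k + 1)) powr q)"
  let ?Q = "\<lambda>S' S. S' \<le> S \<and> S' \<le> ln S powr \<beta> \<and> ?c S' \<le> ?c S"
  have ex: "\<exists>S. ?P k S \<and> ?Q S' S" for k S'
  proof -
    define R where "R = real (k + 1) powr q * 2 ^ (k + 1) / \<epsilon> + 1"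
    define K where "K = max (real (k + 1)) (?c S')"
    have R: "R \<ge> 0" unfolding R_def using \<epsilon> by (intro add_nonneg_nonneg) auto
    have K: "K \<ge> 0" by (simp add: K_def)
    \<comment> \<open>Each summand enforces one of the required lower bounds for \<open>S\<close>.\<close>
    define s0 where "s0 = exp 1 + \<bar>S'\<bar> + exp (\<bar>S'\<bar> powr (1 / \<beta>)) + exp (R powr (1 / \<delta>)) + K powr (1 / \<delta>) + 1 / V"
    have terms: "exp (1::real) > 0" "\<bar>S'\<bar> \<ge> 0" "exp (\<bar>S'\<bar> powr (1 / \<beta>)) > 0" "exp (R powr (1 / \<delta>)) > 0"
      "K powr (1 / \<delta>) \<ge> 0" "1 / V > 0"
      using V by simp_all
    obtain s where s: "s \<ge> s0" "A (ennreal s) > ennreal (\<epsilon> * s powr q)" using large by blast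
    define S where "S = real (k + 1) * s"
    have "s0 \<ge> exp 1" unfolding s0_def using terms by linarith
    then have s_pos: "s > 0" using s(1) exp_gt_zero[of "1::real"] by linarith
    then have "s \<le> S" by (simp add: S_def)
    then have "s0 \<le> S" using s(1) by linarith
    then have S: "exp 1 \<le> S" "\<bar>S'\<bar> \<le> S" "exp (\<bar>S'\<bar> powr (1 / \<beta>)) \<le> S" "exp (R powr (1 / \<delta>)) \<le> S"
      "K powr (1 / \<delta>) \<le> S" "1 / V \<le> S"
      using terms unfolding s0_def by linarith+
    have S0: "S > 0" using S(1) exp_gt_zero[of "1::real"] by linarith
    have L: "\<bar>S'\<bar> powr (1 / \<beta>) \<le> ln S" "R powr (1 / \<delta>) \<le> ln S"
      using S(3,4) S0 by (simp_all add: ln_ge_iff)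
    have "\<bar>S'\<bar> \<le> ln S powr \<beta>" by (rule powr_ge_of_ge_powr_inverse[OF \<beta> _ L(1)]) simp
    moreover have "R \<le> ln S powr \<delta>" by (rule powr_ge_of_ge_powr_inverse[OF \<delta> R L(2)])
    moreover have "K \<le> S powr \<delta>" by (rule powr_ge_of_ge_powr_inverse[OF \<delta> K S(5)])
    moreover have "V * S \<ge> 1" using S(6) V by (simp add: field_simps)
    moreover have "S / real (k + 1) = s" by (simp add: S_def)
    ultimately have "?P k S" "?Q S' S"
      using S s(2) c_ge[OF S(1)] by (auto simp: R_def K_def)
    then show ?thesis by blast
  qed
  have "\<exists>S. \<forall>k. ?P k (S k) \<and> ?Q (S k) (S (Suc k))"
  proof (rule dependent_nat_choice)
    show "\<exists>S. ?P 0 S" using ex[of 0 0] by blast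
    show "\<exists>S. ?P (Suc k) S \<and> ?Q S' S" for S' k by (rule ex)
  qed
  then obtain S where S: "\<And>k. ?P k (S k) \<and> ?Q (S k) (S (Suc k))" by blast
  show ?thesis
  proof (rule that[of S])
    show "mono S" "mono (\<lambda>k. S k powr (q - 1) * ln (S k) powr (- \<delta>))"
      using S by (auto simp: mono_iff_le_Suc)
  qed (use S in blast)+
qed

lemma ennreal_le_suminf: "g k \<le> (\<Sum>k. g k)" for g :: "nat \<Rightarrow> ennreal"
  using sum_le_suminf[of g "{k}"] by simp

text \<open>Take concentric balls of measures \<open>\<mu>\<^sub>k = 1 / (2\<^sup>k\<^sup>+\<^sup>1 c\<^sub>k S\<^sub>k)\<close>, and let \<open>f\<close> be \<open>S\<^sub>k\<close> between the
  \<open>k\<close>-th and the next ball. Since \<open>B(S\<^sub>k) \<le> c\<^sub>k S\<^sub>k\<close> for the step function \<open>B\<close>, the integral of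
  \<open>B(f)\<close> is at most the sum of \<open>c\<^sub>k S\<^sub>k \<mu>\<^sub>k\<close>, which is one. For every \<open>l\<close>, however,
  \<open>f / l \<ge> S\<^sub>k / (k + 1)\<close> on the \<open>k\<close>-th ball as soon as \<open>k \<ge> l\<close>, so that the integral of
  \<open>A(f / l)\<close> exceeds \<open>A(S\<^sub>k / (k + 1)) \<mu>\<^sub>k > 1\<close>.\<close>

lemma step_young_separation:
  fixes \<Omega> :: "(real ^ 'n) set" and S c :: "nat \<Rightarrow> real" and A :: "ennreal \<Rightarrow> ennreal"
  assumes \<Omega>: "open \<Omega>" and ball: "ball x0 r \<subseteq> \<Omega>" "r > 0"
    and S: "mono S" "\<And>k. S k > 0" and c: "mono c" "\<And>k. c k \<ge> 1"
    and V: "\<And>k. unit_ball_vol (real CARD('n)) * r ^ CARD('n) * S k \<ge> 1"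
    and A: "quasi_convex A"
    and large: "\<And>k. A (ennreal (S k / real (k + 1))) > ennreal (c k * S k * 2 ^ (k + 1))"
  obtains f where "f \<in> orlicz_space (step_young S c) \<Omega>" "f \<notin> orlicz_space A \<Omega>"
proof -
  let ?n = "CARD('n)"
  let ?B = "step_young S c"
  define \<omega> where "\<omega> = unit_ball_vol (real ?n)"
  have \<omega>: "\<omega> > 0" by (simp add: \<omega>_def)
  define \<mu> where "\<mu> k = 1 / (c k * S k * 2 ^ (k + 1))" for k
  have cS: "c k * S k > 0" for k using c(2)[of k] S(2)[of k] by simp
  have ne: "c k \<noteq> 0" "S k \<noteq> 0" for k using c(2)[of k] S(2)[of k] by auto
  have cS2: "c k * S k * 2 ^ j > 0" for k j by (intro mult_pos_pos cS) simp
  have \<mu>: "\<mu> k > 0" for k unfolding \<mu>_def by (intro divide_pos_pos cS2) simp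
  have \<mu>_Suc: "\<mu> (Suc k) \<le> \<mu> k" for k
  proof -
    have le: "c k * S k * 2 ^ (k + 1) \<le> c (Suc k) * S (Suc k) * 2 ^ (Suc k + 1)"
      using monoD[OF c(1), of k "Suc k"] monoD[OF S(1), of k "Suc k"] c(2)[of k] c(2)[of "Suc k"] S(2)[of k] S(2)[of "Suc k"]
      by (intro mult_mono power_increasing) auto
    show ?thesis unfolding \<mu>_def by (rule frac_le[OF zero_le_one order_refl cS2 le])
  qed
  define \<rho> where "\<rho> k = root ?n (\<mu> k / \<omega>)" for k
  have \<rho>0: "\<rho> k > 0" for k using \<mu> \<omega> by (simp add: \<rho>_def)
  have \<rho>n: "\<omega> * \<rho> k ^ ?n = \<mu> k" for k
    using \<mu>[of k] \<omega> by (simp add: \<rho>_def real_root_pow_pos2)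
  have \<rho>_anti: "\<rho> (Suc k) \<le> \<rho> k" for k
    unfolding \<rho>_def using \<mu>_Suc[of k] \<omega> by (intro real_root_le_mono divide_right_mono) auto
  then have \<rho>dec: "decseq \<rho>" by (rule decseq_SucI)
  \<comment> \<open>By the hypothesis on the volume of \<open>ball x0 r\<close>, all balls lie in \<open>\<Omega>\<close>.\<close>
  have \<rho>r: "\<rho> k \<le> r" for k
  proof -
    have "1 * S k \<le> c k * S k" using c(2)[of k] S(2)[of k] by (intro mult_right_mono) auto
    moreover have "c k * S k * 1 \<le> c k * S k * 2 ^ (k + 1)"
      using cS[of k] by (intro mult_left_mono one_le_power) auto
    ultimately have "S k \<le> c k * S k * 2 ^ (k + 1)" by linarith
    then have "\<mu> k \<le> 1 / S k" unfolding \<mu>_def using S(2)[of k] by (intro frac_le) auto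
    also have "\<dots> \<le> \<omega> * r ^ ?n" using V[of k] S(2)[of k] by (simp add: \<omega>_def field_simps)
    finally have "\<rho> k ^ ?n \<le> r ^ ?n" using \<rho>n[of k] \<omega> by (metis (no_types) mult_le_cancel_left_pos)
    then show ?thesis using power_mono_iff[of "\<rho> k" r ?n] \<rho>0[of k] ball(2) by simp
  qed
  have eball: "emeasure lebesgue (ball x0 (\<rho> k)) = ennreal (\<mu> k)" for k
    using emeasure_ball[of "\<rho> k" x0] \<rho>0[of k] \<rho>n[of k] by (simp add: \<omega>_def less_imp_le)
  have \<mu>0: "\<mu> \<longlonglongrightarrow> 0"
  proof (rule tendsto_sandwich[of "\<lambda>_. 0" _ _ "\<lambda>k. (1 / S 0) * (1 / 2) ^ k"])
    show "\<forall>\<^sub>F k in sequentially. \<mu> k \<le> (1 / S 0) * (1 / 2) ^ k"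
    proof (intro always_eventually allI)
      fix k
      have "1 * S 0 * 2 ^ k \<le> c k * S k * 2 ^ (k + 1)"
        using c(2)[of k] monoD[OF S(1), of 0 k] S(2)[of 0] by (intro mult_mono power_increasing) auto
      then have "\<mu> k \<le> 1 / (1 * S 0 * 2 ^ k)" unfolding \<mu>_def using S(2)[of 0] by (intro frac_le) auto
      then show "\<mu> k \<le> (1 / S 0) * (1 / 2) ^ k" by (simp add: power_one_over)
    qed
    have "(\<lambda>k. (1 / S 0) * (1 / 2 :: real) ^ k) \<longlonglongrightarrow> (1 / S 0) * 0"
      by (intro tendsto_intros LIMSEQ_realpow_zero) auto
    then show "(\<lambda>k. (1 / S 0) * (1 / 2 :: real) ^ k) \<longlonglongrightarrow> 0" by simp
  qed (auto simp: \<mu> less_imp_le)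
  have \<rho>lim: "\<exists>k. \<rho> (Suc k) \<le> d" if d: "d > 0" for d
  proof -
    have "eventually (\<lambda>k. \<mu> k < \<omega> * d ^ ?n) sequentially"
      using order_tendstoD(2)[OF \<mu>0] \<omega> d by simp
    then obtain k where "\<mu> k < \<omega> * d ^ ?n" by (auto simp: eventually_sequentially)
    then have "\<rho> k ^ ?n < d ^ ?n" using \<rho>n[of k] \<omega> by (metis (no_types) mult_less_cancel_left_pos)
    then have "\<rho> k < d" using d by (meson less_imp_le power_less_imp_less_base)
    then show ?thesis using \<rho>_anti[of k] by (intro exI[of _ k]) linarith
  qed
  \<comment> \<open>The index of the shell that contains \<open>x\<close>; it exists for \<open>x \<noteq> x0\<close> because the radii tend
    to zero.\<close>
  define \<kappa> where "\<kappa> x = (LEAST k. \<rho> (Suc k) \<le> dist x0 x)" for x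
  define f where "f x = (if x \<noteq> x0 \<and> dist x0 x < \<rho> 0 then S (\<kappa> x) else 0)" for x
  have \<kappa>1: "dist x0 x < \<rho> (\<kappa> x)" if "x \<noteq> x0" "dist x0 x < \<rho> 0" for x
  proof (cases "\<kappa> x")
    case (Suc j)
    then have "\<not> \<rho> (Suc j) \<le> dist x0 x" unfolding \<kappa>_def by (intro not_less_Least) simp
    then show ?thesis by (simp add: Suc)
  qed (use that in simp)
  have \<kappa>2: "k \<le> \<kappa> x" if x: "x \<noteq> x0" "dist x0 x < \<rho> k" for x k
  proof -
    have "\<rho> (Suc (\<kappa> x)) \<le> dist x0 x"
      unfolding \<kappa>_def
      by (rule LeastI_ex[of "\<lambda>k. \<rho> (Suc k) \<le> dist x0 x"], rule \<rho>lim) (use x(1) in simp)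
    then have "\<rho> (Suc (\<kappa> x)) < \<rho> k" using x(2) by linarith
    then have "\<not> Suc (\<kappa> x) \<le> k" using decseqD[OF \<rho>dec, of "Suc (\<kappa> x)" k] by linarith
    then show ?thesis by simp
  qed
  have f0: "f x \<ge> 0" for x using S(2) by (simp add: f_def less_imp_le)
  have fge: "f x \<ge> S k" if "x \<noteq> x0" "dist x0 x < \<rho> k" for x k
  proof -
    have "dist x0 x < \<rho> 0" using that(2) decseqD[OF \<rho>dec, of 0 k] by simp
    then show ?thesis using that monoD[OF S(1) \<kappa>2[OF that]] by (simp add: f_def)
  qed
  have fm: "f \<in> borel_measurable borel"
  proof -
    have "(\<lambda>x. LEAST k. \<rho> (Suc k) \<le> dist x0 x) \<in> measurable borel (count_space UNIV)"
      by measurable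
    then have [measurable]: "\<kappa> \<in> measurable borel (count_space UNIV)"
      by (simp add: \<kappa>_def[abs_def])
    show ?thesis unfolding f_def[abs_def] by measurable
  qed
  then have "f \<in> borel_measurable lebesgue" by (intro measurable_completion) simp
  then have fm': "f \<in> borel_measurable (lebesgue_on \<Omega>)" by (rule measurable_restrict_space1)
  have "(\<integral>\<^sup>+ x. ?B (ennreal (\<bar>f x\<bar> / 1)) \<partial>lebesgue_on \<Omega>) = (\<integral>\<^sup>+ x. ?B (ennreal (f x)) * indicator \<Omega> x \<partial>lebesgue)"
    by (subst nn_integral_lebesgue_on[OF \<Omega>]) (simp add: f0)
  also have "\<dots> \<le> (\<integral>\<^sup>+ x. (\<Sum>k. ennreal (c k * S k) * indicator (ball x0 (\<rho> k)) x) \<partial>lebesgue)"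
  proof (rule nn_integral_mono)
    fix x
    show "?B (ennreal (f x)) * indicator \<Omega> x \<le> (\<Sum>k. ennreal (c k * S k) * indicator (ball x0 (\<rho> k)) x)"
    proof (cases "x \<noteq> x0 \<and> dist x0 x < \<rho> 0")
      case True
      let ?k = "\<kappa> x"
      have "?B (ennreal (f x)) * indicator \<Omega> x \<le> ?B (ennreal (S ?k))"
        using True by (auto simp: f_def indicator_def)
      also have "\<dots> \<le> ennreal (c ?k) * ennreal (S ?k)" by (rule step_young_le[OF S(1) c(1)]) simp
      also have "\<dots> = ennreal (c ?k * S ?k) * indicator (ball x0 (\<rho> ?k)) x"
        using \<kappa>1[of x] True c(2)[of ?k] by (simp add: ennreal_mult')
      also have "\<dots> \<le> (\<Sum>k. ennreal (c k * S k) * indicator (ball x0 (\<rho> k)) x)"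
        by (rule ennreal_le_suminf)
      finally show ?thesis .
    next
      case False
      then have "f x = 0" by (auto simp: f_def)
      then show ?thesis by (simp add: step_young_def)
    qed
  qed
  also have "\<dots> = (\<Sum>k. \<integral>\<^sup>+ x. ennreal (c k * S k) * indicator (ball x0 (\<rho> k)) x \<partial>lebesgue)"
    by (intro nn_integral_suminf borel_measurable_times_ennreal borel_measurable_const borel_measurable_indicator) simp
  also have "\<dots> = (\<Sum>k. ennreal ((1 / 2) ^ Suc k))"
  proof (rule suminf_cong)
    fix k
    have "ball x0 (\<rho> k) \<in> sets lebesgue" by simp
    then have "(\<integral>\<^sup>+ x. ennreal (c k * S k) * indicator (ball x0 (\<rho> k)) x \<partial>lebesgue) = ennreal (c k * S k) * ennreal (\<mu> k)"
      by (simp only: nn_integral_cmult_indicator eball)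
    also have "\<dots> = ennreal (c k * S k * \<mu> k)" using cS[of k] by (intro ennreal_mult'[symmetric]) simp
    also have "c k * S k * \<mu> k = (1 / 2) ^ Suc k" using ne[of k] by (simp add: \<mu>_def power_one_over)
    finally show "(\<integral>\<^sup>+ x. ennreal (c k * S k) * indicator (ball x0 (\<rho> k)) x \<partial>lebesgue) = ennreal ((1 / 2) ^ Suc k)" .
  qed
  also have "\<dots> = ennreal 1"
    by (rule suminf_ennreal_eq[OF _ power_half_series]) simp
  finally have "orlicz_norm ?B \<Omega> f \<le> ennreal 1"
    unfolding orlicz_norm_def by (intro Inf_lower) auto
  then have fB: "f \<in> orlicz_space ?B \<Omega>"
    using fm' by (auto simp: orlicz_space_def intro: le_less_trans)
  have "f \<notin> orlicz_space A \<Omega>"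
  proof
    assume "f \<in> orlicz_space A \<Omega>"
    then have "orlicz_norm A \<Omega> f < \<infinity>" by (simp add: orlicz_space_def)
    then obtain l where l: "l > 0" "(\<integral>\<^sup>+ x. A (ennreal (\<bar>f x\<bar> / l)) \<partial>lebesgue_on \<Omega>) \<le> 1"
      unfolding orlicz_norm_def Inf_less_iff by auto
    obtain k where k: "l \<le> real k" using real_arch_simple by blast
    have bsub: "ball x0 (\<rho> k) \<subseteq> \<Omega>" using \<rho>r[of k] ball(1) by (meson order_trans subset_ball)
    let ?a = "A (ennreal (S k / real (k + 1)))"
    have "1 = ennreal (c k * S k * 2 ^ (k + 1) * \<mu> k)" using ne[of k] by (simp add: \<mu>_def)
    also have "\<dots> = ennreal (c k * S k * 2 ^ (k + 1)) * ennreal (\<mu> k)"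
      using cS[of k] by (intro ennreal_mult') simp
    also have "\<dots> < ?a * ennreal (\<mu> k)"
      using large[of k] \<mu>[of k] by (intro ennreal_mult_strict_right_mono) auto
    also have "\<dots> = (\<integral>\<^sup>+ x. ?a * indicator (ball x0 (\<rho> k)) x \<partial>lebesgue)"
    proof -
      have "ball x0 (\<rho> k) \<in> sets lebesgue" by simp
      then show ?thesis by (simp only: nn_integral_cmult_indicator eball)
    qed
    also have "\<dots> \<le> (\<integral>\<^sup>+ x. A (ennreal (\<bar>f x\<bar> / l)) * indicator \<Omega> x \<partial>lebesgue)"
    proof (rule nn_integral_mono_AE)
      have "AE x in lebesgue. x \<noteq> x0" by (rule AE_completion[OF AE_lborel_singleton])
      then show "AE x in lebesgue. ?a * indicator (ball x0 (\<rho> k)) x \<le> A (ennreal (\<bar>f x\<bar> / l)) * indicator \<Omega> x"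
      proof eventually_elim
        case (elim x)
        show ?case
        proof (cases "x \<in> ball x0 (\<rho> k)")
          case True
          have "S k / real (k + 1) \<le> \<bar>f x\<bar> / l"
            using fge[OF elim, of k] True k l(1) S(2)[of k] by (intro frac_le) auto
          then have "?a \<le> A (ennreal (\<bar>f x\<bar> / l))"
            by (intro quasi_convex_mono[OF A] ennreal_leI) auto
          then show ?thesis using True bsub by auto
        qed simp
      qed
    qed
    also have "\<dots> = (\<integral>\<^sup>+ x. A (ennreal (\<bar>f x\<bar> / l)) \<partial>lebesgue_on \<Omega>)"
      by (rule nn_integral_lebesgue_on[OF \<Omega>, symmetric])
    also have "\<dots> \<le> 1" by (rule l(2))
    finally show False by simp
  qed
  then show ?thesis using that fB by blast
qed

theorem theorem4p10:
  fixes \<Omega> :: "(real ^ 'n) set" and m :: nat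
  assumes "CARD('n) \<ge> 2" and "1 \<le> m" and "m \<le> CARD('n) - 1"
    and "bounded_lipschitz_domain \<Omega>" and "emeasure lebesgue \<Omega> = 1"
  shows "\<not> (\<exists>A. largest_orlicz_space \<Omega>
    (\<lambda>B. continuously_embedded
       (orlicz_sobolev_space m B \<Omega>) (orlicz_sobolev_norm m B \<Omega>)
       (LZ_space (real CARD('n) / real m) \<Omega>) (LZ_norm (real CARD('n) / real m) \<Omega>)) A)"
proof
  let ?P = "\<lambda>B. continuously_embedded
       (orlicz_sobolev_space m B \<Omega>) (orlicz_sobolev_norm m B \<Omega>)
       (LZ_space (real CARD('n) / real m) \<Omega>) (LZ_norm (real CARD('n) / real m) \<Omega>)"
  assume "\<exists>A. largest_orlicz_space \<Omega> ?P A"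
  then obtain A where A: "quasi_convex A" "?P A"
    and largest: "\<And>B. quasi_convex B \<Longrightarrow> ?P B \<Longrightarrow> orlicz_space B \<Omega> \<subseteq> orlicz_space A \<Omega>"
    unfolding largest_orlicz_space_def by blast
  have m: "1 \<le> m" "m < CARD('n)" using assms(1-3) by auto
  have op: "open \<Omega>" "\<Omega> \<noteq> {}" using assms(4) by (auto simp: bounded_lipschitz_domain_def)
  define q where "q = real CARD('n) / real m"
  have q: "q > 1" using m by (simp add: q_def)
  \<comment> \<open>Any \<open>\<delta>\<close> with \<open>0 < \<delta> < q - 1\<close> gives a loss in \<open>B\<close> that keeps \<open>(1 - \<beta>) q = q - \<delta>\<close> above
    one. The midpoint is convenient.\<close>
  define \<delta> where "\<delta> = (q - 1) / 2"
  define \<beta> where "\<beta> = \<delta> / q"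
  have \<delta>: "\<delta> > 0" "q - 1 = 2 * \<delta>" using q by (auto simp: \<delta>_def)
  have \<beta>: "\<beta> > 0" using \<delta> q by (simp add: \<beta>_def)
  have \<beta>q: "(1 - \<beta>) * q > 1"
  proof -
    have "(1 - \<beta>) * q = q - \<delta>" using q by (simp add: \<beta>_def left_diff_distrib)
    also have "\<dots> > 1" using q \<delta>(2) by linarith
    finally show ?thesis .
  qed
  obtain \<epsilon> where \<epsilon>: "\<epsilon> > 0" and large: "\<And>s0. \<exists>s\<ge>s0. A (ennreal s) > ennreal (\<epsilon> * s powr q)"
    using embedded_imp_large[OF op assms(5) m A] unfolding q_def by blast
  obtain x0 r where x0: "r > 0" "ball x0 r \<subseteq> \<Omega>" using op by (metis all_not_in_conv openE)
  define V where "V = unit_ball_vol (real CARD('n)) * r ^ CARD('n)"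
  have V: "V > 0" using x0 by (simp add: V_def)
  obtain S where S: "mono S" "\<And>k. exp 1 \<le> S k" "\<And>k. S k \<le> ln (S (Suc k)) powr \<beta>"
    "mono (\<lambda>k. S k powr (q - 1) * ln (S k) powr (- \<delta>))"
    "\<And>k. real (k + 1) \<le> S k powr \<delta>" "\<And>k. V * S k \<ge> 1"
    "\<And>k. real (k + 1) powr q * 2 ^ (k + 1) / \<epsilon> < ln (S k) powr \<delta>"
    "\<And>k. A (ennreal (S k / real (k + 1))) > ennreal (\<epsilon> * (S k / real (k + 1)) powr q)"
    by (rule sparse_thresholds[OF \<delta>(1) \<beta> \<delta>(2) V \<epsilon> large]) blast
  define c where "c k = S k powr (q - 1) * ln (S k) powr (- \<delta>)" for k
  have S0: "S k > 0" for k using S(2)[of k] exp_gt_zero[of "1::real"] by linarith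
  have L: "ln (S k) \<ge> 1" for k using S(2)[of k] S0[of k] by (simp add: ln_ge_iff)
  note growth = thresholds_growth[OF \<delta> \<beta>_def S(2) c_def]
  have cmono: "mono c" using S(4) by (simp add: c_def[abs_def])
  have clim: "filterlim c at_top sequentially"
  proof (rule filterlim_at_top_mono[OF filterlim_real_sequentially])
    show "\<forall>\<^sub>F k in sequentially. real k \<le> c k"
    proof (intro always_eventually allI)
      show "real k \<le> c k" for k using S(5)[of k] growth(1)[of k] by linarith
    qed
  qed
  define K0 where "K0 = (1 / \<delta>) powr \<beta>"
  have K0: "K0 \<ge> 0" by (simp add: K0_def)
  let ?B = "step_young S c"
  have th: "step_threshold S k \<le> K0 * (1 + ln (c k)) powr \<beta>" for k
  proof (cases k)
    case (Suc j)
    then show ?thesis using S(3)[of j] growth(3)[of k] by (simp add: step_threshold_def K0_def)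
  qed (use K0 in \<open>simp add: step_threshold_def\<close>)
  have lev: "S k * (c k * S k) powr (- real m / real CARD('n)) \<le> K0 * (1 + ln (c k)) powr \<beta>" for k
  proof -
    have "- real m / real CARD('n) = - 1 / q" using m by (simp add: q_def)
    then show ?thesis using growth(3,4)[of k] by (simp add: K0_def)
  qed
  have "?P ?B"
    by (rule step_young_embedded[OF assms(4) m S(1) S0 cmono growth(2) clim _ _ K0 th lev])
       (use \<beta> \<beta>q in \<open>auto simp: q_def\<close>)
  moreover have qc: "quasi_convex ?B"
    by (rule step_young_quasi_convex[OF S(1) S0 cmono]) (use growth(2)[of 0] in linarith)
  ultimately have sub: "orlicz_space ?B \<Omega> \<subseteq> orlicz_space A \<Omega>" by (intro largest)
  \<comment> \<open>The factor \<open>(k + 1)\<^sup>q 2\<^sup>k\<^sup>+\<^sup>1 / \<epsilon>\<close> is absorbed by the logarithmic loss in \<open>B\<close>.\<close>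
  have A_large: "A (ennreal (S k / real (k + 1))) > ennreal (c k * S k * 2 ^ (k + 1))" for k
  proof (rule le_less_trans[OF ennreal_leI S(8)])
    have Ld: "ln (S k) powr \<delta> > 0" using L[of k] by simp
    have "real (k + 1) powr q * 2 ^ (k + 1) \<le> \<epsilon> * ln (S k) powr \<delta>"
      using S(7)[of k] \<epsilon> by (simp add: field_simps)
    then have "S k powr q * (real (k + 1) powr q * 2 ^ (k + 1)) \<le> S k powr q * (\<epsilon> * ln (S k) powr \<delta>)"
      by (intro mult_left_mono) auto
    then have "S k powr q * 2 ^ (k + 1) / ln (S k) powr \<delta> \<le> \<epsilon> * (S k powr q / real (k + 1) powr q)"
      using Ld by (simp add: field_simps)
    moreover have "c k * S k * 2 ^ (k + 1) = S k powr q * 2 ^ (k + 1) / ln (S k) powr \<delta>"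
      unfolding growth(5)[of k] by (simp add: powr_minus_divide)
    moreover have "(S k / real (k + 1)) powr q = S k powr q / real (k + 1) powr q"
      by (rule powr_divide)
    ultimately show "c k * S k * 2 ^ (k + 1) \<le> \<epsilon> * (S k / real (k + 1)) powr q" by simp
  qed
  obtain f where "f \<in> orlicz_space ?B \<Omega>" "f \<notin> orlicz_space A \<Omega>"
    by (rule step_young_separation[OF op(1) x0(2,1) S(1) S0 cmono growth(2) S(6)[unfolded V_def] A(1) A_large])
  with sub show False by blast
qed

end
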